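(* If $\Lambda$ is a cyclic non-selfinjective Nakayama algebra which is defined by $r$ many irredundant relations, then $\varphi\dim\Lambda$, $\mathrm{fin.dim}\,\Lambda$, $\mathrm{gor.dim}\,\Lambda$ and $\mathrm{dom.dim}\,\Lambda$ are bounded above by $2r$.
   Context: $\mathbb{K}$ is an algebraically closed field; modules are finitely generated. Cyclic Nakayama algebra: $\Lambda=\mathbb{K}Q/I$, where $Q$ is the cyclic quiver with vertices $1,\dots,N$ ($N\ge 2$) and arrows $\alpha_i:i\to i+1$ (with $\alpha_N:N\to 1$; indices modulo $N$), and $I$ is generated by an irredundant system of $r\ge1$ relations $\alpha_{k_{2i}}\cdots\alpha_{k_{2i-1}+1}\alpha_{k_{2i-1}}=0$ ($1\le i\le r$), each a path of length at least two, with $1\le k_1<k_3<\dots<k_{2r-1}\le N$ (irredundant: no relation is a consequence of the others). $\mathrm{fin.dim}\,\Lambda$ is the supremum of the projective dimensions of the modules of finite projective dimension. $\Lambda$ is Gorenstein if every injective module has finite projective dimension, and $\mathrm{gor.dim}\,\Lambda$ is then the supremum of the projective dimensions of injective modules (it is defined only for Gorenstein $\Lambda$). The dominant dimension is $\mathrm{dom.dim}\,\Lambda=\sup\{m: I_i\text{ is projective for } i=0,\dots,m\}+1$, where $0\to \Lambda\to I_0\to I_1\to\cdots$ is the minimal injective resolution of $\Lambda$. $\varphi$-dimension: let $K_0$ be the abelian group generated by symbols $[X]$, $X$ a finitely generated $\Lambda$-module, modulo $[A_1]=[A_2]+[A_3]$ if $A_1\cong A_2\oplus A_3$ and $[P]=0$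 for $P$ projective. Let $L:K_0\to K_0$, $L[M]=[\Omega M]$ with $\Omega$ the syzygy. Let $\langle \mathrm{add}\,M\rangle$ be the subgroup of $K_0$ generated by the classes of all indecomposable summands of $M$. Then $\varphi(M):=\min\{t\ge0: \mathrm{rank}\,L^t\langle\mathrm{add}\,M\rangle=\mathrm{rank}\,L^{t+j}\langle\mathrm{add}\,M\rangle\ \text{for all } j\geq 1\}$ and $\varphi\dim \Lambda:=\sup\{\varphi(M): M\in\mathrm{mod}\,\Lambda\}$. *)

theory Defs
  imports
    "HOL-Algebra.Algebra"
    "HOL-Library.Extended_Nat"
    "HOL-Library.Poly_Mapping"
    "HOL-Computational_Algebra.Polynomial"
    "Graph_Theory.Arc_Walk"
begin

section \<open>Path algebras and cyclic Nakayama algebras\<close>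

text \<open>
  A quiver is a directed multigraph; a path is a triple \<open>(u, p, v)\<close> consisting of its source, the
  list of its arrows in the order in which they are traversed, and its target. The trivial path
  at \<open>u\<close> is \<open>(u, [], u)\<close>.
\<close>

type_synonym ('v, 'e) qpath = "'v \<times> 'e list \<times> 'v"

definition qpaths :: "('v, 'e) pre_digraph \<Rightarrow> ('v, 'e) qpath set" where
  "qpaths Q = {(u, p, v). pre_digraph.awalk Q u p v}"

text \<open>
  Paths are multiplied like functions: the product of \<open>(u', q, v')\<close> and \<open>(u, p, v)\<close> is
  ``first \<open>p\<close>, then \<open>q\<close>'' if \<open>v = u'\<close>, and zero otherwise. Hence a product of arrows
  \<open>\<alpha>\<^sub>m \<cdots> \<alpha>\<^sub>2 \<alpha>\<^sub>1\<close> is the path with arrow list \<open>[\<alpha>\<^sub>1, \<alpha>\<^sub>2, \<dots>, \<alpha>\<^sub>m]\<close>, and left modules over the path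
  algebra are covariant representations of the quiver.
\<close>

definition qpath_prod ::
    "('v, 'e) qpath \<Rightarrow> ('v, 'e) qpath \<Rightarrow> 'k::field \<Rightarrow> ('v, 'e) qpath \<Rightarrow>\<^sub>0 'k" where
  "qpath_prod x y c = (case (x, y) of ((u', q, v'), (u, p, v)) \<Rightarrow>
     if v = u' then Poly_Mapping.single (u, p @ q, v') c else 0)"

definition path_algebra ::
    "('v, 'e) pre_digraph \<Rightarrow> (('v, 'e) qpath \<Rightarrow>\<^sub>0 'k::field) ring" where
  "path_algebra Q =
     \<lparr>carrier = {f. Poly_Mapping.keys f \<subseteq> qpaths Q},
      monoid.mult = (\<lambda>f g. \<Sum>x\<in>Poly_Mapping.keys f. \<Sum>y\<in>Poly_Mapping.keys g.
        qpath_prod x y (Poly_Mapping.lookup f x * Poly_Mapping.lookup g y)),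
      one = (\<Sum>v\<in>verts Q. Poly_Mapping.single (v, [], v) 1),
      ring.zero = 0,
      add = (+)\<rparr>"

definition cyclic_quiver :: "nat \<Rightarrow> (nat, nat) pre_digraph" where
  "cyclic_quiver N =
     \<lparr>verts = {1..N}, arcs = {1..N}, tail = (\<lambda>i. i), head = (\<lambda>i. i mod N + 1)\<rparr>"

text \<open>
  The path \<open>\<alpha>\<^sub>b \<cdots> \<alpha>\<^sub>a\<^sub>+\<^sub>1 \<alpha>\<^sub>a\<close> for \<open>1 \<le> a \<le> b\<close> as an element of the path algebra. The upper index \<open>b\<close>
  is an arbitrary natural number: arrows are reduced modulo \<open>N\<close> into \<open>{1..N}\<close>, but a path may wind
  around the cycle any number of times.
\<close>

definition arrow_product :: "nat \<Rightarrow> nat \<Rightarrow> nat \<Rightarrow> (nat, nat) qpath \<Rightarrow>\<^sub>0 'k::field" where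
  "arrow_product N a b =
     Poly_Mapping.single ((a - 1) mod N + 1, map (\<lambda>j. (j - 1) mod N + 1) [a..<Suc b], b mod N + 1) 1"

text \<open>The \<open>i\<close>-th relation is \<open>\<alpha>\<^bsub>k(2i)\<^esub> \<cdots> \<alpha>\<^bsub>k(2i-1)\<^esub>\<close>, where \<open>i\<close> ranges over \<open>{1..r}\<close>.\<close>

definition nakayama_relation :: "nat \<Rightarrow> (nat \<Rightarrow> nat) \<Rightarrow> nat \<Rightarrow> (nat, nat) qpath \<Rightarrow>\<^sub>0 'k::field" where
  "nakayama_relation N k i = arrow_product N (k (2 * i - 1)) (k (2 * i))"

definition nakayama_ideal ::
    "nat \<Rightarrow> (nat \<Rightarrow> nat) \<Rightarrow> nat set \<Rightarrow> ((nat, nat) qpath \<Rightarrow>\<^sub>0 'k::field) set" where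
  "nakayama_ideal N k J = Idl\<^bsub>path_algebra (cyclic_quiver N)\<^esub> (nakayama_relation N k ` J)"

type_synonym 'k nakayama = "((nat, nat) qpath \<Rightarrow>\<^sub>0 'k) set ring"

definition nakayama_algebra :: "nat \<Rightarrow> nat \<Rightarrow> (nat \<Rightarrow> nat) \<Rightarrow> 'k::field nakayama" where
  "nakayama_algebra N r k = path_algebra (cyclic_quiver N) Quot nakayama_ideal N k {1..r}"


section \<open>Left modules\<close>

text \<open>
  \<^locale>\<open>module\<close> is restricted to commutative rings. As there, the multiplicative part of the record
  type \<^typ>\<open>('a, 'b) module\<close> is irrelevant.
\<close>

locale left_module = R?: ring R + M?: abelian_group M
  for R :: "('a, 'r) ring_scheme" (structure) and M :: "('a, 'b, 'm) module_scheme" (structure) +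
  assumes smult_closed:
      "\<lbrakk>a \<in> carrier R; x \<in> carrier M\<rbrakk> \<Longrightarrow> a \<odot>\<^bsub>M\<^esub> x \<in> carrier M"
    and smult_l_distr:
      "\<lbrakk>a \<in> carrier R; b \<in> carrier R; x \<in> carrier M\<rbrakk> \<Longrightarrow>
       (a \<oplus>\<^bsub>R\<^esub> b) \<odot>\<^bsub>M\<^esub> x = a \<odot>\<^bsub>M\<^esub> x \<oplus>\<^bsub>M\<^esub> b \<odot>\<^bsub>M\<^esub> x"
    and smult_r_distr:
      "\<lbrakk>a \<in> carrier R; x \<in> carrier M; y \<in> carrier M\<rbrakk> \<Longrightarrow>
       a \<odot>\<^bsub>M\<^esub> (x \<oplus>\<^bsub>M\<^esub> y) = a \<odot>\<^bsub>M\<^esub> x \<oplus>\<^bsub>M\<^esub> a \<odot>\<^bsub>M\<^esub> y"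
    and smult_assoc:
      "\<lbrakk>a \<in> carrier R; b \<in> carrier R; x \<in> carrier M\<rbrakk> \<Longrightarrow>
       (a \<otimes>\<^bsub>R\<^esub> b) \<odot>\<^bsub>M\<^esub> x = a \<odot>\<^bsub>M\<^esub> (b \<odot>\<^bsub>M\<^esub> x)"
    and smult_one:
      "x \<in> carrier M \<Longrightarrow> \<one>\<^bsub>R\<^esub> \<odot>\<^bsub>M\<^esub> x = x"

definition fg_module :: "('a, 'r) ring_scheme \<Rightarrow> ('a, 'b, 'm) module_scheme \<Rightarrow> bool" where
  "fg_module R M \<longleftrightarrow> left_module R M \<and>
     (\<exists>S \<subseteq> carrier M. finite S \<and>
       (\<forall>x \<in> carrier M. \<exists>c \<in> S \<rightarrow> carrier R. x = (\<Oplus>\<^bsub>M\<^esub>s\<in>S. c s \<odot>\<^bsub>M\<^esub> s)))"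

text \<open>
  Quantification over all finitely generated modules needs a fixed carrier type. A module generated
  by \<open>n\<close> elements is a quotient of \<open>R\<^sup>n\<close>, so choosing representatives identifies its carrier with a
  set of functions \<^typ>\<open>nat \<Rightarrow> 'a\<close>, where \<^typ>\<open>'a\<close> is the type of ring elements. Therefore every
  finitely generated \<open>R\<close>-module is isomorphic to one of type \<open>'a fmod\<close>, whatever \<open>R\<close> is.
\<close>

type_synonym 'a fmod = "('a, nat \<Rightarrow> 'a) module"

definition fmods :: "('a, 'r) ring_scheme \<Rightarrow> 'a fmod set" where
  "fmods R = {M. fg_module R M}"

definition lhom ::
    "('a, 'r) ring_scheme \<Rightarrow> ('a, 'b, 'm) module_scheme \<Rightarrow> ('a, 'c, 'n) module_scheme \<Rightarrow> ('b \<Rightarrow> 'c) set"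
  where
  "lhom R A B = {f \<in> carrier A \<rightarrow> carrier B.
     (\<forall>x \<in> carrier A. \<forall>y \<in> carrier A. f (x \<oplus>\<^bsub>A\<^esub> y) = f x \<oplus>\<^bsub>B\<^esub> f y) \<and>
     (\<forall>a \<in> carrier R. \<forall>x \<in> carrier A. f (a \<odot>\<^bsub>A\<^esub> x) = a \<odot>\<^bsub>B\<^esub> f x)}"

definition lmod_iso ::
    "('a, 'r) ring_scheme \<Rightarrow> ('a, 'b, 'm) module_scheme \<Rightarrow> ('a, 'c, 'n) module_scheme \<Rightarrow> bool" where
  "lmod_iso R A B \<longleftrightarrow> (\<exists>f \<in> lhom R A B. bij_betw f (carrier A) (carrier B))"

definition direct_sum ::
    "('a, 'b, 'm) module_scheme \<Rightarrow> ('a, 'c, 'n) module_scheme \<Rightarrow> ('a, 'b \<times> 'c) module" where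
  "direct_sum A B =
     \<lparr>carrier = carrier A \<times> carrier B,
      monoid.mult = undefined,
      one = undefined,
      ring.zero = (\<zero>\<^bsub>A\<^esub>, \<zero>\<^bsub>B\<^esub>),
      add = (\<lambda>(x, y) (x', y'). (x \<oplus>\<^bsub>A\<^esub> x', y \<oplus>\<^bsub>B\<^esub> y')),
      module.smult = (\<lambda>a (x, y). (a \<odot>\<^bsub>A\<^esub> x, a \<odot>\<^bsub>B\<^esub> y))\<rparr>"

definition regular_module :: "('a, 'r) ring_scheme \<Rightarrow> ('a, 'a) module" where
  "regular_module R =
     \<lparr>carrier = carrier R, monoid.mult = undefined, one = undefined,
      ring.zero = \<zero>\<^bsub>R\<^esub>, add = add R, module.smult = monoid.mult R\<rparr>"

definition zero_module :: "('a, 'b, 'm) module_scheme \<Rightarrow> bool" where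
  "zero_module M \<longleftrightarrow> carrier M = {\<zero>\<^bsub>M\<^esub>}"

definition projective :: "('a, 'r) ring_scheme \<Rightarrow> ('a, 'b, 'm) module_scheme \<Rightarrow> bool" where
  "projective R P \<longleftrightarrow> fg_module R P \<and>
     (\<forall>A \<in> fmods R. \<forall>B \<in> fmods R. \<forall>g \<in> lhom R A B. \<forall>f \<in> lhom R P B.
       g ` carrier A = carrier B \<longrightarrow> (\<exists>h \<in> lhom R P A. \<forall>x \<in> carrier P. g (h x) = f x))"

definition injective :: "('a, 'r) ring_scheme \<Rightarrow> ('a, 'b, 'm) module_scheme \<Rightarrow> bool" where
  "injective R E \<longleftrightarrow> fg_module R E \<and>
     (\<forall>A \<in> fmods R. \<forall>B \<in> fmods R. \<forall>g \<in> lhom R A B. \<forall>f \<in> lhom R A E.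
       inj_on g (carrier A) \<longrightarrow> (\<exists>h \<in> lhom R B E. \<forall>x \<in> carrier A. h (g x) = f x))"

definition selfinjective :: "('a, 'r) ring_scheme \<Rightarrow> bool" where
  "selfinjective R \<longleftrightarrow> injective R (regular_module R)"


section \<open>Homological dimensions\<close>

text \<open>The sequence \<open>\<dots> \<rightarrow> P 1 \<rightarrow> P 0 \<rightarrow> M \<rightarrow> 0\<close> with \<open>d i : P (i + 1) \<rightarrow> P i\<close> and \<open>\<epsilon> : P 0 \<rightarrow> M\<close>.\<close>

definition projective_resolution ::
    "('a, 'r) ring_scheme \<Rightarrow> ('a, 'b, 'm) module_scheme \<Rightarrow> (nat \<Rightarrow> 'a fmod) \<Rightarrow>
     ((nat \<Rightarrow> 'a) \<Rightarrow> 'b) \<Rightarrow> (nat \<Rightarrow> (nat \<Rightarrow> 'a) \<Rightarrow> (nat \<Rightarrow> 'a)) \<Rightarrow> bool" where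
  "projective_resolution R M P \<epsilon> d \<longleftrightarrow>
     (\<forall>i. projective R (P i)) \<and>
     \<epsilon> \<in> lhom R (P 0) M \<and> \<epsilon> ` carrier (P 0) = carrier M \<and>
     (\<forall>i. d i \<in> lhom R (P (Suc i)) (P i)) \<and>
     d 0 ` carrier (P 1) = a_kernel (P 0) M \<epsilon> \<and>
     (\<forall>i. d (Suc i) ` carrier (P (Suc (Suc i))) = a_kernel (P (Suc i)) (P i) (d i))"

definition proj_dim :: "('a, 'r) ring_scheme \<Rightarrow> ('a, 'b, 'm) module_scheme \<Rightarrow> enat" where
  "proj_dim R M = Inf {enat n | n.
     \<exists>P \<epsilon> d. projective_resolution R M P \<epsilon> d \<and> (\<forall>i>n. zero_module (P i))}"

definition fin_dim :: "('a, 'r) ring_scheme \<Rightarrow> enat" where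
  "fin_dim R = Sup {proj_dim R M | M. M \<in> fmods R \<and> proj_dim R M < \<infinity>}"

definition gorenstein :: "('a, 'r) ring_scheme \<Rightarrow> bool" where
  "gorenstein R \<longleftrightarrow> (\<forall>E \<in> fmods R. injective R E \<longrightarrow> proj_dim R E < \<infinity>)"

text \<open>Meaningful only under \<^term>\<open>gorenstein R\<close>.\<close>

definition gor_dim :: "('a, 'r) ring_scheme \<Rightarrow> enat" where
  "gor_dim R = Sup {proj_dim R E | E. E \<in> fmods R \<and> injective R E}"

definition essential ::
    "('a, 'r) ring_scheme \<Rightarrow> ('a, 'b, 'm) module_scheme \<Rightarrow> 'b set \<Rightarrow> bool" where
  "essential R M U \<longleftrightarrow> submodule U R M \<and>
     (\<forall>V. submodule V R M \<and> U \<inter> V = {\<zero>\<^bsub>M\<^esub>} \<longrightarrow> V = {\<zero>\<^bsub>M\<^esub>})"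

text \<open>
  The sequence \<open>0 \<rightarrow> M \<rightarrow> I 0 \<rightarrow> I 1 \<rightarrow> \<dots>\<close> with \<open>\<iota> : M \<rightarrow> I 0\<close> and \<open>d i : I i \<rightarrow> I (i + 1)\<close>. It is minimal
  if each \<open>I i\<close> is the injective envelope of the image of the map arriving there; by exactness
  this image is the kernel of \<open>d i\<close>.
\<close>

definition minimal_injective_resolution ::
    "('a, 'r) ring_scheme \<Rightarrow> ('a, 'b, 'm) module_scheme \<Rightarrow> (nat \<Rightarrow> 'a fmod) \<Rightarrow>
     ('b \<Rightarrow> (nat \<Rightarrow> 'a)) \<Rightarrow> (nat \<Rightarrow> (nat \<Rightarrow> 'a) \<Rightarrow> (nat \<Rightarrow> 'a)) \<Rightarrow> bool" where
  "minimal_injective_resolution R M I \<iota> d \<longleftrightarrow>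
     (\<forall>i. injective R (I i)) \<and>
     \<iota> \<in> lhom R M (I 0) \<and> inj_on \<iota> (carrier M) \<and>
     (\<forall>i. d i \<in> lhom R (I i) (I (Suc i))) \<and>
     \<iota> ` carrier M = a_kernel (I 0) (I 1) (d 0) \<and>
     (\<forall>i. d i ` carrier (I i) = a_kernel (I (Suc i)) (I (Suc (Suc i))) (d (Suc i))) \<and>
     (\<forall>i. essential R (I i) (a_kernel (I i) (I (Suc i)) (d i)))"

text \<open>
  Minimal injective resolutions are unique up to isomorphism, so it does not matter which one is
  used. The supremum of the values \<open>m + 1\<close> makes the dominant dimension \<open>0\<close> if \<open>I 0\<close> is not projective.
\<close>

definition dom_dim :: "('a, 'r) ring_scheme \<Rightarrow> enat" where
  "dom_dim R = Sup {enat (m + 1) | m.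
     \<exists>I \<iota> d. minimal_injective_resolution R (regular_module R) I \<iota> d \<and> (\<forall>i\<le>m. projective R (I i))}"


section \<open>The \<open>\<phi>\<close>-dimension\<close>

definition projective_cover ::
    "('a, 'r) ring_scheme \<Rightarrow> ('a, 'b, 'm) module_scheme \<Rightarrow> 'a fmod \<Rightarrow> ((nat \<Rightarrow> 'a) \<Rightarrow> 'b) \<Rightarrow> bool" where
  "projective_cover R M P p \<longleftrightarrow>
     projective R P \<and> p \<in> lhom R P M \<and> p ` carrier P = carrier M \<and>
     (\<forall>U. submodule U R P \<and> set_add P U (a_kernel P M p) = carrier P \<longrightarrow> U = carrier P)"

text \<open>The syzygy is determined up to isomorphism only; one representative is chosen.\<close>

definition syzygy :: "('a, 'r) ring_scheme \<Rightarrow> ('a, 'b, 'm) module_scheme \<Rightarrow> 'a fmod" where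
  "syzygy R M = (SOME K. \<exists>P p. projective_cover R M P p \<and> K = P\<lparr>carrier := a_kernel P M p\<rparr>)"

definition K0_relations :: "('a, 'r) ring_scheme \<Rightarrow> ('a fmod \<Rightarrow>\<^sub>0 int) set" where
  "K0_relations R = generate (free_Abelian_group (fmods R))
     ({frag_of A1 - (frag_of A2 + frag_of A3) | A1 A2 A3.
         A1 \<in> fmods R \<and> A2 \<in> fmods R \<and> A3 \<in> fmods R \<and> lmod_iso R A1 (direct_sum A2 A3)} \<union>
      {frag_of P | P. P \<in> fmods R \<and> projective R P})"

definition K0 :: "('a, 'r) ring_scheme \<Rightarrow> ('a fmod \<Rightarrow>\<^sub>0 int) set monoid" where
  "K0 R = free_Abelian_group (fmods R) Mod K0_relations R"

definition K0_coset :: "('a, 'r) ring_scheme \<Rightarrow> ('a fmod \<Rightarrow>\<^sub>0 int) \<Rightarrow> ('a fmod \<Rightarrow>\<^sub>0 int) set" where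
  "K0_coset R c = K0_relations R #>\<^bsub>free_Abelian_group (fmods R)\<^esub> c"

definition K0_class :: "('a, 'r) ring_scheme \<Rightarrow> 'a fmod \<Rightarrow> ('a fmod \<Rightarrow>\<^sub>0 int) set" where
  "K0_class R M = K0_coset R (frag_of M)"

text \<open>
  The map induced on \<^term>\<open>K0 R\<close> by the additive extension of \<^term>\<open>syzygy R\<close> to the free
  abelian group. All members of the union are equal when the extension respects \<^term>\<open>K0_relations R\<close>.
\<close>

definition K0_syzygy ::
    "('a, 'r) ring_scheme \<Rightarrow> ('a fmod \<Rightarrow>\<^sub>0 int) set \<Rightarrow> ('a fmod \<Rightarrow>\<^sub>0 int) set" where
  "K0_syzygy R C = (\<Union>c\<in>C. K0_coset R (frag_extend (\<lambda>M. frag_of (syzygy R M)) c))"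

definition indecomposable :: "('a, 'r) ring_scheme \<Rightarrow> 'a fmod \<Rightarrow> bool" where
  "indecomposable R V \<longleftrightarrow> V \<in> fmods R \<and> \<not> zero_module V \<and>
     (\<forall>A \<in> fmods R. \<forall>B \<in> fmods R. lmod_iso R V (direct_sum A B) \<longrightarrow> zero_module A \<or> zero_module B)"

definition indec_summands :: "('a, 'r) ring_scheme \<Rightarrow> 'a fmod \<Rightarrow> 'a fmod set" where
  "indec_summands R M =
     {V. indecomposable R V \<and> (\<exists>Y \<in> fmods R. lmod_iso R M (direct_sum V Y))}"

definition K0_add :: "('a, 'r) ring_scheme \<Rightarrow> 'a fmod \<Rightarrow> ('a fmod \<Rightarrow>\<^sub>0 int) set set" where
  "K0_add R M = generate (K0 R) (K0_class R ` indec_summands R M)"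

definition int_independent :: "('g, 'm) monoid_scheme \<Rightarrow> 'g set \<Rightarrow> bool" where
  "int_independent G S \<longleftrightarrow> finite S \<and> S \<subseteq> carrier G \<and>
     (\<forall>c :: 'g \<Rightarrow> int. (\<Otimes>\<^bsub>G\<^esub>x\<in>S. x [^]\<^bsub>G\<^esub> c x) = \<one>\<^bsub>G\<^esub> \<longrightarrow> (\<forall>x\<in>S. c x = 0))"

definition subgroup_rank :: "('g, 'm) monoid_scheme \<Rightarrow> 'g set \<Rightarrow> enat" where
  "subgroup_rank G H = Sup {enat (card S) | S. S \<subseteq> H \<and> int_independent G S}"

definition phi :: "('a, 'r) ring_scheme \<Rightarrow> 'a fmod \<Rightarrow> nat" where
  "phi R M = (LEAST t. \<forall>j\<ge>1.
     subgroup_rank (K0 R) ((K0_syzygy R ^^ t) ` K0_add R M) =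
     subgroup_rank (K0 R) ((K0_syzygy R ^^ (t + j)) ` K0_add R M))"

definition phi_dim :: "('a, 'r) ring_scheme \<Rightarrow> enat" where
  "phi_dim R = Sup {enat (phi R M) | M. M \<in> fmods R}"

end

theory Submission
  imports Defs
begin

text \<open>
  The modules over a cyclic Nakayama algebra are direct sums of uniserial modules, and a uniserial
  module is given by an interval \<open>[a, b)\<close> of integers, taken modulo a common shift by \<open>N\<close>: it has a
  basis of vectors at the vertices \<open>a, a + 1, \<dots>, b - 1\<close> and the arrows push each vector to the next.
  The projective module at \<open>a\<close> is \<open>[a, f a)\<close>, where the path from \<open>a\<close> to \<open>f a\<close> is the shortest one
  that contains a relation. The function \<open>f\<close> is monotone and commutes with the shift by \<open>N\<close>. As
  \<open>f a\<close> is the vertex at which some relation ends, \<open>f\<close> takes at most \<open>r\<close> values modulo \<open>N\<close>.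

  The syzygy of \<open>[a, b)\<close> is \<open>[b, f a)\<close>, and its second syzygy is \<open>[f a, f b)\<close>. Hence the behaviour of
  high syzygies is that of the iterates of \<open>f\<close>. The images of these iterates, read modulo \<open>N\<close>, form a
  decreasing chain of nonempty sets that starts with at most \<open>r\<close> elements and is constant once two
  consecutive members agree. It is constant from the \<open>r\<close>-th member on, where \<open>f\<close> is bijective
  (\<open>residues_r\<close>). Everything else follows from this.

  \<^item> If some syzygy of \<open>[a, b)\<close> is projective, two of the iterated end points coincide. By injectivity
    they coincide already after \<open>r\<close> applications of \<open>f\<close>, so the \<open>(2 r)\<close>-th syzygy is projective
    (\<open>syzygy_projective_bound\<close>). This bounds all finite projective dimensions by \<open>2 r\<close>, and with them
    the finitistic and the Gorenstein dimension.

  \<^item> A monotone bijection that commutes with the shift has a power that is a translation by a multiple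
    of \<open>N\<close> (\<open>proj_end_period\<close>). So on \<open>K\<^sub>0\<close> the syzygy map satisfies \<open>L\<^bsup>2r+q\<^esup> = L\<^bsup>2r\<^esup>\<close> for some \<open>q > 0\<close>
    (\<open>syz_ext_periodic\<close>). Ranks cannot grow under \<open>L\<close>, so they are constant from the exponent \<open>2 r\<close> on.

  \<^item> If the terms \<open>I\<^sub>0, \<dots>, I\<^bsub>2r\<^esub>\<close> of an injective resolution of the ring are projective, they resolve
    the next cokernel projectively. Its projective dimension is at most \<open>2 r\<close>, so the \<open>(2 r)\<close>-th syzygy
    in this resolution is projective. This syzygy is the cokernel of the embedding of the ring into
    \<open>I\<^sub>0\<close>, so the ring is a direct summand of \<open>I\<^sub>0\<close> (\<open>selfinjective_if_long_dominant\<close>).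

  The link between modules and intervals is an explicit construction (\<open>exists_projective_cover\<close>): a
  decomposition of a module into uniserial modules yields a projective cover together with a
  decomposition of its kernel. The summands of a module are controlled by means of retracts. A retract
  of a module of finite projective dimension has summands with projective high syzygies, because
  retracts are inherited by syzygies (\<open>pd_le_retract\<close>). In \<open>K\<^sub>0\<close>, the class of a syzygy can be computed
  from any decomposition, which shows that the syzygy map is well defined (\<open>syz_ext_relations\<close>).

  All this is carried out in a ring with idempotents \<open>e a\<close> and an element \<open>t\<close>, the sum of the arrows,
  of which only the few laws collected in the locale \<open>cyclic_nakayama\<close> are known. The last sections
  verify these laws for the quotient of the path algebra.
\<close>

section \<open>Modules over a noncommutative ring\<close>

context left_module
begin

lemma smult_l_null: "x \<in> carrier M \<Longrightarrow> \<zero>\<^bsub>R\<^esub> \<odot>\<^bsub>M\<^esub> x = \<zero>\<^bsub>M\<^esub>"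
  using smult_l_distr[of "\<zero>\<^bsub>R\<^esub>" "\<zero>\<^bsub>R\<^esub>" x] smult_closed[of "\<zero>\<^bsub>R\<^esub>" x]
  by (metis M.add.r_cancel_one R.l_zero R.zero_closed)

lemma smult_r_null: "a \<in> carrier R \<Longrightarrow> a \<odot>\<^bsub>M\<^esub> \<zero>\<^bsub>M\<^esub> = \<zero>\<^bsub>M\<^esub>"
  using smult_r_distr[of a "\<zero>\<^bsub>M\<^esub>" "\<zero>\<^bsub>M\<^esub>"] smult_closed[of a "\<zero>\<^bsub>M\<^esub>"]
  by (metis M.add.r_cancel_one M.l_zero M.zero_closed)

lemma smult_l_minus:
  "\<lbrakk>a \<in> carrier R; x \<in> carrier M\<rbrakk> \<Longrightarrow> (\<ominus>\<^bsub>R\<^esub> a) \<odot>\<^bsub>M\<^esub> x = \<ominus>\<^bsub>M\<^esub> (a \<odot>\<^bsub>M\<^esub> x)"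
  using smult_l_distr[of "\<ominus>\<^bsub>R\<^esub> a" a x] smult_l_null[of x]
  by (metis M.minus_equality R.a_inv_closed R.l_neg smult_closed)

lemma smult_r_minus:
  "\<lbrakk>a \<in> carrier R; x \<in> carrier M\<rbrakk> \<Longrightarrow> a \<odot>\<^bsub>M\<^esub> (\<ominus>\<^bsub>M\<^esub> x) = \<ominus>\<^bsub>M\<^esub> (a \<odot>\<^bsub>M\<^esub> x)"
  using smult_r_distr[of a "\<ominus>\<^bsub>M\<^esub> x" x] smult_r_null[of a]
  by (metis M.minus_equality M.a_inv_closed M.l_neg smult_closed)

lemma smult_minus_one: "x \<in> carrier M \<Longrightarrow> (\<ominus>\<^bsub>R\<^esub> \<one>\<^bsub>R\<^esub>) \<odot>\<^bsub>M\<^esub> x = \<ominus>\<^bsub>M\<^esub> x"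
  by (simp add: smult_l_minus smult_one)

lemma smult_finsum:
  assumes "finite I" "a \<in> carrier R" "f \<in> I \<rightarrow> carrier M"
  shows "a \<odot>\<^bsub>M\<^esub> (\<Oplus>\<^bsub>M\<^esub>i\<in>I. f i) = (\<Oplus>\<^bsub>M\<^esub>i\<in>I. a \<odot>\<^bsub>M\<^esub> f i)"
  using assms
proof (induction I)
  case empty then show ?case by (simp add: smult_r_null)
next
  case (insert i I)
  then have "f i \<in> carrier M" "f \<in> I \<rightarrow> carrier M" "(\<lambda>i. a \<odot>\<^bsub>M\<^esub> f i) \<in> I \<rightarrow> carrier M"
    by (auto simp: smult_closed Pi_iff)
  with insert show ?case by (simp add: smult_r_distr M.finsum_closed smult_closed)
qed

lemma submoduleI:
  assumes "U \<subseteq> carrier M" "\<zero>\<^bsub>M\<^esub> \<in> U"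
    and add: "\<And>x y. x \<in> U \<Longrightarrow> y \<in> U \<Longrightarrow> x \<oplus>\<^bsub>M\<^esub> y \<in> U"
    and sm: "\<And>a x. a \<in> carrier R \<Longrightarrow> x \<in> U \<Longrightarrow> a \<odot>\<^bsub>M\<^esub> x \<in> U"
  shows "submodule U R M"
proof -
  have "\<ominus>\<^bsub>M\<^esub> x \<in> U" if "x \<in> U" for x
    using sm[of "\<ominus>\<^bsub>R\<^esub> \<one>\<^bsub>R\<^esub>" x] that smult_minus_one[of x] assms(1)
    by (metis R.a_inv_closed R.one_closed subsetD)
  then show ?thesis
    using assms by (auto intro!: submodule.intro subgroup.intro simp: submodule_axioms_def a_inv_def)
qed

lemma submoduleD:
  assumes "submodule U R M"
  shows "U \<subseteq> carrier M" "\<zero>\<^bsub>M\<^esub> \<in> U" "\<And>x y. x \<in> U \<Longrightarrow> y \<in> U \<Longrightarrow> x \<oplus>\<^bsub>M\<^esub> y \<in> U"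
    "\<And>a x. a \<in> carrier R \<Longrightarrow> x \<in> U \<Longrightarrow> a \<odot>\<^bsub>M\<^esub> x \<in> U"
    "\<And>x. x \<in> U \<Longrightarrow> \<ominus>\<^bsub>M\<^esub> x \<in> U" 
proof -
  interpret S: submodule U R M by fact
  show *: "U \<subseteq> carrier M" "\<zero>\<^bsub>M\<^esub> \<in> U" "\<And>x y. x \<in> U \<Longrightarrow> y \<in> U \<Longrightarrow> x \<oplus>\<^bsub>M\<^esub> y \<in> U"
    "\<And>a x. a \<in> carrier R \<Longrightarrow> x \<in> U \<Longrightarrow> a \<odot>\<^bsub>M\<^esub> x \<in> U"
    using S.subset S.one_closed S.m_closed S.smult_closed by auto
  show "\<ominus>\<^bsub>M\<^esub> x \<in> U" if "x \<in> U" for x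
    using *(1) *(4)[of "\<ominus>\<^bsub>R\<^esub> \<one>\<^bsub>R\<^esub>" x] that smult_minus_one[of x]
    by (metis R.a_inv_closed R.one_closed subsetD)
qed

lemma submodule_finsum:
  assumes "submodule U R M" "finite I" "f \<in> I \<rightarrow> U"
  shows "(\<Oplus>\<^bsub>M\<^esub>i\<in>I. f i) \<in> U"
  using assms(2,3)
proof (induction I)
  case empty then show ?case using submoduleD[OF assms(1)] by simp
next
  case (insert i I)
  then have "f i \<in> U" "f \<in> I \<rightarrow> U" by auto
  with insert submoduleD[OF assms(1)] show ?case
    by (subst M.finsum_insert) auto
qed

lemma left_module_submodule:
  assumes "submodule U R M"
  shows "left_module R (M\<lparr>carrier := U\<rparr>)"
proof -
  note D = submoduleD[OF assms]
  have c: "x \<in> carrier M" if "x \<in> U" for x using that D by auto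
  have "abelian_group (M\<lparr>carrier := U\<rparr>)"
  proof (rule abelian_groupI)
    fix x assume "x \<in> carrier (M\<lparr>carrier := U\<rparr>)"
    then have "x \<in> U" by simp
    then show "\<exists>y\<in>carrier (M\<lparr>carrier := U\<rparr>). y \<oplus>\<^bsub>M\<lparr>carrier := U\<rparr>\<^esub> x = \<zero>\<^bsub>M\<lparr>carrier := U\<rparr>\<^esub>"
      by (intro bexI[of _ "\<ominus>\<^bsub>M\<^esub> x"]) (use D(5) c in \<open>auto simp: M.l_neg\<close>)
  qed (use D c in \<open>auto simp: M.a_ac\<close>)
  then show ?thesis
    by (intro left_module.intro R.ring_axioms left_module_axioms.intro)
      (use D c in \<open>auto simp: smult_l_distr smult_r_distr smult_assoc smult_one\<close>)
qed

lemma finsum_submodule: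
  assumes "submodule U R M" "finite I" "f \<in> I \<rightarrow> U"
  shows "(\<Oplus>\<^bsub>M\<lparr>carrier := U\<rparr>\<^esub>i\<in>I. f i) = (\<Oplus>\<^bsub>M\<^esub>i\<in>I. f i)"
proof -
  interpret U: left_module R "M\<lparr>carrier := U\<rparr>" by (rule left_module_submodule) fact
  note D = submoduleD[OF assms(1)]
  show ?thesis
    using assms(2,3)
  proof (induction I)
    case empty then show ?case by simp
  next
    case (insert i I)
    then have *: "f i \<in> U" "f \<in> I \<rightarrow> U" "f \<in> I \<rightarrow> carrier M" using D by auto
    then show ?case using insert D
      by (subst U.finsum_insert) (auto simp: M.finsum_insert subsetD)
  qed
qed

lemma submodule_carrier: "submodule (carrier M) R M"
  by (rule submoduleI) (auto simp: smult_closed)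

lemma submodule_zero: "submodule {\<zero>\<^bsub>M\<^esub>} R M"
  by (rule submoduleI) (auto simp: smult_r_null)

end

lemma submodule_of_submodule_iff:
  assumes "left_module R M" "submodule U R M"
  shows "submodule V R (M\<lparr>carrier := U\<rparr>) \<longleftrightarrow> submodule V R M \<and> V \<subseteq> U"
proof -
  interpret M: left_module R M by fact
  interpret U: left_module R "M\<lparr>carrier := U\<rparr>" by (rule M.left_module_submodule) fact
  note D = M.submoduleD[OF assms(2)]
  show ?thesis
  proof
    assume "submodule V R (M\<lparr>carrier := U\<rparr>)"
    from U.submoduleD[OF this] show "submodule V R M \<and> V \<subseteq> U"
      using D by (auto intro!: M.submoduleI)
  next
    assume "submodule V R M \<and> V \<subseteq> U"
    then show "submodule V R (M\<lparr>carrier := U\<rparr>)"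
      using M.submoduleD[of V] by (auto intro!: U.submoduleI)
  qed
qed

definition lincomb :: "('a, 'b, 'm) module_scheme \<Rightarrow> 'i set \<Rightarrow> ('i \<Rightarrow> 'a) \<Rightarrow> ('i \<Rightarrow> 'b) \<Rightarrow> 'b" where
  "lincomb M I v x = (\<Oplus>\<^bsub>M\<^esub>i\<in>I. v i \<odot>\<^bsub>M\<^esub> x i)"

definition lspan ::
    "('a, 'r) ring_scheme \<Rightarrow> ('a, 'b, 'm) module_scheme \<Rightarrow> 'i set \<Rightarrow> ('i \<Rightarrow> 'b) \<Rightarrow> 'b set" where
  "lspan R M I x = {lincomb M I v x | v. v \<in> I \<rightarrow> carrier R}"

context left_module
begin

lemma smult_Pi:
  "v \<in> I \<rightarrow> carrier R \<Longrightarrow> x \<in> I \<rightarrow> carrier M \<Longrightarrow> (\<lambda>i. v i \<odot>\<^bsub>M\<^esub> x i) \<in> I \<rightarrow> carrier M"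
  by (auto simp: smult_closed Pi_iff)

lemma lincomb_empty: "lincomb M {} v x = \<zero>\<^bsub>M\<^esub>"
  by (simp add: lincomb_def)

lemma lincomb_closed:
  "v \<in> I \<rightarrow> carrier R \<Longrightarrow> x \<in> I \<rightarrow> carrier M \<Longrightarrow> lincomb M I v x \<in> carrier M"
  unfolding lincomb_def by (rule M.finsum_closed) (rule smult_Pi)

lemma lincomb_insert:
  "finite I \<Longrightarrow> i \<notin> I \<Longrightarrow> v \<in> insert i I \<rightarrow> carrier R \<Longrightarrow> x \<in> insert i I \<rightarrow> carrier M \<Longrightarrow>
    lincomb M (insert i I) v x = v i \<odot>\<^bsub>M\<^esub> x i \<oplus>\<^bsub>M\<^esub> lincomb M I v x"
  unfolding lincomb_def by (subst M.finsum_insert) (auto simp: smult_closed Pi_iff)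

lemma lincomb_add:
  "v \<in> I \<rightarrow> carrier R \<Longrightarrow> w \<in> I \<rightarrow> carrier R \<Longrightarrow> x \<in> I \<rightarrow> carrier M \<Longrightarrow>
   lincomb M I v x \<oplus>\<^bsub>M\<^esub> lincomb M I w x = lincomb M I (\<lambda>i. v i \<oplus>\<^bsub>R\<^esub> w i) x"
  unfolding lincomb_def
  by (rule trans[OF M.finsum_addf[symmetric] M.finsum_cong'])
    (auto simp: smult_closed Pi_iff smult_l_distr)

lemma lincomb_smult:
  "finite I \<Longrightarrow> a \<in> carrier R \<Longrightarrow> v \<in> I \<rightarrow> carrier R \<Longrightarrow> x \<in> I \<rightarrow> carrier M \<Longrightarrow>
   a \<odot>\<^bsub>M\<^esub> lincomb M I v x = lincomb M I (\<lambda>i. a \<otimes>\<^bsub>R\<^esub> v i) x"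
  unfolding lincomb_def
  by (subst smult_finsum) (auto simp: smult_closed Pi_iff smult_assoc intro!: M.finsum_cong')

lemma lincomb_cong:
  "(\<And>i. i \<in> I \<Longrightarrow> v i \<odot>\<^bsub>M\<^esub> x i = w i \<odot>\<^bsub>M\<^esub> y i) \<Longrightarrow> w \<in> I \<rightarrow> carrier R \<Longrightarrow> y \<in> I \<rightarrow> carrier M \<Longrightarrow>
   lincomb M I v x = lincomb M I w y"
  unfolding lincomb_def by (rule M.finsum_cong') (auto simp: smult_closed Pi_iff)

lemma lincomb_zero:
  "(\<And>i. i \<in> I \<Longrightarrow> v i \<odot>\<^bsub>M\<^esub> x i = \<zero>\<^bsub>M\<^esub>) \<Longrightarrow> lincomb M I v x = \<zero>\<^bsub>M\<^esub>"
  unfolding lincomb_def by (rule M.add.finprod_one_eqI)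

lemma lincomb_Un:
  "finite I \<Longrightarrow> finite J \<Longrightarrow> I \<inter> J = {} \<Longrightarrow> v \<in> I \<union> J \<rightarrow> carrier R \<Longrightarrow> x \<in> I \<union> J \<rightarrow> carrier M \<Longrightarrow>
   lincomb M (I \<union> J) v x = lincomb M I v x \<oplus>\<^bsub>M\<^esub> lincomb M J v x"
  unfolding lincomb_def by (rule M.finsum_Un_disjoint) (auto simp: smult_closed Pi_iff)

lemma lincomb_mono_neutral:
  assumes "finite I" "J \<subseteq> I" "v \<in> I \<rightarrow> carrier R" "x \<in> I \<rightarrow> carrier M"
    and "\<And>i. i \<in> I - J \<Longrightarrow> v i \<odot>\<^bsub>M\<^esub> x i = \<zero>\<^bsub>M\<^esub>"
  shows "lincomb M I v x = lincomb M J v x"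
proof -
  have "I = J \<union> (I - J)" using assms by auto
  then have "lincomb M I v x = lincomb M J v x \<oplus>\<^bsub>M\<^esub> lincomb M (I - J) v x"
    using assms lincomb_Un[of J "I - J" v x] by (metis Diff_disjoint finite_Diff finite_subset)
  moreover have "lincomb M J v x \<in> carrier M" using assms by (intro lincomb_closed) auto
  ultimately show ?thesis using lincomb_zero[of "I - J" v x] assms(5) by simp
qed

lemma lincomb_extend:
  assumes "finite I" "J \<subseteq> I" "v \<in> J \<rightarrow> carrier R" "x \<in> I \<rightarrow> carrier M"
  shows "lincomb M I (\<lambda>i. if i \<in> J then v i else \<zero>\<^bsub>R\<^esub>) x = lincomb M J v x"
proof -
  let ?v = "\<lambda>i. if i \<in> J then v i else \<zero>\<^bsub>R\<^esub>"
  have "lincomb M I ?v x = lincomb M J ?v x"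
    using assms by (intro lincomb_mono_neutral) (auto simp: smult_l_null Pi_iff)
  also have "\<dots> = lincomb M J v x"
    using assms by (intro lincomb_cong) auto
  finally show ?thesis .
qed

lemma lincomb_single:
  assumes "finite I" "i \<in> I" "v \<in> I \<rightarrow> carrier R" "x \<in> I \<rightarrow> carrier M"
    and "\<And>j. j \<in> I \<Longrightarrow> j \<noteq> i \<Longrightarrow> v j \<odot>\<^bsub>M\<^esub> x j = \<zero>\<^bsub>M\<^esub>"
  shows "lincomb M I v x = v i \<odot>\<^bsub>M\<^esub> x i"
proof -
  have "lincomb M I v x = lincomb M {i} v x"
    using assms by (intro lincomb_mono_neutral) auto
  also have "\<dots> = v i \<odot>\<^bsub>M\<^esub> x i"
    using assms by (subst lincomb_insert) (auto simp: lincomb_empty smult_closed Pi_iff)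
  finally show ?thesis .
qed

lemma lincomb_reindex:
  "inj_on g I \<Longrightarrow> v \<in> g ` I \<rightarrow> carrier R \<Longrightarrow> x \<in> g ` I \<rightarrow> carrier M \<Longrightarrow>
    lincomb M (g ` I) v x = lincomb M I (v \<circ> g) (x \<circ> g)"
  unfolding lincomb_def by (subst M.finsum_reindex) (auto simp: smult_closed Pi_iff)

lemma lincomb_submodule:
  assumes "submodule U R M" "finite I" "v \<in> I \<rightarrow> carrier R" "x \<in> I \<rightarrow> U"
  shows "lincomb (M\<lparr>carrier := U\<rparr>) I v x = lincomb M I v x" "lincomb M I v x \<in> U"
proof -
  have *: "(\<lambda>i. v i \<odot>\<^bsub>M\<^esub> x i) \<in> I \<rightarrow> U"
    using assms submoduleD(4)[OF assms(1)] by (auto simp: Pi_iff)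
  show "lincomb (M\<lparr>carrier := U\<rparr>) I v x = lincomb M I v x" 
    using finsum_submodule[OF assms(1,2) *] by (simp add: lincomb_def)
  show "lincomb M I v x \<in> U"
    using submodule_finsum[OF assms(1,2) *] by (simp add: lincomb_def)
qed

lemma submodule_lspan:
  assumes "finite I" "x \<in> I \<rightarrow> carrier M"
  shows "submodule (lspan R M I x) R M"
proof (rule submoduleI)
  show "lspan R M I x \<subseteq> carrier M" using assms by (auto simp: lspan_def lincomb_closed)
  show "\<zero>\<^bsub>M\<^esub> \<in> lspan R M I x" unfolding lspan_def
    using assms by (auto intro!: exI[of _ "\<lambda>_. \<zero>\<^bsub>R\<^esub>"] lincomb_zero[symmetric] smult_l_null simp: Pi_iff)
next
  fix y z assume "y \<in> lspan R M I x" "z \<in> lspan R M I x"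
  then obtain v w where "y = lincomb M I v x" "v \<in> I \<rightarrow> carrier R" "z = lincomb M I w x" "w \<in> I \<rightarrow> carrier R"
    by (auto simp: lspan_def)
  then show "y \<oplus>\<^bsub>M\<^esub> z \<in> lspan R M I x"
    using assms lincomb_add unfolding lspan_def by (auto intro!: exI[of _ "\<lambda>i. v i \<oplus>\<^bsub>R\<^esub> w i"])
next
  fix a y assume "a \<in> carrier R" "y \<in> lspan R M I x"
  then obtain v where "y = lincomb M I v x" "v \<in> I \<rightarrow> carrier R"
    by (auto simp: lspan_def)
  then show "a \<odot>\<^bsub>M\<^esub> y \<in> lspan R M I x"
    using assms lincomb_smult \<open>a \<in> carrier R\<close> unfolding lspan_def
    by (auto intro!: exI[of _ "\<lambda>i. a \<otimes>\<^bsub>R\<^esub> v i"])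
qed

lemma lspan_gen:
  assumes "finite I" "x \<in> I \<rightarrow> carrier M" "i \<in> I"
  shows "x i \<in> lspan R M I x"
proof -
  let ?v = "\<lambda>j. if j = i then \<one>\<^bsub>R\<^esub> else \<zero>\<^bsub>R\<^esub>"
  have "lincomb M I ?v x = ?v i \<odot>\<^bsub>M\<^esub> x i"
    using assms by (intro lincomb_single) (auto simp: smult_l_null Pi_iff)
  also have "\<dots> = x i" using assms by (auto simp: smult_one Pi_iff)
  finally show ?thesis unfolding lspan_def by (auto intro!: exI[of _ ?v])
qed

lemma lspan_subset:
  assumes "submodule U R M" "finite I" "x \<in> I \<rightarrow> U"
  shows "lspan R M I x \<subseteq> U"
  using lincomb_submodule(2)[OF assms(1,2)] assms(3) by (auto simp: lspan_def)

end

lemma fg_module_iff: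
  "fg_module R M \<longleftrightarrow> left_module R M \<and>
    (\<exists>S \<subseteq> carrier M. finite S \<and> carrier M \<subseteq> lspan R M S (\<lambda>s. s))"
proof -
  have "x \<in> lspan R M S (\<lambda>s. s) \<longleftrightarrow> (\<exists>c \<in> S \<rightarrow> carrier R. x = (\<Oplus>\<^bsub>M\<^esub>s\<in>S. c s \<odot>\<^bsub>M\<^esub> s))" for x S
    by (auto simp: lspan_def lincomb_def)
  then show ?thesis unfolding fg_module_def subset_eq[of "carrier M"] by presburger
qed

lemma fg_moduleI:
  assumes "left_module R M" "finite I" "x \<in> I \<rightarrow> carrier M" "carrier M \<subseteq> lspan R M I x"
  shows "fg_module R M"
proof -
  interpret left_module R M by fact
  have U: "submodule (lspan R M (x ` I) (\<lambda>s. s)) R M"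
    using assms by (intro submodule_lspan) auto
  have "x \<in> I \<rightarrow> lspan R M (x ` I) (\<lambda>s. s)"
    using assms lspan_gen[of "x ` I" "\<lambda>s. s"] by (auto simp: Pi_iff)
  then have "carrier M \<subseteq> lspan R M (x ` I) (\<lambda>s. s)"
    using lspan_subset[OF U assms(2)] assms(4) by blast
  then show ?thesis unfolding fg_module_iff using assms by (intro conjI exI[of _ "x ` I"]) auto
qed

subsection \<open>Homomorphisms\<close>

lemma lhom_closed: "f \<in> lhom R A B \<Longrightarrow> x \<in> carrier A \<Longrightarrow> f x \<in> carrier B"
  and lhom_add: "f \<in> lhom R A B \<Longrightarrow> x \<in> carrier A \<Longrightarrow> y \<in> carrier A \<Longrightarrow> f (x \<oplus>\<^bsub>A\<^esub> y) = f x \<oplus>\<^bsub>B\<^esub> f y"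
  and lhom_smult: "f \<in> lhom R A B \<Longrightarrow> a \<in> carrier R \<Longrightarrow> x \<in> carrier A \<Longrightarrow> f (a \<odot>\<^bsub>A\<^esub> x) = a \<odot>\<^bsub>B\<^esub> f x"
  by (auto simp: lhom_def)

lemma lhom_comp: "f \<in> lhom R A B \<Longrightarrow> g \<in> lhom R B C \<Longrightarrow> (\<lambda>x. g (f x)) \<in> lhom R A C"
  by (auto simp: lhom_def Pi_iff)

lemma lhom_id: "(\<lambda>x. x) \<in> lhom R A A"
  by (auto simp: lhom_def)

lemma lhom_zero:
  assumes "left_module R A" "left_module R B" "f \<in> lhom R A B"
  shows "f \<zero>\<^bsub>A\<^esub> = \<zero>\<^bsub>B\<^esub>"
proof -
  interpret A: left_module R A by fact
  interpret B: left_module R B by fact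
  have "f (\<zero>\<^bsub>R\<^esub> \<odot>\<^bsub>A\<^esub> \<zero>\<^bsub>A\<^esub>) = \<zero>\<^bsub>R\<^esub> \<odot>\<^bsub>B\<^esub> f \<zero>\<^bsub>A\<^esub>"
    using lhom_smult[OF assms(3)] by simp
  then show ?thesis using lhom_closed[OF assms(3)] by (simp add: A.smult_l_null B.smult_l_null)
qed

lemma lhom_minus:
  assumes "left_module R A" "left_module R B" "f \<in> lhom R A B" "x \<in> carrier A"
  shows "f (\<ominus>\<^bsub>A\<^esub> x) = \<ominus>\<^bsub>B\<^esub> f x"
proof -
  interpret A: left_module R A by fact
  interpret B: left_module R B by fact
  show ?thesis
    using lhom_smult[OF assms(3), of "\<ominus>\<^bsub>R\<^esub> \<one>\<^bsub>R\<^esub>" x] assms(4) lhom_closed[OF assms(3)]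
    by (simp add: A.smult_minus_one B.smult_minus_one)
qed

lemma lhom_diff:
  assumes "left_module R A" "left_module R B" "f \<in> lhom R A B" "x \<in> carrier A" "y \<in> carrier A"
  shows "f (x \<ominus>\<^bsub>A\<^esub> y) = f x \<ominus>\<^bsub>B\<^esub> f y"
proof -
  interpret A: left_module R A by fact
  show ?thesis
    using assms by (simp add: a_minus_def lhom_add[OF assms(3)] lhom_minus[OF assms(1-3)])
qed

lemma lhom_lincomb:
  assumes "left_module R A" "left_module R B" "f \<in> lhom R A B" "finite I"
    "v \<in> I \<rightarrow> carrier R" "x \<in> I \<rightarrow> carrier A"
  shows "f (lincomb A I v x) = lincomb B I v (\<lambda>i. f (x i))"
  using assms(4,5,6)
proof (induction I)
  case empty
  then show ?case using lhom_zero[OF assms(1-3)] assms(1,2) by (simp add: left_module.lincomb_empty)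
next
  case (insert i I)
  interpret A: left_module R A by fact
  interpret B: left_module R B by fact
  have "lincomb A I v x \<in> carrier A" using insert by (intro A.lincomb_closed) auto
  then show ?case
    using insert lhom_closed[OF assms(3)]
    by (simp add: A.lincomb_insert B.lincomb_insert lhom_add[OF assms(3)] A.smult_closed
        lhom_smult[OF assms(3)] Pi_iff)
qed

lemma submodule_kernel:
  assumes "left_module R A" "left_module R B" "f \<in> lhom R A B"
  shows "submodule (a_kernel A B f) R A"
proof -
  interpret A: left_module R A by fact
  interpret B: left_module R B by fact
  show ?thesis
    by (rule A.submoduleI)
      (auto simp: a_kernel_def' lhom_zero[OF assms] lhom_add[OF assms(3)] lhom_smult[OF assms(3)]
        A.smult_closed B.smult_r_null)
qed

lemma left_module_kernel:
  assumes "left_module R A" "left_module R B" "f \<in> lhom R A B"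
  shows "left_module R (A\<lparr>carrier := a_kernel A B f\<rparr>)"
  by (rule left_module.left_module_submodule[OF assms(1) submodule_kernel[OF assms]])

lemma submodule_image:
  assumes "left_module R A" "left_module R B" "f \<in> lhom R A B" "submodule U R A"
  shows "submodule (f ` U) R B"
proof -
  interpret A: left_module R A by fact
  interpret B: left_module R B by fact
  note D = A.submoduleD[OF assms(4)]
  note c = subsetD[OF D(1)]
  show ?thesis
  proof (rule B.submoduleI)
    show "f ` U \<subseteq> carrier B" using lhom_closed[OF assms(3)] D by auto
    show "\<zero>\<^bsub>B\<^esub> \<in> f ` U" using lhom_zero[OF assms(1-3)] D by (metis imageI)
    show "x \<oplus>\<^bsub>B\<^esub> y \<in> f ` U" if "x \<in> f ` U" "y \<in> f ` U" for x y
      using that D c by (auto simp: lhom_add[OF assms(3), symmetric])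
    show "a \<odot>\<^bsub>B\<^esub> x \<in> f ` U" if "a \<in> carrier R" "x \<in> f ` U" for a x
      using that D c by (auto simp: lhom_smult[OF assms(3), symmetric])
  qed
qed

lemma lhom_restrict: "f \<in> lhom R A B \<Longrightarrow> U \<subseteq> carrier A \<Longrightarrow> f ` U \<subseteq> V \<Longrightarrow>
    f \<in> lhom R (A\<lparr>carrier := U\<rparr>) (B\<lparr>carrier := V\<rparr>)"
  by (simp add: lhom_def Pi_iff subset_iff image_subset_iff)

lemma lhom_restrict_dom: "f \<in> lhom R A B \<Longrightarrow> U \<subseteq> carrier A \<Longrightarrow> f \<in> lhom R (A\<lparr>carrier := U\<rparr>) B"
  by (simp add: lhom_def Pi_iff subset_iff)

lemma lhom_restrict_cod: "f \<in> lhom R A B \<Longrightarrow> f ` carrier A \<subseteq> V \<Longrightarrow> f \<in> lhom R A (B\<lparr>carrier := V\<rparr>)"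
  by (simp add: lhom_def Pi_iff image_subset_iff)

lemma lhom_enlarge_cod: "f \<in> lhom R A (B\<lparr>carrier := V\<rparr>) \<Longrightarrow> V \<subseteq> carrier B \<Longrightarrow> f \<in> lhom R A B"
  by (simp add: lhom_def Pi_iff subset_iff)

lemma lhom_inj:
  assumes "left_module R A" "left_module R B" "f \<in> lhom R A B"
    "\<And>x. x \<in> carrier A \<Longrightarrow> f x = \<zero>\<^bsub>B\<^esub> \<Longrightarrow> x = \<zero>\<^bsub>A\<^esub>"
  shows "inj_on f (carrier A)"
proof (rule inj_onI)
  interpret A: left_module R A by fact
  interpret B: left_module R B by fact
  fix x y assume *: "x \<in> carrier A" "y \<in> carrier A" "f x = f y"
  then have "f (x \<ominus>\<^bsub>A\<^esub> y) = \<zero>\<^bsub>B\<^esub>"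
    using lhom_diff[OF assms(1-3)] lhom_closed[OF assms(3)] by (simp add: B.M.minus_eq B.M.r_neg)
  then have "x \<ominus>\<^bsub>A\<^esub> y = \<zero>\<^bsub>A\<^esub>" using assms(4) * by simp
  then show "x = y"
    using * A.M.minus_equality[of x "\<ominus>\<^bsub>A\<^esub> y"] by (simp add: A.M.minus_eq)
qed

lemma lhom_inv_into:
  assumes "left_module R A" "f \<in> lhom R A B" "bij_betw f (carrier A) (carrier B)"
  shows "inv_into (carrier A) f \<in> lhom R B A"
proof -
  interpret A: left_module R A by fact
  let ?g = "inv_into (carrier A) f"
  have g: "?g y \<in> carrier A" "f (?g y) = y" if "y \<in> carrier B" for y
    using that assms(3) by (auto simp: bij_betw_def inv_into_into f_inv_into_f)
  have gf: "?g (f x) = x" if "x \<in> carrier A" for x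
    using that assms(3) by (auto simp: bij_betw_def)
  have 1: "?g (x \<oplus>\<^bsub>B\<^esub> y) = ?g x \<oplus>\<^bsub>A\<^esub> ?g y" if "x \<in> carrier B" "y \<in> carrier B" for x y
  proof -
    have "x \<oplus>\<^bsub>B\<^esub> y = f (?g x \<oplus>\<^bsub>A\<^esub> ?g y)" using that by (simp add: lhom_add[OF assms(2)] g)
    then show ?thesis using that by (simp add: gf g)
  qed
  have 2: "?g (a \<odot>\<^bsub>B\<^esub> x) = a \<odot>\<^bsub>A\<^esub> ?g x" if "x \<in> carrier B" "a \<in> carrier R" for x a
  proof -
    have "a \<odot>\<^bsub>B\<^esub> x = f (a \<odot>\<^bsub>A\<^esub> ?g x)" using that by (simp add: lhom_smult[OF assms(2)] g)
    then show ?thesis using that by (simp add: gf g A.smult_closed)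
  qed
  show ?thesis using g 1 2 by (auto simp: lhom_def)
qed

lemma lmod_iso_sym: "left_module R A \<Longrightarrow> lmod_iso R A B \<Longrightarrow> lmod_iso R B A"
  unfolding lmod_iso_def by (auto intro: lhom_inv_into bij_betw_inv_into bexI[rotated])

lemma lmod_iso_trans:
  assumes "lmod_iso R A B" "lmod_iso R B C" shows "lmod_iso R A C"
proof -
  obtain f g where "f \<in> lhom R A B" "bij_betw f (carrier A) (carrier B)"
    "g \<in> lhom R B C" "bij_betw g (carrier B) (carrier C)"
    using assms by (auto simp: lmod_iso_def)
  then show ?thesis unfolding lmod_iso_def
    using bij_betw_trans[of f "carrier A" "carrier B" g "carrier C"]
    by (intro bexI[of _ "\<lambda>x. g (f x)"] lhom_comp[of f R A B g C]) (simp_all add: comp_def)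
qed

lemma fg_module_image:
  assumes "fg_module R A" "left_module R B" "f \<in> lhom R A B" "f ` carrier A = carrier B"
  shows "fg_module R B"
proof -
  interpret A: left_module R A using assms by (simp add: fg_module_def)
  interpret B: left_module R B by fact
  obtain S where S: "S \<subseteq> carrier A" "finite S" "carrier A \<subseteq> lspan R A S (\<lambda>s. s)"
    using assms by (auto simp: fg_module_iff)
  have "carrier B \<subseteq> lspan R B S f"
  proof
    fix y assume "y \<in> carrier B"
    then obtain x where x: "x \<in> carrier A" "y = f x" using assms by blast
    then obtain v where v: "v \<in> S \<rightarrow> carrier R" "x = lincomb A S v (\<lambda>s. s)"
      using S by (auto simp: lspan_def)
    then have "y = lincomb B S v f"
      using lhom_lincomb[OF A.left_module_axioms B.left_module_axioms assms(3) S(2) v(1), of "\<lambda>s. s"] S x v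
      by (simp add: subset_iff)
    then show "y \<in> lspan R B S f" using v by (auto simp: lspan_def)
  qed
  then show ?thesis
    using S lhom_closed[OF assms(3)] B.left_module_axioms by (intro fg_moduleI[of _ _ S f]) auto
qed

text \<open>A split epimorphism comes with the projection onto its kernel along the section.\<close>

lemma split_projection:
  assumes "left_module R A" "left_module R B" "h \<in> lhom R A B" "s \<in> lhom R B A"
    and hs: "\<forall>x\<in>carrier B. h (s x) = x"
  defines "\<rho> \<equiv> \<lambda>y. y \<ominus>\<^bsub>A\<^esub> s (h y)"
  shows "\<rho> \<in> lhom R A (A\<lparr>carrier := a_kernel A B h\<rparr>)"
    and "\<And>y. y \<in> carrier A \<Longrightarrow> y = s (h y) \<oplus>\<^bsub>A\<^esub> \<rho> y"
    and "\<And>y. y \<in> a_kernel A B h \<Longrightarrow> \<rho> y = y"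
proof -
  interpret A: left_module R A by fact
  interpret B: left_module R B by fact
  note hc = lhom_closed[OF assms(3)] and sc = lhom_closed[OF assms(4)]
  have \<rho>k: "\<rho> y \<in> a_kernel A B h" if y: "y \<in> carrier A" for y
  proof -
    have "h (\<rho> y) = h y \<ominus>\<^bsub>B\<^esub> h (s (h y))"
      unfolding \<rho>_def by (rule lhom_diff[OF assms(1-3) y sc[OF hc[OF y]]])
    also have "\<dots> = \<zero>\<^bsub>B\<^esub>" using hs hc[OF y] by (simp add: B.M.minus_eq B.M.r_neg)
    finally show ?thesis using y sc[OF hc[OF y]] by (simp add: a_kernel_def' \<rho>_def)
  qed
  have "\<rho> \<in> lhom R A A"
    using hc sc
    by (auto simp: \<rho>_def lhom_def lhom_add[OF assms(3)] lhom_add[OF assms(4)] lhom_smult[OF assms(3)]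
        lhom_smult[OF assms(4)] A.M.minus_eq A.smult_r_distr A.smult_r_minus A.smult_closed
        A.M.minus_add A.M.a_ac)
  then show "\<rho> \<in> lhom R A (A\<lparr>carrier := a_kernel A B h\<rparr>)"
    by (rule lhom_restrict_cod) (use \<rho>k in auto)
  show "y = s (h y) \<oplus>\<^bsub>A\<^esub> \<rho> y" if y: "y \<in> carrier A" for y
    using y sc[OF hc[OF y]]
    by (simp add: \<rho>_def A.M.minus_eq A.M.a_ac A.M.r_neg A.M.r_neg2 A.M.r_neg1)
  show "\<rho> y = y" if "y \<in> a_kernel A B h" for y
    using that lhom_zero[OF assms(2,1,4)] by (simp add: \<rho>_def a_kernel_def' A.M.minus_eq)
qed

subsection \<open>Direct sums\<close>

lemma direct_sum_simps [simp]:
  "carrier (direct_sum A B) = carrier A \<times> carrier B"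
  "\<zero>\<^bsub>direct_sum A B\<^esub> = (\<zero>\<^bsub>A\<^esub>, \<zero>\<^bsub>B\<^esub>)"
  "x \<oplus>\<^bsub>direct_sum A B\<^esub> y = (fst x \<oplus>\<^bsub>A\<^esub> fst y, snd x \<oplus>\<^bsub>B\<^esub> snd y)"
  "a \<odot>\<^bsub>direct_sum A B\<^esub> x = (a \<odot>\<^bsub>A\<^esub> fst x, a \<odot>\<^bsub>B\<^esub> snd x)"
  by (auto simp: direct_sum_def case_prod_beta)

lemma left_module_direct_sum:
  assumes "left_module R A" "left_module R B"
  shows "left_module R (direct_sum A B)"
proof -
  interpret A: left_module R A by fact
  interpret B: left_module R B by fact
  have "abelian_group (direct_sum A B)"
  proof (rule abelian_groupI)
    fix x assume "x \<in> carrier (direct_sum A B)"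
    then show "\<exists>y\<in>carrier (direct_sum A B). y \<oplus>\<^bsub>direct_sum A B\<^esub> x = \<zero>\<^bsub>direct_sum A B\<^esub>"
      by (intro bexI[of _ "(\<ominus>\<^bsub>A\<^esub> fst x, \<ominus>\<^bsub>B\<^esub> snd x)"]) (auto simp: A.M.l_neg B.M.l_neg)
  qed (auto simp: A.M.a_ac B.M.a_ac)
  then show ?thesis
    by (intro left_module.intro A.R.ring_axioms left_module_axioms.intro)
      (auto simp: A.smult_l_distr A.smult_r_distr A.smult_assoc A.smult_one
        B.smult_l_distr B.smult_r_distr B.smult_assoc B.smult_one A.smult_closed B.smult_closed)
qed

lemma lmod_iso_internal_sum:
  assumes "left_module R M" "submodule U R M" "submodule V R M"
    "\<And>x. x \<in> carrier M \<Longrightarrow> \<exists>u\<in>U. \<exists>v\<in>V. x = u \<oplus>\<^bsub>M\<^esub> v" "U \<inter> V = {\<zero>\<^bsub>M\<^esub>}"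
  shows "lmod_iso R M (direct_sum (M\<lparr>carrier := U\<rparr>) (M\<lparr>carrier := V\<rparr>))"
proof -
  interpret M: left_module R M by fact
  interpret U: left_module R "M\<lparr>carrier := U\<rparr>" using assms by (intro M.left_module_submodule)
  interpret V: left_module R "M\<lparr>carrier := V\<rparr>" using assms by (intro M.left_module_submodule)
  note DU = M.submoduleD[OF assms(2)] and DV = M.submoduleD[OF assms(3)]
  let ?D = "direct_sum (M\<lparr>carrier := U\<rparr>) (M\<lparr>carrier := V\<rparr>)"
  let ?f = "\<lambda>(u, v). u \<oplus>\<^bsub>M\<^esub> v"
  have f: "?f \<in> lhom R ?D M"
    unfolding lhom_def using DU(1) DV(1)
    by (auto simp: subset_iff M.smult_r_distr M.M.a_ac)
  have D: "left_module R ?D" by (intro left_module_direct_sum U.left_module_axioms V.left_module_axioms)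
  have "inj_on ?f (carrier ?D)"
  proof (rule lhom_inj[OF D assms(1) f])
    fix x assume x: "x \<in> carrier ?D" "?f x = \<zero>\<^bsub>M\<^esub>"
    then obtain u v where uv: "x = (u, v)" "u \<in> U" "v \<in> V" by auto
    then have "u = \<ominus>\<^bsub>M\<^esub> v" using x DU(1) DV(1) by (simp add: subset_iff M.M.minus_equality)
    then have "u \<in> U \<inter> V" using uv DV by auto
    then have "u = \<zero>\<^bsub>M\<^esub>" using assms(5) by auto
    moreover from this have "v = \<zero>\<^bsub>M\<^esub>" using x uv DV(1) by (auto simp: subset_iff)
    ultimately show "x = \<zero>\<^bsub>?D\<^esub>" using uv by simp
  qed
  moreover have "?f ` carrier ?D = carrier M"
  proof
    show "?f ` carrier ?D \<subseteq> carrier M" using lhom_closed[OF f] by blast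
    show "carrier M \<subseteq> ?f ` carrier ?D"
    proof
      fix x assume "x \<in> carrier M"
      then obtain u v where "u \<in> U" "v \<in> V" "x = u \<oplus>\<^bsub>M\<^esub> v" using assms(4) by blast
      then show "x \<in> ?f ` carrier ?D" by (intro image_eqI[of _ _ "(u, v)"]) auto
    qed
  qed
  ultimately have "lmod_iso R ?D M" using f unfolding lmod_iso_def bij_betw_def by blast
  then show ?thesis using lmod_iso_sym D by blast
qed

section \<open>Projective modules, covers and projective dimension\<close>

lemma fmods_iff: "M \<in> fmods R \<longleftrightarrow> fg_module R M"
  by (simp add: fmods_def)

lemma projective_left_module: "projective R P \<Longrightarrow> left_module R P"
  and projective_fmods: "projective R (Q :: 'a fmod) \<Longrightarrow> Q \<in> fmods R"
  and fmods_left_module: "M \<in> fmods R \<Longrightarrow> left_module R M"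
  by (auto simp: projective_def fg_module_def fmods_def)

lemma projective_lift:
  assumes "projective R P" "A \<in> fmods R" "B \<in> fmods R" "g \<in> lhom R A B" "f \<in> lhom R P B"
    "g ` carrier A = carrier B"
  obtains h where "h \<in> lhom R P A" "\<And>x. x \<in> carrier P \<Longrightarrow> g (h x) = f x"
proof -
  have "\<exists>h \<in> lhom R P A. \<forall>x \<in> carrier P. g (h x) = f x"
    using assms(1)[unfolded projective_def, THEN conjunct2, rule_format, OF assms(2-6)] .
  then show ?thesis using that by auto
qed

lemma projective_retract:
  assumes "projective R P" "left_module R M" "s \<in> lhom R M P" "p \<in> lhom R P M"
    "\<And>x. x \<in> carrier M \<Longrightarrow> p (s x) = x"
  shows "projective R M"
proof -
  have "p ` carrier P = carrier M"
    using lhom_closed[OF assms(3)] lhom_closed[OF assms(4)] assms(5) by (force simp: image_iff)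
  then have "fg_module R M"
    using fg_module_image[OF _ assms(2,4)] assms(1) by (simp add: projective_def)
  moreover have "\<exists>h\<in>lhom R M A. \<forall>x\<in>carrier M. g (h x) = f x"
    if *: "A \<in> fmods R" "B \<in> fmods R" "g \<in> lhom R A B" "f \<in> lhom R M B" "g ` carrier A = carrier B"
    for A B g f
  proof -
    obtain h where h: "h \<in> lhom R P A" "\<And>x. x \<in> carrier P \<Longrightarrow> g (h x) = f (p x)"
      using projective_lift[OF assms(1) *(1-3) lhom_comp[OF assms(4) *(4)] *(5)] by blast
    then show ?thesis
      using lhom_closed[OF assms(3)] assms(5)
      by (intro bexI[of _ "\<lambda>x. h (s x)"] lhom_comp[OF assms(3)]) auto
  qed
  ultimately show ?thesis unfolding projective_def by auto
qed

lemma projective_iso: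
  assumes "projective R P" "left_module R M" "lmod_iso R P M"
  shows "projective R M"
proof -
  obtain f where f: "f \<in> lhom R P M" "bij_betw f (carrier P) (carrier M)"
    using assms(3) by (auto simp: lmod_iso_def)
  show ?thesis
    by (rule projective_retract[OF assms(1,2) lhom_inv_into[OF projective_left_module[OF assms(1)] f] f(1)])
      (use f(2) in \<open>auto simp: bij_betw_def f_inv_into_f\<close>)
qed

lemma projective_split:
  fixes P :: "'a fmod"
  assumes "projective R P" "A \<in> fmods R" "g \<in> lhom R A P" "g ` carrier A = carrier P"
  obtains s where "s \<in> lhom R P A" "\<And>x. x \<in> carrier P \<Longrightarrow> g (s x) = x"
  using projective_lift[OF assms(1,2) projective_fmods[OF assms(1)] assms(3) lhom_id assms(4)] by blast

lemma projective_zero_module: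
  assumes "left_module R M" "zero_module M"
  shows "projective R M"
proof -
  interpret left_module R M by fact
  have c: "carrier M = {\<zero>\<^bsub>M\<^esub>}" using assms(2) by (simp add: zero_module_def)
  have fg: "fg_module R M"
    by (rule fg_moduleI[of _ _ "{}" "\<lambda>_. \<zero>\<^bsub>M\<^esub>"]) (auto simp: assms c lspan_def lincomb_empty)
  have "\<exists>h\<in>lhom R M A. \<forall>x\<in>carrier M. g (h x) = f x"
    if *: "A \<in> fmods R" "B \<in> fmods R" "g \<in> lhom R A B" "f \<in> lhom R M B" for A B g f
  proof -
    interpret A: left_module R A using * by (simp add: fmods_left_module)
    interpret B: left_module R B using * by (simp add: fmods_left_module)
    have "(\<lambda>_. \<zero>\<^bsub>A\<^esub>) \<in> lhom R M A" by (auto simp: lhom_def A.smult_r_null)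
    moreover have "g \<zero>\<^bsub>A\<^esub> = f \<zero>\<^bsub>M\<^esub>"
      using lhom_zero[OF A.left_module_axioms B.left_module_axioms *(3)]
        lhom_zero[OF left_module_axioms B.left_module_axioms *(4)] by simp
    ultimately show ?thesis using c by auto
  qed
  then show ?thesis using fg unfolding projective_def by blast
qed

lemma projective_coverD:
  assumes "projective_cover R M P p"
  shows "projective R P" "p \<in> lhom R P M" "p ` carrier P = carrier M"
  using assms by (auto simp: projective_cover_def)

lemma projective_cover_superfluous:
  assumes "projective_cover R M P p" "left_module R M" "submodule U R P" "p ` U = carrier M"
  shows "U = carrier P"
proof -
  interpret P: left_module R P using assms(1) by (simp add: projective_cover_def projective_left_module)
  interpret M: left_module R M by fact
  note p = projective_coverD(2)[OF assms(1)] and U = P.submoduleD[OF assms(3)]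
  have "x \<in> set_add P U (a_kernel P M p)" if x: "x \<in> carrier P" for x
  proof -
    obtain u where u: "u \<in> U" "p u = p x" using lhom_closed[OF p x] assms(4) by (metis imageE)
    then have uP: "u \<in> carrier P" using U(1) by auto
    have "p (x \<ominus>\<^bsub>P\<^esub> u) = p x \<ominus>\<^bsub>M\<^esub> p u"
      by (rule lhom_diff[OF P.left_module_axioms assms(2) p x uP])
    then have "x \<ominus>\<^bsub>P\<^esub> u \<in> a_kernel P M p"
      using u x uP lhom_closed[OF p x] by (simp add: a_kernel_def' M.M.minus_eq M.M.r_neg)
    moreover have "x = u \<oplus>\<^bsub>P\<^esub> (x \<ominus>\<^bsub>P\<^esub> u)"
      using x uP by (simp add: P.M.minus_eq P.M.a_lcomm[of u x] P.M.r_neg)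
    ultimately show ?thesis unfolding set_add_def' using u(1) by blast
  qed
  moreover have "set_add P U (a_kernel P M p) \<subseteq> carrier P"
    using U(1) by (auto simp: set_add_def' a_kernel_def')
  ultimately show ?thesis using assms(1,3) unfolding projective_cover_def by blast
qed

text \<open>
  The image of a lift \<open>h\<close> of the identity maps onto \<open>M\<close>. As the kernel of the cover is superfluous,
  this image is everything, and \<open>h\<close> has a section. The section is again a lift of the identity, so it
  is onto by the same reason, and \<open>h\<close> is injective.
\<close>

lemma projective_cover_comparison:
  assumes "M \<in> fmods R" "projective_cover R M P p" "projective_cover R M P' p'"
    and h: "h \<in> lhom R P P'" "\<And>x. x \<in> carrier P \<Longrightarrow> p' (h x) = p x"
  shows "bij_betw h (carrier P) (carrier P')"
proof -
  note c = projective_coverD[OF assms(2)] and c' = projective_coverD[OF assms(3)]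
  interpret M: left_module R M using assms(1) by (simp add: fmods_left_module)
  interpret P: left_module R P using c(1) by (rule projective_left_module)
  interpret P': left_module R P' using c'(1) by (rule projective_left_module)
  have hP: "submodule (h ` carrier P) R P'"
    by (rule submodule_image[OF P.left_module_axioms P'.left_module_axioms h(1) P.submodule_carrier])
  have "p' ` (h ` carrier P) = p ` carrier P" using h(2) by (auto simp: image_iff)
  then have onto: "h ` carrier P = carrier P'"
    using projective_cover_superfluous[OF assms(3) M.left_module_axioms hP] c(3) by simp
  obtain s where s: "s \<in> lhom R P' P" "\<And>x. x \<in> carrier P' \<Longrightarrow> h (s x) = x"
    using projective_split[OF c'(1) projective_fmods[OF c(1)] h(1) onto] by blast
  have sP: "submodule (s ` carrier P') R P"
    by (rule submodule_image[OF P'.left_module_axioms P.left_module_axioms s(1) P'.submodule_carrier])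
  have "p (s x) = p' x" if "x \<in> carrier P'" for x
    using h(2)[OF lhom_closed[OF s(1) that]] s(2)[OF that] by simp
  then have "p ` (s ` carrier P') = p' ` carrier P'" by (auto simp: image_iff)
  then have sonto: "s ` carrier P' = carrier P"
    using projective_cover_superfluous[OF assms(2) M.left_module_axioms sP] c'(3) by simp
  have "inj_on h (carrier P)"
  proof (rule inj_onI)
    fix x y assume *: "x \<in> carrier P" "y \<in> carrier P" "h x = h y"
    then obtain x' y' where "x' \<in> carrier P'" "x = s x'" "y' \<in> carrier P'" "y = s y'"
      using sonto by blast
    then show "x = y" using * s(2) by auto
  qed
  then show ?thesis using onto by (simp add: bij_betw_def)
qed

lemma kernel_bij_betw:
  assumes "bij_betw h (carrier P) (carrier P')" "\<And>x. x \<in> carrier P \<Longrightarrow> p' (h x) = p x"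
  shows "bij_betw h (a_kernel P M p) (a_kernel P' M p')"
  using assms unfolding bij_betw_def a_kernel_def'
  by (auto simp: inj_on_def image_iff) (metis image_iff)

lemma projective_cover_unique:
  assumes "M \<in> fmods R" "projective_cover R M P p" "projective_cover R M P' p'"
  shows "lmod_iso R (P\<lparr>carrier := a_kernel P M p\<rparr>) (P'\<lparr>carrier := a_kernel P' M p'\<rparr>)"
proof -
  note c = projective_coverD[OF assms(2)] and c' = projective_coverD[OF assms(3)]
  obtain h where h: "h \<in> lhom R P P'" "\<And>x. x \<in> carrier P \<Longrightarrow> p' (h x) = p x"
    using projective_lift[OF c(1) projective_fmods[OF c'(1)] assms(1) c'(2) c(2) c'(3)] by blast
  have b: "bij_betw h (carrier P) (carrier P')"
    by (rule projective_cover_comparison[OF assms h])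
  have k: "bij_betw h (a_kernel P M p) (a_kernel P' M p')"
    by (rule kernel_bij_betw[OF b]) (rule h(2))
  have "h \<in> lhom R (P\<lparr>carrier := a_kernel P M p\<rparr>) (P'\<lparr>carrier := a_kernel P' M p'\<rparr>)"
    by (rule lhom_restrict[OF h(1)]) (use k in \<open>auto simp: bij_betw_def a_kernel_def'\<close>)
  then show ?thesis using k unfolding lmod_iso_def by auto
qed

subsection \<open>Projective dimension by recursion\<close>

text \<open>
  Projective dimension at most \<open>n\<close>, by the existence of one suitable projective module onto \<open>M\<close>. In
  contrast to resolutions, which are infinite sequences, this allows induction on \<open>n\<close>.
\<close>

primrec pd_le :: "('a, 'r) ring_scheme \<Rightarrow> nat \<Rightarrow> 'a fmod \<Rightarrow> bool" where
  "pd_le R 0 M \<longleftrightarrow> projective R M"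
| "pd_le R (Suc n) M \<longleftrightarrow> M \<in> fmods R \<and>
     (\<exists>Q g. projective R Q \<and> g \<in> lhom R Q M \<and> g ` carrier Q = carrier M \<and>
        pd_le R n (Q\<lparr>carrier := a_kernel Q M g\<rparr>))"

lemma pd_le_fmods: "pd_le R n M \<Longrightarrow> M \<in> fmods R"
  by (cases n) (auto simp: projective_fmods)

lemma pd_le_resolution:
  fixes M :: "'a fmod"
  assumes "pd_le R n M"
  shows "\<exists>P \<epsilon> d. projective_resolution R M P \<epsilon> d \<and> (\<forall>i>n. zero_module (P i))"
  using assms
proof (induction n arbitrary: M)
  case 0
  then have p: "projective R M" by simp
  interpret M: left_module R M using p by (rule projective_left_module)
  let ?Z = "M\<lparr>carrier := {\<zero>\<^bsub>M\<^esub>}\<rparr>"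
  interpret Z: left_module R ?Z by (rule M.left_module_submodule[OF M.submodule_zero])
  have z: "zero_module ?Z" by (simp add: zero_module_def)
  let ?P = "\<lambda>i::nat. if i = 0 then M else ?Z"
  have "projective_resolution R M ?P (\<lambda>x. x) (\<lambda>i x. x)"
    using p projective_zero_module[OF Z.left_module_axioms z]
    by (auto simp: projective_resolution_def a_kernel_def' lhom_def)
  moreover have "\<forall>i>0. zero_module (?P i)" using z by auto
  ultimately show ?case by blast
next
  case (Suc n)
  then obtain Q g where Q: "projective R Q" "g \<in> lhom R Q M" "g ` carrier Q = carrier M"
    "pd_le R n (Q\<lparr>carrier := a_kernel Q M g\<rparr>)" by auto
  then obtain P \<epsilon> d where P: "projective_resolution R (Q\<lparr>carrier := a_kernel Q M g\<rparr>) P \<epsilon> d"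
     "\<forall>i>n. zero_module (P i)" using Suc.IH by blast
  have e: "\<epsilon> \<in> lhom R (P 0) Q" 
    using P(1) unfolding projective_resolution_def 
    by (intro lhom_enlarge_cod[where V = "a_kernel Q M g" and B = Q]) (auto simp: a_kernel_def')
  let ?P = "\<lambda>i. case i of 0 \<Rightarrow> Q | Suc i \<Rightarrow> P i"
  let ?d = "\<lambda>i. case i of 0 \<Rightarrow> \<epsilon> | Suc i \<Rightarrow> d i"
  have "projective_resolution R M ?P g ?d"
    unfolding projective_resolution_def
    using P(1) Q e by (auto simp: projective_resolution_def a_kernel_def' split: nat.split)
  moreover have "\<forall>i>Suc n. zero_module (?P i)" using P(2) by (auto split: nat.split)
  ultimately show ?case by blast
qed

lemma proj_dim_le: "pd_le R n M \<Longrightarrow> proj_dim R M \<le> enat n"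
  unfolding proj_dim_def by (rule Inf_lower) (use pd_le_resolution in blast)

lemma resolution_pd_le:
  assumes "M \<in> fmods R" "projective_resolution R M P \<epsilon> d" "\<forall>i>n. zero_module (P i)"
  shows "pd_le R n M"
  using assms
proof (induction n arbitrary: M P \<epsilon> d)
  case 0
  have pr: "projective R (P i)" for i using 0 by (simp add: projective_resolution_def)
  interpret M: left_module R M using 0 by (simp add: fmods_left_module)
  interpret P0: left_module R "P 0" by (rule projective_left_module[OF pr])
  interpret P1: left_module R "P 1" by (rule projective_left_module[OF pr])
  have e: "\<epsilon> \<in> lhom R (P 0) M" "\<epsilon> ` carrier (P 0) = carrier M" "d 0 \<in> lhom R (P 1) (P 0)"
    "d 0 ` carrier (P 1) = a_kernel (P 0) M \<epsilon>"
    using 0 by (auto simp: projective_resolution_def)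
  have "a_kernel (P 0) M \<epsilon> = {\<zero>\<^bsub>P 0\<^esub>}"
    using 0 e(4) lhom_zero[OF P1.left_module_axioms P0.left_module_axioms e(3)] by (auto simp: zero_module_def)
  then have "inj_on \<epsilon> (carrier (P 0))"
    by (intro lhom_inj[OF P0.left_module_axioms M.left_module_axioms e(1)]) (auto simp: a_kernel_def')
  then have "lmod_iso R (P 0) M" using e unfolding lmod_iso_def bij_betw_def by blast
  then show ?case using projective_iso[OF pr M.left_module_axioms] by simp
next
  case (Suc n)
  have pr: "projective R (P i)" for i using Suc by (simp add: projective_resolution_def)
  have e: "\<epsilon> \<in> lhom R (P 0) M" "\<epsilon> ` carrier (P 0) = carrier M" "\<And>i. d i \<in> lhom R (P (Suc i)) (P i)"
    "d 0 ` carrier (P (Suc 0)) = a_kernel (P 0) M \<epsilon>"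
    "\<And>i. d (Suc i) ` carrier (P (Suc (Suc i))) = a_kernel (P (Suc i)) (P i) (d i)"
    using Suc by (auto simp: projective_resolution_def)
  let ?K = "(P 0)\<lparr>carrier := a_kernel (P 0) M \<epsilon>\<rparr>"
  interpret M: left_module R M using Suc by (simp add: fmods_left_module)
  interpret P0: left_module R "P 0" by (rule projective_left_module[OF pr])
  have K: "left_module R ?K"
    by (rule P0.left_module_submodule[OF submodule_kernel[OF P0.left_module_axioms M.left_module_axioms e(1)]])
  have d0: "d 0 \<in> lhom R (P (Suc 0)) ?K"
    by (rule lhom_restrict_cod[OF e(3)]) (simp add: e(4))
  have "fg_module R (P (Suc 0))" using pr[of "Suc 0"] by (simp add: projective_def)
  then have "?K \<in> fmods R" unfolding fmods_iff by (rule fg_module_image[OF _ K d0]) (simp add: e(4))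
  moreover have "projective_resolution R ?K (\<lambda>i. P (Suc i)) (d 0) (\<lambda>i. d (Suc i))"
    unfolding projective_resolution_def
    using pr e d0 by (simp add: a_kernel_def')
  ultimately have "pd_le R n ?K"
    using Suc.prems(3) by (intro Suc.IH[of ?K "\<lambda>i. P (Suc i)" "d 0" "\<lambda>i. d (Suc i)"]) auto
  then show ?case using Suc.prems(1) pr e by auto
qed

lemma finite_proj_dim_pd_le:
  assumes "M \<in> fmods R" "proj_dim R M < \<infinity>"
  obtains n where "pd_le R n M"
proof -
  let ?S = "{enat n | n. \<exists>P \<epsilon> d. projective_resolution R M P \<epsilon> d \<and> (\<forall>i>n. zero_module (P i))}"
  have "\<exists>n P \<epsilon> d. projective_resolution R M P \<epsilon> d \<and> (\<forall>i>n. zero_module (P i))"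
  proof (rule ccontr)
    assume "\<not> ?thesis"
    then have "?S = {}" by simp
    then show False using assms(2) by (simp add: proj_dim_def Inf_enat_def)
  qed
  then obtain n P \<epsilon> d where "projective_resolution R M P \<epsilon> d" "\<forall>i>n. zero_module (P i)" by auto
  then show ?thesis by (intro that resolution_pd_le[OF assms(1)])
qed

section \<open>Rings of cyclic Nakayama type\<close>

text \<open>
  A polynomial with nonzero constant term acts invertibly wherever a power of the variable acts as
  zero. An error term \<open>v X\<^sup>n\<close> becomes divisible by \<open>X\<^bsup>n+1\<^esup>\<close> after subtracting a suitable multiple of \<open>q X\<^sup>n\<close>.
\<close>

lemma poly_inverse_mod_monom:
  fixes q :: "'k::field poly"
  assumes "coeff q 0 \<noteq> 0"
  shows "\<exists>u v. u * q + v * monom 1 n = 1"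
proof (induction n)
  case 0
  show ?case by (intro exI[of _ 0] exI[of _ 1]) (simp add: monom_0)
next
  case (Suc n)
  then obtain u v where uv: "u * q + v * monom 1 n = 1" by blast
  define \<alpha> where "\<alpha> = coeff v 0 / coeff q 0"
  have "coeff (v - smult \<alpha> q) 0 = 0" using assms by (simp add: \<alpha>_def)
  then obtain w where w: "v - smult \<alpha> q = pCons 0 w"
    by (metis coeff_pCons_0 pCons_cases)
  have "(u + smult \<alpha> (monom 1 n)) * q + w * monom 1 (Suc n)
      = u * q + (smult \<alpha> q + pCons 0 w) * monom 1 n"
    by (simp add: monom_Suc algebra_simps)
  also have "smult \<alpha> q + pCons 0 w = v" by (simp flip: w)
  finally show ?case using uv by metis
qed

lemma poly_factor_monom:
  fixes p :: "'k::field poly"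
  assumes "p \<noteq> 0"
  shows "\<exists>m q. p = monom 1 m * q \<and> coeff q 0 \<noteq> 0"
proof -
  obtain q where q: "p = [:- 0, 1:] ^ order 0 p * q" "\<not> [:- 0, 1:] dvd q"
    using order_decomp[OF assms, of 0] by blast
  moreover have "[:0, 1:] ^ m = (monom 1 m :: 'k poly)" for m by (simp add: monom_altdef)
  moreover have "coeff q 0 \<noteq> 0"
    using q(2) by (simp add: dvd_iff_poly_eq_0 poly_0_coeff_0)
  ultimately show ?thesis by (intro exI[of _ "order 0 p"] exI[of _ q]) simp
qed

text \<open>
  The vertices of the cyclic quiver are indexed by all integers, with period \<open>N\<close>, so that paths become
  intervals. The idempotent at the vertex \<open>a\<close> is \<open>e a\<close>, and \<open>pv p\<close> is the value of the polynomial \<open>p\<close>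
  at the sum \<open>t\<close> of all arrows. Thus \<open>t\<^sup>n e a\<close> is the path of length \<open>n\<close> that starts at \<open>a\<close>, and \<open>c a\<close> is
  the length of the indecomposable projective module at \<open>a\<close>.
\<close>

locale cyclic_nakayama = ring R
  for R :: "('a, 'm) ring_scheme" (structure) +
  fixes N :: nat and e :: "int \<Rightarrow> 'a" and pv :: "'k::field poly \<Rightarrow> 'a" and c :: "int \<Rightarrow> nat"
  assumes N_pos: "N > 0"
    and e_closed [simp]: "e a \<in> carrier R"
    and e_period: "e (a + int N) = e a"
    and e_idem: "e a \<otimes> e a = e a"
    and e_sum: "(\<Oplus>i\<in>{..<N}. e (int i)) = \<one>"
    and pv_closed [simp]: "pv p \<in> carrier R"
    and pv_add: "pv (p + q) = pv p \<oplus> pv q"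
    and pv_mult: "pv (p * q) = pv p \<otimes> pv q"
    and pv_one: "pv 1 = \<one>"
    and pv_X_e: "pv (Polynomial.monom 1 (Suc 0)) \<otimes> e a = e (a + 1) \<otimes> pv (Polynomial.monom 1 (Suc 0))"
    and pv_const_e: "pv [:k:] \<otimes> e a = e a \<otimes> pv [:k:]"
    and spanning: "u \<in> carrier R \<Longrightarrow> \<exists>p. u \<otimes> e a = pv p \<otimes> e a"
    and vanish: "pv (Polynomial.monom 1 n) \<otimes> e a = \<zero> \<longleftrightarrow> c a \<le> n"
begin

abbreviation t :: "nat \<Rightarrow> 'a" where
  "t n \<equiv> pv (Polynomial.monom 1 n)"

lemma pv_zero: "pv 0 = \<zero>"
  using pv_add[of 0 0] by (metis add.r_cancel_one add_0 l_zero pv_closed zero_closed)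

lemma t_0: "t 0 = \<one>"
  by (simp add: monom_0 one_pCons[symmetric] pv_one del: one_pCons)

lemma t_add: "t (m + n) = t m \<otimes> t n"
  by (simp add: mult_monom flip: pv_mult)

lemma t_pv: "t n \<otimes> pv p = pv p \<otimes> t n"
  by (simp add: mult.commute flip: pv_mult)

lemma t_e: "t n \<otimes> e a = e (a + int n) \<otimes> t n"
proof (induction n arbitrary: a)
  case (Suc n)
  have "t (Suc n) \<otimes> e a = t n \<otimes> (t (Suc 0) \<otimes> e a)"
    using t_add[of n "Suc 0"] by (simp add: m_assoc)
  also have "\<dots> = (t n \<otimes> e (a + 1)) \<otimes> t (Suc 0)" by (simp add: pv_X_e m_assoc)
  also have "\<dots> = e (a + 1 + int n) \<otimes> t (Suc n)"
    using t_add[of n "Suc 0"] by (simp add: Suc m_assoc)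
  finally show ?case by (simp add: algebra_simps)
qed (use t_0 in simp)

lemma e_shift_nat: "e (a + int N * int w) = e a"
proof (induction w)
  case (Suc w)
  then show ?case using e_period[of "a + int N * int w"] by (simp add: algebra_simps)
qed simp

lemma e_shift: "e (a + int N * w) = e a"
  using e_shift_nat[of a "nat w"] e_shift_nat[of "a + int N * w" "nat (- w)"]
  by (cases "w \<ge> 0") auto

lemma c_shift: "c (a + int N * w) = c a"
  using vanish[of _ a] vanish[of _ "a + int N * w"] by (metis e_shift order_antisym_conv order_refl)

lemma c_mono_step: "c a \<le> Suc (c (a + 1))"
proof -
  have "t (Suc (c (a + 1))) \<otimes> e a = t (c (a + 1)) \<otimes> (t (Suc 0) \<otimes> e a)"
    using t_add[of "c (a + 1)" "Suc 0"] by (simp add: m_assoc)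
  also have "\<dots> = (t (c (a + 1)) \<otimes> e (a + 1)) \<otimes> t (Suc 0)" by (simp add: pv_X_e m_assoc)
  also have "t (c (a + 1)) \<otimes> e (a + 1) = \<zero>" using vanish by simp
  finally show ?thesis using vanish by simp
qed

subsection \<open>Homogeneous elements\<close>

text \<open>
  A homogeneous element \<open>x\<close> of degree \<open>a\<close> and length \<open>l\<close> generates the uniserial module with top at
  the vertex \<open>a\<close> and basis \<open>x, t x, \<dots>, t\<^bsup>l-1\<^esup> x\<close>.
\<close>

definition homogeneous :: "('a, 'b, 'n) module_scheme \<Rightarrow> 'b \<Rightarrow> int \<Rightarrow> nat \<Rightarrow> bool" where
  "homogeneous M x a l \<longleftrightarrow> x \<in> carrier M \<and> e a \<odot>\<^bsub>M\<^esub> x = x \<and> (\<forall>n. t n \<odot>\<^bsub>M\<^esub> x = \<zero>\<^bsub>M\<^esub> \<longleftrightarrow> l \<le> n)"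

lemma homogeneousD:
  assumes "homogeneous M x a l"
  shows "x \<in> carrier M" "e a \<odot>\<^bsub>M\<^esub> x = x" "t l \<odot>\<^bsub>M\<^esub> x = \<zero>\<^bsub>M\<^esub>" "\<And>n. t n \<odot>\<^bsub>M\<^esub> x = \<zero>\<^bsub>M\<^esub> \<longleftrightarrow> l \<le> n"
  using assms by (auto simp: homogeneous_def)

text \<open>
  On elements of degree \<open>a\<close>, only the right multiple of a scalar by \<open>e a\<close> matters. By \<open>spanning\<close>, every
  scalar can therefore be replaced by a polynomial in \<open>t\<close>.
\<close>

lemma smult_eq_of_e:
  assumes "left_module R M" "x \<in> carrier M" "e a \<odot>\<^bsub>M\<^esub> x = x" "u \<in> carrier R" "v \<in> carrier R"
    "u \<otimes> e a = v \<otimes> e a"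
  shows "u \<odot>\<^bsub>M\<^esub> x = v \<odot>\<^bsub>M\<^esub> x"
proof -
  interpret M: left_module R M by fact
  have "u \<odot>\<^bsub>M\<^esub> x = (u \<otimes> e a) \<odot>\<^bsub>M\<^esub> x" using assms(1-5) by (simp add: M.smult_assoc)
  also have "\<dots> = v \<odot>\<^bsub>M\<^esub> x" unfolding assms(6) using assms(1-5) by (simp add: M.smult_assoc)
  finally show ?thesis .
qed

lemma homogeneous_exists:
  assumes "left_module R M" "x \<in> carrier M" "e a \<odot>\<^bsub>M\<^esub> x = x"
  shows "\<exists>l. homogeneous M x a l"
proof -
  interpret M: left_module R M by fact
  define l where "l = (LEAST n. t n \<odot>\<^bsub>M\<^esub> x = \<zero>\<^bsub>M\<^esub>)"
  have "t (c a) \<odot>\<^bsub>M\<^esub> x = \<zero> \<odot>\<^bsub>M\<^esub> x"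
    using vanish[of "c a" a] by (intro smult_eq_of_e[OF assms]) auto
  then have ex: "t (c a) \<odot>\<^bsub>M\<^esub> x = \<zero>\<^bsub>M\<^esub>" using assms by (simp add: M.smult_l_null)
  then have l: "t l \<odot>\<^bsub>M\<^esub> x = \<zero>\<^bsub>M\<^esub>" unfolding l_def by (rule LeastI)
  have "t n \<odot>\<^bsub>M\<^esub> x = \<zero>\<^bsub>M\<^esub> \<longleftrightarrow> l \<le> n" for n
  proof
    show "l \<le> n" if "t n \<odot>\<^bsub>M\<^esub> x = \<zero>\<^bsub>M\<^esub>" using that unfolding l_def by (rule Least_le)
    assume "l \<le> n"
    then have "t n = t (n - l) \<otimes> t l" using t_add[of "n - l" l] by simp
    then show "t n \<odot>\<^bsub>M\<^esub> x = \<zero>\<^bsub>M\<^esub>"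
      using assms l by (simp add: M.smult_assoc M.smult_r_null)
  qed
  then show ?thesis using assms by (auto simp: homogeneous_def)
qed

lemma homogeneous_le:
  assumes "left_module R M" "homogeneous M x a l"
  shows "l \<le> c a"
proof -
  interpret M: left_module R M by fact
  note h = homogeneousD[OF assms(2)]
  have "t (c a) \<odot>\<^bsub>M\<^esub> x = \<zero> \<odot>\<^bsub>M\<^esub> x"
    using vanish[of "c a" a] by (intro smult_eq_of_e[OF assms(1) h(1,2)]) auto
  then show ?thesis using h M.smult_l_null by simp
qed

text \<open>
  The annihilator of \<open>x\<close> in the polynomial ring contains a power of the variable, so it is generated
  by one: any other factor of a polynomial in it has nonzero constant term and acts invertibly.
\<close>

lemma homogeneous_pv_zero_iff:
  assumes "left_module R M" "homogeneous M x a l"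
  shows "pv p \<odot>\<^bsub>M\<^esub> x = \<zero>\<^bsub>M\<^esub> \<longleftrightarrow> Polynomial.monom 1 l dvd p"
proof -
  interpret M: left_module R M by fact
  note h = homogeneousD[OF assms(2)]
  show ?thesis
  proof
    assume "Polynomial.monom 1 l dvd p"
    then obtain q where "p = q * Polynomial.monom 1 l" by (metis dvd_def mult.commute)
    then show "pv p \<odot>\<^bsub>M\<^esub> x = \<zero>\<^bsub>M\<^esub>" using h(1-3) by (simp add: pv_mult M.smult_assoc M.smult_r_null)
  next
    assume *: "pv p \<odot>\<^bsub>M\<^esub> x = \<zero>\<^bsub>M\<^esub>"
    show "Polynomial.monom 1 l dvd p"
    proof (cases "p = 0")
      case False
      obtain m q where q: "p = Polynomial.monom 1 m * q" "Polynomial.coeff q 0 \<noteq> 0" using poly_factor_monom[OF False] by blast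
      obtain u v where uv: "u * q + v * Polynomial.monom 1 l = 1" using poly_inverse_mod_monom[OF q(2), of l] by blast
      have "Polynomial.monom 1 m = u * p + Polynomial.monom 1 m * v * Polynomial.monom 1 l"
        using arg_cong[OF uv, of "\<lambda>z. Polynomial.monom 1 m * z"] by (simp add: q(1) algebra_simps)
      then have "t m = pv u \<otimes> pv p \<oplus> pv (Polynomial.monom 1 m * v) \<otimes> t l"
        by (metis pv_add pv_mult)
      then have "t m \<odot>\<^bsub>M\<^esub> x = \<zero>\<^bsub>M\<^esub>"
        using h(1-3) * by (simp add: M.smult_l_distr M.smult_assoc M.smult_r_null)
      then have "l \<le> m" using h by simp
      then have "Polynomial.monom 1 l dvd (Polynomial.monom 1 m :: 'k poly)"
        by (intro dvdI[of _ _ "Polynomial.monom 1 (m - l)"]) (simp add: mult_monom)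
      then show ?thesis using q(1) by (metis dvd_mult2)
    qed simp
  qed
qed

text \<open>
  The annihilator of a homogeneous element depends on its degree and its length only. This is what
  makes homomorphisms between uniserial modules available.
\<close>

lemma homogeneous_annihilator:
  assumes "left_module R M" "homogeneous M x a l" "left_module R B"
    "y \<in> carrier B" "e a \<odot>\<^bsub>B\<^esub> y = y" "t l \<odot>\<^bsub>B\<^esub> y = \<zero>\<^bsub>B\<^esub>"
    "v \<in> carrier R" "v \<odot>\<^bsub>M\<^esub> x = \<zero>\<^bsub>M\<^esub>"
  shows "v \<odot>\<^bsub>B\<^esub> y = \<zero>\<^bsub>B\<^esub>"
proof -
  interpret B: left_module R B by fact
  note h = homogeneousD[OF assms(2)]
  obtain p where p: "v \<otimes> e a = pv p \<otimes> e a" using spanning assms(7) by blast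
  have "pv p \<odot>\<^bsub>M\<^esub> x = \<zero>\<^bsub>M\<^esub>"
    using smult_eq_of_e[OF assms(1) h(1,2) assms(7) _ p] assms(8) by simp
  then have "Polynomial.monom 1 l dvd p" using homogeneous_pv_zero_iff[OF assms(1,2)] by simp
  then obtain q where "p = q * Polynomial.monom 1 l" by (metis dvd_def mult.commute)
  then have "pv p \<odot>\<^bsub>B\<^esub> y = \<zero>\<^bsub>B\<^esub>" using assms by (simp add: pv_mult B.smult_assoc B.smult_r_null)
  then show ?thesis using smult_eq_of_e[OF assms(3-5) assms(7) _ p] by simp
qed

text \<open>
  The component of \<open>q(t) x\<close> in the degree of \<open>x\<close> is \<open>q'(t) x\<close> for a polynomial \<open>q'\<close> with the same
  constant term as \<open>q\<close>, and this acts invertibly on \<open>x\<close>.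
\<close>

lemma homogeneous_unit:
  assumes "left_module R M" "x \<in> carrier M" "e a \<odot>\<^bsub>M\<^esub> x = x" "Polynomial.coeff q 0 \<noteq> 0"
  shows "\<exists>u\<in>carrier R. u \<odot>\<^bsub>M\<^esub> (e a \<odot>\<^bsub>M\<^esub> (pv q \<odot>\<^bsub>M\<^esub> x)) = x"
proof -
  interpret M: left_module R M by fact
  obtain q0 s where q: "q = pCons q0 s" by (cases q) 
  have qs: "pCons q0 s' = [:q0:] + Polynomial.monom 1 (Suc 0) * s'" for s' :: "'k poly" by (simp add: monom_Suc monom_0)
  obtain s' where s': "(e (a - 1) \<otimes> pv s) \<otimes> e a = pv s' \<otimes> e a" using spanning by (meson e_closed m_closed pv_closed)
  have "(e a \<otimes> pv q) \<otimes> e a = e a \<otimes> pv [:q0:] \<otimes> e a \<oplus> e a \<otimes> t (Suc 0) \<otimes> pv s \<otimes> e a"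
    unfolding q qs[of s] pv_add pv_mult by (simp add: l_distr r_distr m_assoc)
  also have "e a \<otimes> pv [:q0:] \<otimes> e a = pv [:q0:] \<otimes> e a"
    by (metis e_closed e_idem m_assoc pv_closed pv_const_e)
  also have "e a \<otimes> t (Suc 0) = t (Suc 0) \<otimes> e (a - 1)" using pv_X_e[of "a - 1"] by simp
  also have "t (Suc 0) \<otimes> e (a - 1) \<otimes> pv s \<otimes> e a = t (Suc 0) \<otimes> (pv s' \<otimes> e a)" by (simp add: m_assoc flip: s')
  also have "pv [:q0:] \<otimes> e a \<oplus> t (Suc 0) \<otimes> (pv s' \<otimes> e a) = pv (pCons q0 s') \<otimes> e a"
    unfolding qs[of s'] pv_add pv_mult by (simp add: l_distr m_assoc)
  finally have eq: "(e a \<otimes> pv q) \<otimes> e a = pv (pCons q0 s') \<otimes> e a" .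
  have "e a \<odot>\<^bsub>M\<^esub> (pv q \<odot>\<^bsub>M\<^esub> x) = (e a \<otimes> pv q) \<odot>\<^bsub>M\<^esub> x" using assms by (simp add: M.smult_assoc)
  also have "\<dots> = pv (pCons q0 s') \<odot>\<^bsub>M\<^esub> x" by (rule smult_eq_of_e[OF assms(1-3) _ _ eq]) auto
  finally have 1: "e a \<odot>\<^bsub>M\<^esub> (pv q \<odot>\<^bsub>M\<^esub> x) = pv (pCons q0 s') \<odot>\<^bsub>M\<^esub> x" .
  obtain l where l: "homogeneous M x a l" using homogeneous_exists[OF assms(1-3)] by blast
  have "Polynomial.coeff (pCons q0 s') 0 \<noteq> 0" using assms(4) q by simp
  then obtain u v where uv: "u * pCons q0 s' + v * Polynomial.monom 1 l = 1" using poly_inverse_mod_monom by blast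
  have "x = pv (u * pCons q0 s' + v * Polynomial.monom 1 l) \<odot>\<^bsub>M\<^esub> x"
    unfolding uv using assms by (simp add: pv_one M.smult_one)
  also have "\<dots> = pv u \<odot>\<^bsub>M\<^esub> (pv (pCons q0 s') \<odot>\<^bsub>M\<^esub> x)"
    using assms(1-3) homogeneousD(1-3)[OF l] unfolding pv_add pv_mult
    by (simp add: M.smult_l_distr M.smult_assoc M.smult_r_null M.smult_closed)
  finally show ?thesis using 1 by (intro bexI[of _ "pv u"]) auto
qed

subsection \<open>Decompositions into uniserial modules\<close>

text \<open>
  The module is the internal direct sum of the uniserial modules generated by the elements \<open>x i\<close>.
  Independence is required of the summands \<open>v i x i\<close>, not of the coefficients, as the \<open>x i\<close> have
  nontrivial annihilators.
\<close>

definition decomp :: "('a, 'b, 'n) module_scheme \<Rightarrow> 'i set \<Rightarrow> ('i \<Rightarrow> 'b) \<Rightarrow> ('i \<Rightarrow> int) \<Rightarrow> ('i \<Rightarrow> nat) \<Rightarrow> bool" where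
  "decomp M I x a l \<longleftrightarrow> finite I \<and> (\<forall>i\<in>I. homogeneous M (x i) (a i) (l i) \<and> l i > 0) \<and>
     carrier M \<subseteq> lspan R M I x \<and>
     (\<forall>v \<in> I \<rightarrow> carrier R. lincomb M I v x = \<zero>\<^bsub>M\<^esub> \<longrightarrow> (\<forall>i\<in>I. v i \<odot>\<^bsub>M\<^esub> x i = \<zero>\<^bsub>M\<^esub>))"

lemma decompD:
  assumes "decomp M I x a l"
  shows "finite I" "\<And>i. i \<in> I \<Longrightarrow> homogeneous M (x i) (a i) (l i)" "\<And>i. i \<in> I \<Longrightarrow> l i > 0"
    "\<And>m. m \<in> carrier M \<Longrightarrow> \<exists>v\<in>I \<rightarrow> carrier R. m = lincomb M I v x"
    "\<And>v i. v \<in> I \<rightarrow> carrier R \<Longrightarrow> lincomb M I v x = \<zero>\<^bsub>M\<^esub> \<Longrightarrow> i \<in> I \<Longrightarrow> v i \<odot>\<^bsub>M\<^esub> x i = \<zero>\<^bsub>M\<^esub>"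
    "x \<in> I \<rightarrow> carrier M"
  using assms unfolding decomp_def lspan_def by (auto dest: homogeneousD(1))

lemma decomp_fg:
  assumes "left_module R M" "decomp M I x a l" shows "fg_module R M"
  using assms(2) by (intro fg_moduleI[OF assms(1), of I x]) (auto simp: decomp_def dest: homogeneousD(1))

lemma lincomb_indicator:
  assumes "left_module R M" "finite I" "x \<in> I \<rightarrow> carrier M" "i \<in> I"
  shows "lincomb M I (\<lambda>j. if j = i then \<one> else \<zero>) x = x i"
proof -
  interpret M: left_module R M by fact
  have "lincomb M I (\<lambda>j. if j = i then \<one> else \<zero>) x = (if i = i then \<one> else \<zero>) \<odot>\<^bsub>M\<^esub> x i"
    using assms by (intro M.lincomb_single) (auto simp: M.smult_l_null Pi_iff)
  then show ?thesis using assms by (auto simp: M.smult_one Pi_iff)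
qed

text \<open>Homomorphisms on a direct sum of cyclic modules are prescribed on the generators.\<close>

lemma decomp_lift:
  assumes "left_module R M" "decomp M I x a l" "left_module R B"
    and y: "\<And>i. i \<in> I \<Longrightarrow> y i \<in> carrier B" "\<And>i. i \<in> I \<Longrightarrow> e (a i) \<odot>\<^bsub>B\<^esub> y i = y i"
      "\<And>i. i \<in> I \<Longrightarrow> t (l i) \<odot>\<^bsub>B\<^esub> y i = \<zero>\<^bsub>B\<^esub>"
  obtains \<phi> where "\<phi> \<in> lhom R M B" "\<And>v. v \<in> I \<rightarrow> carrier R \<Longrightarrow> \<phi> (lincomb M I v x) = lincomb B I v y"
    "\<And>i. i \<in> I \<Longrightarrow> \<phi> (x i) = y i"
proof -
  interpret M: left_module R M by fact
  interpret B: left_module R B by fact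
  note d = decompD[OF assms(2)]
  have yc: "y \<in> I \<rightarrow> carrier B" using y by auto
  define w where "w m = (SOME v. v \<in> I \<rightarrow> carrier R \<and> m = lincomb M I v x)" for m
  have w: "w m \<in> I \<rightarrow> carrier R" "m = lincomb M I (w m) x" if "m \<in> carrier M" for m
  proof -
    have "\<exists>v. v \<in> I \<rightarrow> carrier R \<and> m = lincomb M I v x" using d(4)[OF that] by auto
    from someI_ex[OF this] show "w m \<in> I \<rightarrow> carrier R" "m = lincomb M I (w m) x"
      unfolding w_def by auto
  qed
  define \<phi> where "\<phi> m = lincomb B I (w m) y" for m
  have key: "\<phi> (lincomb M I v x) = lincomb B I v y" if v: "v \<in> I \<rightarrow> carrier R" for v
  proof -
    let ?m = "lincomb M I v x"
    have m: "?m \<in> carrier M" using v d(6) by (rule M.lincomb_closed)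
    note wm = w[OF m]
    have neg: "(\<lambda>i. \<ominus> v i) \<in> I \<rightarrow> carrier R" using v by auto
    have "lincomb M I (\<lambda>i. w ?m i \<oplus> \<ominus> v i) x = lincomb M I (w ?m) x \<oplus>\<^bsub>M\<^esub> lincomb M I (\<lambda>i. \<ominus> v i) x"
      by (rule M.lincomb_add[symmetric]) (use wm neg d(6) in auto)
    also have "\<dots> = lincomb M I v x \<oplus>\<^bsub>M\<^esub> lincomb M I (\<lambda>i. \<ominus> v i) x" using wm by simp
    also have "\<dots> = lincomb M I (\<lambda>i. v i \<oplus> \<ominus> v i) x"
      by (rule M.lincomb_add) (use v neg d(6) in auto)
    also have "\<dots> = \<zero>\<^bsub>M\<^esub>"
      by (rule M.lincomb_zero) (use v d(6) in \<open>auto simp: r_neg Pi_iff M.smult_l_null\<close>)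
    finally have z: "lincomb M I (\<lambda>i. w ?m i \<oplus> \<ominus> v i) x = \<zero>\<^bsub>M\<^esub>" .
    have "w ?m i \<odot>\<^bsub>B\<^esub> y i = v i \<odot>\<^bsub>B\<^esub> y i" if i: "i \<in> I" for i
    proof -
      have vi: "v i \<in> carrier R" "w ?m i \<in> carrier R" using v wm i by auto
      have "(w ?m i \<oplus> \<ominus> v i) \<odot>\<^bsub>M\<^esub> x i = \<zero>\<^bsub>M\<^esub>"
        by (rule d(5)[OF _ z i]) (use v wm in auto)
      then have "(w ?m i \<oplus> \<ominus> v i) \<odot>\<^bsub>B\<^esub> y i = \<zero>\<^bsub>B\<^esub>"
        using homogeneous_annihilator[OF assms(1) d(2)[OF i] assms(3) y(1)[OF i] y(2)[OF i] y(3)[OF i]] vi by auto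
      then have *: "w ?m i \<odot>\<^bsub>B\<^esub> y i \<oplus>\<^bsub>B\<^esub> \<ominus>\<^bsub>B\<^esub> (v i \<odot>\<^bsub>B\<^esub> y i) = \<zero>\<^bsub>B\<^esub>"
        using vi y(1)[OF i] by (simp add: B.smult_l_distr B.smult_l_minus)
      show ?thesis
        using B.M.minus_equality[OF *] vi y(1)[OF i] by (simp add: B.smult_closed)
    qed
    then show ?thesis unfolding \<phi>_def by (intro B.lincomb_cong) (use v yc in auto)
  qed
  have "\<phi> \<in> lhom R M B"
    unfolding lhom_def
  proof (intro CollectI conjI ballI funcsetI)
    show "\<phi> m \<in> carrier B" if "m \<in> carrier M" for m
      unfolding \<phi>_def using w[OF that] yc by (intro B.lincomb_closed)
    fix m m' assume m: "m \<in> carrier M" "m' \<in> carrier M"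
    have "m \<oplus>\<^bsub>M\<^esub> m' = lincomb M I (\<lambda>i. w m i \<oplus> w m' i) x"
      using w(2)[OF m(1)] w(2)[OF m(2)] M.lincomb_add[OF w(1)[OF m(1)] w(1)[OF m(2)] d(6)] by simp
    moreover have "(\<lambda>i. w m i \<oplus> w m' i) \<in> I \<rightarrow> carrier R" using w(1)[OF m(1)] w(1)[OF m(2)] by auto
    ultimately have "\<phi> (m \<oplus>\<^bsub>M\<^esub> m') = lincomb B I (\<lambda>i. w m i \<oplus> w m' i) y" using key by simp
    then show "\<phi> (m \<oplus>\<^bsub>M\<^esub> m') = \<phi> m \<oplus>\<^bsub>B\<^esub> \<phi> m'"
      unfolding \<phi>_def using B.lincomb_add[OF w(1)[OF m(1)] w(1)[OF m(2)] yc] by simp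
  next
    fix r m assume m: "r \<in> carrier R" "m \<in> carrier M"
    have "r \<odot>\<^bsub>M\<^esub> m = lincomb M I (\<lambda>i. r \<otimes> w m i) x"
      using w(2)[OF m(2)] M.lincomb_smult[OF d(1) m(1) w(1)[OF m(2)] d(6)] by simp
    moreover have "(\<lambda>i. r \<otimes> w m i) \<in> I \<rightarrow> carrier R" using w(1)[OF m(2)] m(1) by auto
    ultimately have "\<phi> (r \<odot>\<^bsub>M\<^esub> m) = lincomb B I (\<lambda>i. r \<otimes> w m i) y" using key by simp
    then show "\<phi> (r \<odot>\<^bsub>M\<^esub> m) = r \<odot>\<^bsub>B\<^esub> \<phi> m"
      unfolding \<phi>_def using B.lincomb_smult[OF d(1) m(1) w(1)[OF m(2)] yc] by simp
  qed
  moreover have "\<phi> (x i) = y i" if "i \<in> I" for i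
  proof -
    have "\<phi> (lincomb M I (\<lambda>j. if j = i then \<one> else \<zero>) x) = lincomb B I (\<lambda>j. if j = i then \<one> else \<zero>) y"
      by (rule key) auto
    then show ?thesis
      using lincomb_indicator[OF assms(1) d(1,6) that] lincomb_indicator[OF assms(3) d(1) yc that] by simp
  qed
  ultimately show ?thesis using that key by blast
qed

lemma decomp_iso:
  assumes "left_module R M" "decomp M I x a l" "left_module R M'" "decomp M' I x' a' l"
    "\<And>i. i \<in> I \<Longrightarrow> e (a' i) = e (a i)"
  shows "lmod_iso R M M'"
proof -
  note d = decompD[OF assms(2)] and d' = decompD[OF assms(4)]
  interpret M: left_module R M by fact
  obtain \<phi> where \<phi>: "\<phi> \<in> lhom R M M'"
    "\<And>v. v \<in> I \<rightarrow> carrier R \<Longrightarrow> \<phi> (lincomb M I v x) = lincomb M' I v x'"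
    using decomp_lift[OF assms(1-3), of x'] homogeneousD[OF d'(2)] assms(5) by metis
  have h': "homogeneous M' (x' i) (a i) (l i)" if "i \<in> I" for i
    using d'(2)[OF that] assms(5)[OF that] by (simp add: homogeneous_def)
  have "inj_on \<phi> (carrier M)"
  proof (rule lhom_inj[OF assms(1,3) \<phi>(1)])
    fix m assume m: "m \<in> carrier M" "\<phi> m = \<zero>\<^bsub>M'\<^esub>"
    obtain v where v: "v \<in> I \<rightarrow> carrier R" "m = lincomb M I v x" using d(4)[OF m(1)] by auto
    have "lincomb M' I v x' = \<zero>\<^bsub>M'\<^esub>" using \<phi>(2)[OF v(1)] m(2) v(2) by simp
    then have "v i \<odot>\<^bsub>M'\<^esub> x' i = \<zero>\<^bsub>M'\<^esub>" if "i \<in> I" for i using d'(5) v(1) that by blast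
    then have "v i \<odot>\<^bsub>M\<^esub> x i = \<zero>\<^bsub>M\<^esub>" if "i \<in> I" for i
      using homogeneous_annihilator[OF assms(3) h'[OF that] assms(1) homogeneousD(1-3)[OF d(2)[OF that]]] v(1) that by auto
    then show "m = \<zero>\<^bsub>M\<^esub>" unfolding v(2) by (rule M.lincomb_zero)
  qed
  moreover have "\<phi> ` carrier M = carrier M'"
  proof
    show "\<phi> ` carrier M \<subseteq> carrier M'" using lhom_closed[OF \<phi>(1)] by auto
    show "carrier M' \<subseteq> \<phi> ` carrier M"
    proof
      fix m assume "m \<in> carrier M'"
      then obtain v where v: "v \<in> I \<rightarrow> carrier R" "m = lincomb M' I v x'" using d'(4) by auto
      then show "m \<in> \<phi> ` carrier M"
        using \<phi>(2)[OF v(1)] M.lincomb_closed[OF v(1) d(6)] by (metis imageI)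
    qed
  qed
  ultimately show ?thesis using \<phi>(1) unfolding lmod_iso_def bij_betw_def by auto
qed

lemma decomp_transport:
  assumes "left_module R M" "decomp M I x a l" "left_module R M'" "\<phi> \<in> lhom R M M'"
    "bij_betw \<phi> (carrier M) (carrier M')"
  shows "decomp M' I (\<lambda>i. \<phi> (x i)) a l"
proof -
  note d = decompD[OF assms(2)]
  interpret M: left_module R M by fact
  have z: "\<phi> m = \<zero>\<^bsub>M'\<^esub> \<longleftrightarrow> m = \<zero>\<^bsub>M\<^esub>" if "m \<in> carrier M" for m
    using that assms(5) lhom_zero[OF assms(1,3,4)] M.M.zero_closed by (metis bij_betw_def inj_on_eq_iff)
  have lc: "\<phi> (lincomb M I v x) = lincomb M' I v (\<lambda>i. \<phi> (x i))" if "v \<in> I \<rightarrow> carrier R" for v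
    by (rule lhom_lincomb[OF assms(1,3,4) d(1) that d(6)])
  have hg: "homogeneous M' (\<phi> (x i)) (a i) (l i)" if "i \<in> I" for i
    using homogeneousD[OF d(2)[OF that]] z lhom_closed[OF assms(4)] 
    unfolding homogeneous_def by (simp add: M.smult_closed flip: lhom_smult[OF assms(4)])
  have sp: "carrier M' \<subseteq> lspan R M' I (\<lambda>i. \<phi> (x i))"
  proof
    fix m assume "m \<in> carrier M'"
    then obtain m' where m': "m' \<in> carrier M" "m = \<phi> m'" using assms(5) by (auto simp: bij_betw_def)
    then obtain v where "v \<in> I \<rightarrow> carrier R" "m' = lincomb M I v x" using d(4) by blast
    then show "m \<in> lspan R M' I (\<lambda>i. \<phi> (x i))" using lc m' by (auto simp: lspan_def)
  qed
  have ind: "v i \<odot>\<^bsub>M'\<^esub> \<phi> (x i) = \<zero>\<^bsub>M'\<^esub>"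
    if "v \<in> I \<rightarrow> carrier R" "lincomb M' I v (\<lambda>i. \<phi> (x i)) = \<zero>\<^bsub>M'\<^esub>" "i \<in> I" for v i
  proof -
    have "lincomb M I v x = \<zero>\<^bsub>M\<^esub>"
      using that(2) z M.lincomb_closed[OF that(1) d(6)] by (simp flip: lc[OF that(1)])
    then have "v i \<odot>\<^bsub>M\<^esub> x i = \<zero>\<^bsub>M\<^esub>" using d(5) that by blast
    then have "\<phi> (v i \<odot>\<^bsub>M\<^esub> x i) = \<zero>\<^bsub>M'\<^esub>" using lhom_zero[OF assms(1,3,4)] by simp
    then show ?thesis using lhom_smult[OF assms(4)] that d(6) by (auto simp: Pi_iff)
  qed
  show ?thesis unfolding decomp_def using d(1,3) hg sp ind by auto
qed

lemma decomp_reindex: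
  assumes "left_module R M" "decomp M I x a l" "bij_betw g J I"
  shows "decomp M J (\<lambda>j. x (g j)) (\<lambda>j. a (g j)) (\<lambda>j. l (g j))"
proof -
  note d = decompD[OF assms(2)]
  interpret M: left_module R M by fact
  have J: "finite J" "g ` J = I" "inj_on g J"
    using assms(3) d(1) by (auto simp: bij_betw_def finite_image_iff dest: bij_betw_finite)
  let ?g = "inv_into J g"
  have gi: "?g (g j) = j" if "j \<in> J" for j using J that by simp
  have lc: "lincomb M I (\<lambda>i. v (?g i)) x = lincomb M J v (\<lambda>j. x (g j))" if "v \<in> J \<rightarrow> carrier R" for v
  proof -
    have "lincomb M (g ` J) (\<lambda>i. v (?g i)) x = lincomb M J ((\<lambda>i. v (?g i)) \<circ> g) (x \<circ> g)"
      using J that d(6) gi by (intro M.lincomb_reindex) (auto simp: Pi_iff)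
    also have "\<dots> = lincomb M J v (\<lambda>j. x (g j))"
      using J that d(6) gi by (intro M.lincomb_cong) (auto simp: Pi_iff)
    finally show ?thesis using J by simp
  qed
  have sp: "carrier M \<subseteq> lspan R M J (\<lambda>j. x (g j))"
  proof
    fix m assume "m \<in> carrier M"
    then obtain v where v: "v \<in> I \<rightarrow> carrier R" "m = lincomb M I v x" using d(4) by blast
    have "m = lincomb M J (v \<circ> g) (x \<circ> g)"
      using M.lincomb_reindex[of g J v x] J v d(6) by simp
    then show "m \<in> lspan R M J (\<lambda>j. x (g j))"
      using v J by (auto simp: lspan_def comp_def intro!: exI[of _ "v \<circ> g"])
  qed
  have ind: "v j \<odot>\<^bsub>M\<^esub> x (g j) = \<zero>\<^bsub>M\<^esub>"
    if v: "v \<in> J \<rightarrow> carrier R" "lincomb M J v (\<lambda>j. x (g j)) = \<zero>\<^bsub>M\<^esub>" "j \<in> J" for v j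
  proof -
    have "(\<lambda>i. v (?g i)) \<in> I \<rightarrow> carrier R" using v(1) J gi by auto
    from d(5)[OF this, of "g j"] show ?thesis using lc[OF v(1)] v J gi by auto
  qed
  show ?thesis unfolding decomp_def using J d sp ind by auto
qed


subsection \<open>Every finitely generated module is a direct sum of uniserial modules\<close>

definition nilpotency :: "('a, 'b, 'n) module_scheme \<Rightarrow> 'b \<Rightarrow> nat" where
  "nilpotency M x = (LEAST n. t n \<odot>\<^bsub>M\<^esub> x = \<zero>\<^bsub>M\<^esub>)"

lemma homogeneous_nilpotency:
  assumes "left_module R M" "x \<in> carrier M" "e a \<odot>\<^bsub>M\<^esub> x = x"
  shows "homogeneous M x a (nilpotency M x)"
proof -
  obtain l where l: "homogeneous M x a l" using homogeneous_exists[OF assms] by blast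
  then have "nilpotency M x = l" unfolding nilpotency_def by (intro Least_equality) (auto simp: homogeneous_def)
  then show ?thesis using l by simp
qed

text \<open>
  Generation is expressed through submodules because this form is evidently stable under exchanging
  a generator.
\<close>

definition homogeneous_generators :: "('a, 'b, 'n) module_scheme \<Rightarrow> 'i set \<Rightarrow> ('i \<Rightarrow> 'b) \<Rightarrow> ('i \<Rightarrow> int) \<Rightarrow> bool" where
  "homogeneous_generators M I x a \<longleftrightarrow> finite I \<and> (\<forall>i\<in>I. x i \<in> carrier M \<and> e (a i) \<odot>\<^bsub>M\<^esub> x i = x i) \<and>
     (\<forall>U. submodule U R M \<and> x ` I \<subseteq> U \<longrightarrow> carrier M \<subseteq> U)"

lemma independent_decomp:
  assumes "left_module R M" "homogeneous_generators M I x a"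
    and ind: "\<And>v i. v \<in> I \<rightarrow> carrier R \<Longrightarrow> lincomb M I v x = \<zero>\<^bsub>M\<^esub> \<Longrightarrow> i \<in> I \<Longrightarrow> v i \<odot>\<^bsub>M\<^esub> x i = \<zero>\<^bsub>M\<^esub>"
  shows "decomp M {i \<in> I. nilpotency M (x i) > 0} x a (\<lambda>i. nilpotency M (x i))"
proof -
  interpret M: left_module R M by fact
  let ?J = "{i \<in> I. nilpotency M (x i) > 0}"
  have I: "finite I" and xI: "x \<in> I \<rightarrow> carrier M" and J: "finite ?J" "x \<in> ?J \<rightarrow> carrier M"
    using assms(2) by (auto simp: homogeneous_generators_def)
  have h: "homogeneous M (x i) (a i) (nilpotency M (x i))" if "i \<in> I" for i
    using assms(2) that by (intro homogeneous_nilpotency[OF assms(1)]) (auto simp: homogeneous_generators_def)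
  have x0: "x i = \<zero>\<^bsub>M\<^esub>" if "i \<in> I - ?J" for i
  proof -
    have "t 0 \<odot>\<^bsub>M\<^esub> x i = \<zero>\<^bsub>M\<^esub>" using homogeneousD(4)[OF h, of i 0] that by auto
    then show ?thesis using that xI unfolding t_0 by (auto simp: M.smult_one Pi_iff)
  qed
  have sub: "submodule (lspan R M ?J x) R M" by (rule M.submodule_lspan[OF J])
  have "x i \<in> lspan R M ?J x" if "i \<in> I" for i
  proof (cases "i \<in> ?J")
    case True
    then show ?thesis by (rule M.lspan_gen[OF J])
  next
    case False
    then show ?thesis using x0[of i] that M.submoduleD(2)[OF sub] by auto
  qed
  then have "carrier M \<subseteq> lspan R M ?J x"
    using assms(2) sub unfolding homogeneous_generators_def by blast
  moreover have "v i \<odot>\<^bsub>M\<^esub> x i = \<zero>\<^bsub>M\<^esub>"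
    if v: "v \<in> ?J \<rightarrow> carrier R" "lincomb M ?J v x = \<zero>\<^bsub>M\<^esub>" "i \<in> ?J" for v i
  proof -
    let ?v = "\<lambda>i. if i \<in> ?J then v i else \<zero>"
    have v': "?v \<in> I \<rightarrow> carrier R" using v(1) by auto
    have "lincomb M I ?v x = \<zero>\<^bsub>M\<^esub>" using M.lincomb_extend[OF I _ v(1) xI] v(2) by simp
    then have "?v i \<odot>\<^bsub>M\<^esub> x i = \<zero>\<^bsub>M\<^esub>" by (rule ind[OF v']) (use v(3) in auto)
    then show ?thesis using v(3) by simp
  qed
  ultimately show ?thesis unfolding decomp_def using J h by auto
qed

text \<open>
  A relation among homogeneous generators can be divided by the smallest power of \<open>t\<close> that occurs in
  it. The quotient contains one of the generators with an invertible coefficient, so it can take the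
  place of this generator. That power of \<open>t\<close> kills the quotient but not the generator.
\<close>

lemma dependent_replacement:
  assumes "left_module R M" "homogeneous_generators M I x a"
    and v: "v \<in> I \<rightarrow> carrier R" "lincomb M I v x = \<zero>\<^bsub>M\<^esub>" "i1 \<in> I" "v i1 \<odot>\<^bsub>M\<^esub> x i1 \<noteq> \<zero>\<^bsub>M\<^esub>"
  shows "\<exists>i0\<in>I. \<exists>y. homogeneous_generators M I (x(i0 := y)) a \<and> nilpotency M y < nilpotency M (x i0)"
proof -
  interpret M: left_module R M by fact
  have I: "finite I" and xI: "x \<in> I \<rightarrow> carrier M"
    using assms(2) by (auto simp: homogeneous_generators_def)
  have xe: "x i \<in> carrier M" "e (a i) \<odot>\<^bsub>M\<^esub> x i = x i" if "i \<in> I" for i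
    using assms(2) that by (auto simp: homogeneous_generators_def)
  define J where "J = {i \<in> I. v i \<odot>\<^bsub>M\<^esub> x i \<noteq> \<zero>\<^bsub>M\<^esub>}"
  have J: "finite J" "J \<subseteq> I" "J \<noteq> {}" using I v by (auto simp: J_def)
  have "\<exists>m q. v i \<odot>\<^bsub>M\<^esub> x i = pv (Polynomial.monom 1 m * q) \<odot>\<^bsub>M\<^esub> x i \<and> Polynomial.coeff q 0 \<noteq> 0"
    if i: "i \<in> J" for i
  proof -
    have iI: "i \<in> I" using i J by auto
    obtain p where p: "v i \<otimes> e (a i) = pv p \<otimes> e (a i)" using spanning v(1) iI by blast
    then have *: "v i \<odot>\<^bsub>M\<^esub> x i = pv p \<odot>\<^bsub>M\<^esub> x i"
      using v(1) iI by (intro smult_eq_of_e[OF assms(1) xe[OF iI]]) auto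
    have "p \<noteq> 0" using * i xe[OF iI] by (auto simp: J_def pv_zero M.smult_l_null)
    then obtain m q where "p = Polynomial.monom 1 m * q" "Polynomial.coeff q 0 \<noteq> 0"
      using poly_factor_monom by blast
    then show ?thesis using * by auto
  qed
  then obtain m q where mq: "v i \<odot>\<^bsub>M\<^esub> x i = pv (Polynomial.monom 1 (m i) * q i) \<odot>\<^bsub>M\<^esub> x i"
    "Polynomial.coeff (q i) 0 \<noteq> 0" if "i \<in> J" for i by metis
  obtain i0 where i0: "i0 \<in> J" "\<And>i. i \<in> J \<Longrightarrow> m i0 \<le> m i"
    using ex_min_if_finite[of "m ` J"] J by (metis arg_min_if_finite(1) arg_min_least)
  have i0I: "i0 \<in> I" using i0 J by auto
  \<comment> \<open>The new generator \<open>y\<close> is the component of degree \<open>a i0\<close> of the relation divided by \<open>t\<^bsup>m i0\<^esup>\<close>.\<close>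
  define w where "w i = pv (Polynomial.monom 1 (m i - m i0) * q i)" for i
  have wR: "w \<in> J \<rightarrow> carrier R" by (simp add: w_def)
  have xJ: "x \<in> J \<rightarrow> carrier M" using xI J by auto
  define z where "z = lincomb M J w x"
  define y where "y = e (a i0) \<odot>\<^bsub>M\<^esub> z"
  have zM: "z \<in> carrier M" unfolding z_def by (rule M.lincomb_closed[OF wR xJ])
  have yM: "y \<in> carrier M" unfolding y_def using zM by (simp add: M.smult_closed)
  have ye: "e (a i0) \<odot>\<^bsub>M\<^esub> y = y" unfolding y_def using zM by (simp add: e_idem flip: M.smult_assoc)
  have "t (m i0) \<odot>\<^bsub>M\<^esub> z = lincomb M J (\<lambda>i. t (m i0) \<otimes> w i) x"
    unfolding z_def by (rule M.lincomb_smult[OF J(1) _ wR xJ]) simp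
  also have "\<dots> = lincomb M J v x"
  proof (rule M.lincomb_cong)
    fix i assume i: "i \<in> J"
    have "t (m i0) \<otimes> w i = pv (Polynomial.monom 1 (m i) * q i)"
      unfolding w_def pv_mult[symmetric]
      by (simp add: mult_monom i0(2)[OF i] flip: mult.assoc)
    then show "(t (m i0) \<otimes> w i) \<odot>\<^bsub>M\<^esub> x i = v i \<odot>\<^bsub>M\<^esub> x i" using mq(1)[OF i] by simp
  qed (use v(1) xI J in auto)
  also have "\<dots> = lincomb M I v x"
    by (rule M.lincomb_mono_neutral[symmetric]) (use I J v(1) xI in \<open>auto simp: J_def\<close>)
  finally have tz: "t (m i0) \<odot>\<^bsub>M\<^esub> z = \<zero>\<^bsub>M\<^esub>" using v(2) by simp
  have "t (m i0) \<odot>\<^bsub>M\<^esub> y = (e (a i0 + int (m i0)) \<otimes> t (m i0)) \<odot>\<^bsub>M\<^esub> z"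
    unfolding y_def using zM by (simp add: t_e flip: M.smult_assoc)
  also have "\<dots> = \<zero>\<^bsub>M\<^esub>" using zM tz by (simp add: M.smult_assoc M.smult_r_null)
  finally have ty: "t (m i0) \<odot>\<^bsub>M\<^esub> y = \<zero>\<^bsub>M\<^esub>" .
  then have nil_y: "nilpotency M y \<le> m i0" unfolding nilpotency_def by (rule Least_le)
  have "m i0 < nilpotency M (x i0)"
  proof (rule ccontr)
    assume "\<not> m i0 < nilpotency M (x i0)"
    then have "t (m i0) \<odot>\<^bsub>M\<^esub> x i0 = \<zero>\<^bsub>M\<^esub>"
      using homogeneousD(4)[OF homogeneous_nilpotency[OF assms(1) xe[OF i0I]]] by simp
    then have "v i0 \<odot>\<^bsub>M\<^esub> x i0 = \<zero>\<^bsub>M\<^esub>"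
      using mq(1)[OF i0(1)] xe[OF i0I]
      by (simp add: mult.commute[of "Polynomial.monom 1 (m i0)"] pv_mult M.smult_assoc M.smult_r_null)
    then show False using i0(1) by (simp add: J_def)
  qed
  then have less: "nilpotency M y < nilpotency M (x i0)" using nil_y by simp
  have "carrier M \<subseteq> U" if U: "submodule U R M" "(x(i0 := y)) ` I \<subseteq> U" for U
  proof -
    note DU = M.submoduleD[OF U(1)]
    have yU: "y \<in> U" and xU: "\<And>i. i \<in> I \<Longrightarrow> i \<noteq> i0 \<Longrightarrow> x i \<in> U"
      using U(2) i0I by (auto simp: image_subset_iff split: if_splits)
    let ?z' = "lincomb M (J - {i0}) w x"
    have z': "?z' \<in> U"
      by (rule M.lincomb_submodule(2)[OF U(1)]) (use J wR xU in auto)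
    have z'M: "?z' \<in> carrier M" using z' DU by auto
    let ?u = "w i0 \<odot>\<^bsub>M\<^esub> x i0"
    have uM: "?u \<in> carrier M" using wR i0(1) xe[OF i0I] by (simp add: M.smult_closed w_def)
    have "z = ?u \<oplus>\<^bsub>M\<^esub> ?z'"
      unfolding z_def using M.lincomb_insert[of "J - {i0}" i0 w x] J wR xJ i0(1)
      by (simp add: insert_absorb)
    then have yy: "y = e (a i0) \<odot>\<^bsub>M\<^esub> ?u \<oplus>\<^bsub>M\<^esub> e (a i0) \<odot>\<^bsub>M\<^esub> ?z'"
      unfolding y_def using uM z'M by (simp add: M.smult_r_distr)
    have eM: "e (a i0) \<odot>\<^bsub>M\<^esub> ?u \<in> carrier M" "e (a i0) \<odot>\<^bsub>M\<^esub> ?z' \<in> carrier M"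
      using uM z'M by (auto simp: M.smult_closed)
    have "y \<oplus>\<^bsub>M\<^esub> \<ominus>\<^bsub>M\<^esub> (e (a i0) \<odot>\<^bsub>M\<^esub> ?z') \<in> U"
      using DU yU z' by simp
    then have "e (a i0) \<odot>\<^bsub>M\<^esub> ?u \<in> U"
      unfolding yy using eM by (simp add: M.M.a_assoc M.M.r_neg)
    moreover have "?u = pv (q i0) \<odot>\<^bsub>M\<^esub> x i0" by (simp add: w_def monom_0 flip: one_pCons)
    ultimately have "e (a i0) \<odot>\<^bsub>M\<^esub> (pv (q i0) \<odot>\<^bsub>M\<^esub> x i0) \<in> U" by simp
    moreover obtain r where "r \<in> carrier R" "r \<odot>\<^bsub>M\<^esub> (e (a i0) \<odot>\<^bsub>M\<^esub> (pv (q i0) \<odot>\<^bsub>M\<^esub> x i0)) = x i0"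
      using homogeneous_unit[OF assms(1) xe[OF i0I] mq(2)[OF i0(1)]] by blast
    ultimately have "x i0 \<in> U" using DU(4) by metis
    then have "x ` I \<subseteq> U" using xU by auto
    then show ?thesis using assms(2) U(1) by (auto simp: homogeneous_generators_def)
  qed
  then have "homogeneous_generators M I (x(i0 := y)) a"
    unfolding homogeneous_generators_def using I xe yM ye by auto
  then show ?thesis using less i0I by blast
qed

text \<open>
  Exchanging generators along relations lowers the sum of their lengths, so it ends with independent
  generators.
\<close>

lemma homogeneous_generators_decomp:
  assumes "left_module R M" "homogeneous_generators M I x a"
  shows "\<exists>J x l. J \<subseteq> I \<and> decomp M J x a l"
  using assms(2)
proof (induction "\<Sum>i\<in>I. nilpotency M (x i)" arbitrary: x rule: less_induct)
  case less
  show ?case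
  proof (cases "\<forall>v i. v \<in> I \<rightarrow> carrier R \<longrightarrow> lincomb M I v x = \<zero>\<^bsub>M\<^esub> \<longrightarrow> i \<in> I \<longrightarrow> v i \<odot>\<^bsub>M\<^esub> x i = \<zero>\<^bsub>M\<^esub>")
    case True
    then have "decomp M {i \<in> I. nilpotency M (x i) > 0} x a (\<lambda>i. nilpotency M (x i))"
      by (intro independent_decomp[OF assms(1) less.prems]) auto
    then show ?thesis by (intro exI[of _ "{i \<in> I. nilpotency M (x i) > 0}"]) auto
  next
    case False
    then obtain i0 y where y: "i0 \<in> I" "homogeneous_generators M I (x(i0 := y)) a" "nilpotency M y < nilpotency M (x i0)"
      using dependent_replacement[OF assms(1) less.prems] by metis
    have "finite I" using less.prems by (simp add: homogeneous_generators_def)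
    then have "(\<Sum>i\<in>I. nilpotency M ((x(i0 := y)) i)) < (\<Sum>i\<in>I. nilpotency M (x i))"
      using y by (intro sum_strict_mono_ex1) auto
    then show ?thesis using less.hyps y(2) by blast
  qed
qed

lemma fg_homogeneous_generators:
  assumes "fg_module R M"
  shows "\<exists>(I :: ('b \<times> nat) set) x a. homogeneous_generators (M :: ('a, 'b, 'n) module_scheme) I x a"
proof -
  interpret M: left_module R M using assms by (simp add: fg_module_def)
  obtain S where S: "S \<subseteq> carrier M" "finite S" "carrier M \<subseteq> lspan R M S (\<lambda>s. s)"
    using assms by (auto simp: fg_module_iff)
  let ?I = "S \<times> {..<N}" and ?x = "\<lambda>(s, j). e (int j) \<odot>\<^bsub>M\<^esub> s" and ?a = "\<lambda>(s, j). int j"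
  have "carrier M \<subseteq> U" if U: "submodule U R M" "?x ` ?I \<subseteq> U" for U
  proof -
    have "s \<in> U" if s: "s \<in> S" for s
    proof -
      have sM: "s \<in> carrier M" using s S by auto
      have fs: "(\<Oplus>j\<in>J. e (int j)) \<odot>\<^bsub>M\<^esub> s = (\<Oplus>\<^bsub>M\<^esub>j\<in>J. e (int j) \<odot>\<^bsub>M\<^esub> s)" if "finite J" for J
        using that
      proof (induction J)
        case empty
        then show ?case using sM by (simp add: M.smult_l_null)
      next
        case (insert j J)
        have 1: "(\<Oplus>j\<in>insert j J. e (int j)) = e (int j) \<oplus> (\<Oplus>j\<in>J. e (int j))"
          using insert by (intro finsum_insert) auto
        have 2: "(\<Oplus>\<^bsub>M\<^esub>j\<in>insert j J. e (int j) \<odot>\<^bsub>M\<^esub> s)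
            = e (int j) \<odot>\<^bsub>M\<^esub> s \<oplus>\<^bsub>M\<^esub> (\<Oplus>\<^bsub>M\<^esub>j\<in>J. e (int j) \<odot>\<^bsub>M\<^esub> s)"
          using insert sM by (intro M.M.finsum_insert) (auto simp: M.smult_closed)
        have "(\<Oplus>j\<in>J. e (int j)) \<in> carrier R" by (rule finsum_closed) auto
        then show ?case unfolding 1 2 using insert sM by (simp add: M.smult_l_distr)
      qed
      have "s = \<one> \<odot>\<^bsub>M\<^esub> s" using sM by (simp add: M.smult_one)
      also have "\<dots> = (\<Oplus>\<^bsub>M\<^esub>j\<in>{..<N}. e (int j) \<odot>\<^bsub>M\<^esub> s)"
        unfolding e_sum[symmetric] by (rule fs) simp
      also have "\<dots> \<in> U"
        by (rule M.submodule_finsum[OF U(1)]) (use U(2) s in auto)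
      finally show ?thesis .
    qed
    then have "lspan R M S (\<lambda>s. s) \<subseteq> U" using S by (intro M.lspan_subset[OF U(1)]) auto
    then show ?thesis using S by auto
  qed
  moreover have "?x p \<in> carrier M \<and> e (?a p) \<odot>\<^bsub>M\<^esub> ?x p = ?x p" if "p \<in> ?I" for p
    using that S by (auto simp: M.smult_closed e_idem subset_iff simp flip: M.smult_assoc)
  moreover have "finite ?I" using S by auto
  ultimately have "homogeneous_generators M ?I ?x ?a" unfolding homogeneous_generators_def by blast
  then show ?thesis by blast
qed

theorem exists_decomp:
  assumes "fg_module R M"
  shows "\<exists>(I :: nat set) x a l. decomp M I x a l"
proof -
  have M: "left_module R M" using assms by (simp add: fg_module_def)
  obtain J x a l where d: "decomp M (J :: ('b \<times> nat) set) x a l"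
    using fg_homogeneous_generators[OF assms] homogeneous_generators_decomp[OF M] by metis
  obtain g where "bij_betw g {0..<card J} J"
    using decompD(1)[OF d] ex_bij_betw_nat_finite by blast
  then show ?thesis using decomp_reindex[OF M d] by blast
qed

subsection \<open>Projective covers\<close>

lemma decomp_projective:
  assumes "left_module R M" "decomp M I x a l" "\<And>i. i \<in> I \<Longrightarrow> l i = c (a i)"
  shows "projective R M"
proof -
  note d = decompD[OF assms(2)]
  have "\<exists>h\<in>lhom R M A. \<forall>m\<in>carrier M. g (h m) = f m"
    if *: "A \<in> fmods R" "B \<in> fmods R" "g \<in> lhom R A B" "f \<in> lhom R M B" "g ` carrier A = carrier B"
    for A B g f
  proof -
    interpret A: left_module R A using * by (simp add: fmods_left_module)
    interpret B: left_module R B using * by (simp add: fmods_left_module)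
    have "\<exists>y. y \<in> carrier A \<and> g y = f (x i)" if "i \<in> I" for i
    proof -
      have "f (x i) \<in> g ` carrier A" using *(5) d(6) that lhom_closed[OF *(4)] by (auto simp: Pi_iff)
      then show ?thesis by auto
    qed
    then obtain y0 where y0: "y0 i \<in> carrier A" "g (y0 i) = f (x i)" if "i \<in> I" for i by metis
    define y where "y i = e (a i) \<odot>\<^bsub>A\<^esub> y0 i" for i
    have y: "y i \<in> carrier A" "e (a i) \<odot>\<^bsub>A\<^esub> y i = y i" "t (l i) \<odot>\<^bsub>A\<^esub> y i = \<zero>\<^bsub>A\<^esub>"
      "g (y i) = f (x i)" if i: "i \<in> I" for i
    proof -
      show "y i \<in> carrier A" "e (a i) \<odot>\<^bsub>A\<^esub> y i = y i"
        using y0(1)[OF i] by (simp_all add: y_def A.smult_closed e_idem flip: A.smult_assoc)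
      have "t (l i) \<odot>\<^bsub>A\<^esub> y i = (t (l i) \<otimes> e (a i)) \<odot>\<^bsub>A\<^esub> y0 i"
        using y0(1)[OF i] by (simp add: y_def A.smult_assoc)
      also have "t (l i) \<otimes> e (a i) = \<zero>" using vanish assms(3)[OF i] by simp
      finally show "t (l i) \<odot>\<^bsub>A\<^esub> y i = \<zero>\<^bsub>A\<^esub>" using y0(1)[OF i] by (simp add: A.smult_l_null)
      have "g (y i) = e (a i) \<odot>\<^bsub>B\<^esub> f (x i)"
        using y0[OF i] by (simp add: y_def lhom_smult[OF *(3)])
      also have "\<dots> = f (e (a i) \<odot>\<^bsub>M\<^esub> x i)"
        using lhom_smult[OF *(4)] d(6) i by (auto simp: Pi_iff)
      also have "\<dots> = f (x i)" using homogeneousD(2)[OF d(2)[OF i]] by simp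
      finally show "g (y i) = f (x i)" .
    qed
    obtain h where h: "h \<in> lhom R M A" "\<And>v. v \<in> I \<rightarrow> carrier R \<Longrightarrow> h (lincomb M I v x) = lincomb A I v y"
      by (rule decomp_lift[OF assms(1,2) A.left_module_axioms y(1-3)]) auto
    have yA: "y \<in> I \<rightarrow> carrier A" using y(1) by auto
    have "g (h m) = f m" if m: "m \<in> carrier M" for m
    proof -
      obtain v where v: "v \<in> I \<rightarrow> carrier R" "m = lincomb M I v x" using d(4)[OF m] by blast
      have "g (h m) = lincomb B I v (\<lambda>i. g (y i))"
        using lhom_lincomb[OF A.left_module_axioms B.left_module_axioms *(3) d(1) v(1) yA] h(2) v by simp
      also have "\<dots> = lincomb B I v (\<lambda>i. f (x i))"
        using v(1) d(6) lhom_closed[OF *(4)] y(4) by (intro B.lincomb_cong) auto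
      also have "\<dots> = f m"
        using lhom_lincomb[OF assms(1) B.left_module_axioms *(4) d(1) v(1) d(6)] v by simp
      finally show ?thesis .
    qed
    then show ?thesis using h(1) by blast
  qed
  then show ?thesis using decomp_fg[OF assms(1,2)] unfolding projective_def by blast
qed

text \<open>
  The direct sum of the indecomposable projective modules \<open>R e (a i)\<close>, realized by functions that
  vanish outside \<open>I\<close> so that equal elements are equal functions.
\<close>

definition proj_sum :: "nat set \<Rightarrow> (nat \<Rightarrow> int) \<Rightarrow> 'a fmod" where
  "proj_sum I a = \<lparr>carrier = {v. (\<forall>i\<in>I. v i \<in> carrier R \<and> v i \<otimes> e (a i) = v i) \<and> (\<forall>i. i \<notin> I \<longrightarrow> v i = \<zero>)},
     monoid.mult = undefined, one = undefined, ring.zero = (\<lambda>_. \<zero>),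
     add = (\<lambda>u v i. u i \<oplus> v i), module.smult = (\<lambda>r v i. r \<otimes> v i)\<rparr>"

lemma proj_sum_simps [simp]:
  "v \<in> carrier (proj_sum I a) \<longleftrightarrow> (\<forall>i\<in>I. v i \<in> carrier R \<and> v i \<otimes> e (a i) = v i) \<and> (\<forall>i. i \<notin> I \<longrightarrow> v i = \<zero>)"
  "\<zero>\<^bsub>proj_sum I a\<^esub> = (\<lambda>_. \<zero>)"
  "u \<oplus>\<^bsub>proj_sum I a\<^esub> v = (\<lambda>i. u i \<oplus> v i)"
  "r \<odot>\<^bsub>proj_sum I a\<^esub> v = (\<lambda>i. r \<otimes> v i)"
  by (auto simp: proj_sum_def)

lemma proj_sum_closed: "v \<in> carrier (proj_sum I a) \<Longrightarrow> v i \<in> carrier R"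
  by (cases "i \<in> I") auto

lemma left_module_proj_sum: "left_module R (proj_sum I a)"
proof -
  note cl = proj_sum_closed[of _ I a]
  have "abelian_group (proj_sum I a)"
  proof (rule abelian_groupI)
    fix u v assume *: "u \<in> carrier (proj_sum I a)" "v \<in> carrier (proj_sum I a)"
    show "u \<oplus>\<^bsub>proj_sum I a\<^esub> v \<in> carrier (proj_sum I a)"
      using * by (auto simp: l_distr)
    show "u \<oplus>\<^bsub>proj_sum I a\<^esub> v = v \<oplus>\<^bsub>proj_sum I a\<^esub> u"
      using cl[OF *(1)] cl[OF *(2)] by (auto simp: a_comm)
  next
    fix u v w assume *: "u \<in> carrier (proj_sum I a)" "v \<in> carrier (proj_sum I a)" "w \<in> carrier (proj_sum I a)"
    show "u \<oplus>\<^bsub>proj_sum I a\<^esub> v \<oplus>\<^bsub>proj_sum I a\<^esub> w = u \<oplus>\<^bsub>proj_sum I a\<^esub> (v \<oplus>\<^bsub>proj_sum I a\<^esub> w)"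
      using cl[OF *(1)] cl[OF *(2)] cl[OF *(3)] by (auto simp: a_assoc)
  next
    fix u assume *: "u \<in> carrier (proj_sum I a)"
    show "\<zero>\<^bsub>proj_sum I a\<^esub> \<oplus>\<^bsub>proj_sum I a\<^esub> u = u" using cl[OF *] by auto
    show "\<exists>y\<in>carrier (proj_sum I a). y \<oplus>\<^bsub>proj_sum I a\<^esub> u = \<zero>\<^bsub>proj_sum I a\<^esub>"
    proof (rule bexI[of _ "\<lambda>i. \<ominus> u i"])
      show "(\<lambda>i. \<ominus> u i) \<oplus>\<^bsub>proj_sum I a\<^esub> u = \<zero>\<^bsub>proj_sum I a\<^esub>" using cl[OF *] by (auto simp: l_neg)
      show "(\<lambda>i. \<ominus> u i) \<in> carrier (proj_sum I a)" using * by (auto simp: l_minus)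
    qed
  qed auto
  then show ?thesis
  proof (intro left_module.intro ring_axioms left_module_axioms.intro)
    fix r u assume *: "r \<in> carrier R" "u \<in> carrier (proj_sum I a)"
    show "r \<odot>\<^bsub>proj_sum I a\<^esub> u \<in> carrier (proj_sum I a)" using * by (auto simp: m_assoc)
  next
    fix r s u assume *: "r \<in> carrier R" "s \<in> carrier R" "u \<in> carrier (proj_sum I a)"
    show "(r \<oplus> s) \<odot>\<^bsub>proj_sum I a\<^esub> u = r \<odot>\<^bsub>proj_sum I a\<^esub> u \<oplus>\<^bsub>proj_sum I a\<^esub> s \<odot>\<^bsub>proj_sum I a\<^esub> u"
      "(r \<otimes> s) \<odot>\<^bsub>proj_sum I a\<^esub> u = r \<odot>\<^bsub>proj_sum I a\<^esub> (s \<odot>\<^bsub>proj_sum I a\<^esub> u)"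
      using * cl[OF *(3)] by (auto simp: l_distr m_assoc)
  next
    fix r u v assume *: "r \<in> carrier R" "u \<in> carrier (proj_sum I a)" "v \<in> carrier (proj_sum I a)"
    show "r \<odot>\<^bsub>proj_sum I a\<^esub> (u \<oplus>\<^bsub>proj_sum I a\<^esub> v) = r \<odot>\<^bsub>proj_sum I a\<^esub> u \<oplus>\<^bsub>proj_sum I a\<^esub> r \<odot>\<^bsub>proj_sum I a\<^esub> v"
      using * cl[OF *(2)] cl[OF *(3)] by (auto simp: r_distr)
  next
    fix u assume *: "u \<in> carrier (proj_sum I a)"
    show "\<one> \<odot>\<^bsub>proj_sum I a\<^esub> u = u" using cl[OF *] by auto
  qed
qed

definition coord :: "(nat \<Rightarrow> 'a) \<Rightarrow> nat \<Rightarrow> nat \<Rightarrow> 'a" where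
  "coord z i = (\<lambda>j. if j = i then z i else \<zero>)"

lemma coord_closed:
  "i \<in> I \<Longrightarrow> z i \<in> carrier R \<Longrightarrow> z i \<otimes> e (a i) = z i \<Longrightarrow> coord z i \<in> carrier (proj_sum I a)"
  by (auto simp: coord_def)

lemma lincomb_coord:
  assumes "finite J" "J \<subseteq> I" "v \<in> J \<rightarrow> carrier R"
    "\<And>i. i \<in> J \<Longrightarrow> z i \<in> carrier R" "\<And>i. i \<in> J \<Longrightarrow> z i \<otimes> e (a i) = z i"
  shows "lincomb (proj_sum I a) J v (coord z) = (\<lambda>j. if j \<in> J then v j \<otimes> z j else \<zero>)"
  using assms
proof (induction J)
  case empty
  interpret P: left_module R "proj_sum I a" by (rule left_module_proj_sum)
  show ?case by (simp add: P.lincomb_empty)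
next
  case (insert i J)
  interpret P: left_module R "proj_sum I a" by (rule left_module_proj_sum)
  have "coord z \<in> insert i J \<rightarrow> carrier (proj_sum I a)"
    using insert by (intro Pi_I coord_closed) auto
  then have "lincomb (proj_sum I a) (insert i J) v (coord z)
      = (\<lambda>j. v i \<otimes> coord z i j \<oplus> (if j \<in> J then v j \<otimes> z j else \<zero>))"
    using insert by (simp add: P.lincomb_insert)
  also have "\<dots> = (\<lambda>j. if j \<in> insert i J then v j \<otimes> z j else \<zero>)"
  proof
    fix j
    show "v i \<otimes> coord z i j \<oplus> (if j \<in> J then v j \<otimes> z j else \<zero>)
      = (if j \<in> insert i J then v j \<otimes> z j else \<zero>)"
      using insert by (cases "j = i") (auto simp: coord_def Pi_iff)
  qed
  finally show ?case .
qed

text \<open>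
  Submodules of \<^const>\<open>proj_sum\<close> that are generated coordinate by coordinate. The projective cover
  itself and its kernel are both of this kind.
\<close>

lemma decomp_coord:
  assumes "finite J" "J \<subseteq> I" "U \<subseteq> carrier (proj_sum I a)" "submodule U R (proj_sum I a)"
    and z: "\<And>i. i \<in> J \<Longrightarrow> coord z i \<in> U"
      "\<And>i. i \<in> J \<Longrightarrow> e (b i) \<otimes> z i = z i" "\<And>i n. i \<in> J \<Longrightarrow> t n \<otimes> z i = \<zero> \<longleftrightarrow> l i \<le> n"
      "\<And>i. i \<in> J \<Longrightarrow> l i > 0"
    and sp: "\<And>u i. u \<in> U \<Longrightarrow> i \<in> J \<Longrightarrow> \<exists>r\<in>carrier R. u i = r \<otimes> z i" "\<And>u i. u \<in> U \<Longrightarrow> i \<notin> J \<Longrightarrow> u i = \<zero>"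
  shows "decomp ((proj_sum I a)\<lparr>carrier := U\<rparr>) J (coord z) b l"
proof -
  interpret P: left_module R "proj_sum I a" by (rule left_module_proj_sum)
  let ?U = "(proj_sum I a)\<lparr>carrier := U\<rparr>"
  have zR: "z i \<in> carrier R" "z i \<otimes> e (a i) = z i" if "i \<in> J" for i
    using subsetD[OF assms(3) z(1)[OF that]] subsetD[OF assms(2) that] by (auto simp: coord_def)
  have lc: "lincomb ?U J v (coord z) = (\<lambda>j. if j \<in> J then v j \<otimes> z j else \<zero>)" if "v \<in> J \<rightarrow> carrier R" for v
    using P.lincomb_submodule(1)[OF assms(4,1) that, of "coord z"] z(1)
      lincomb_coord[OF assms(1,2) that zR] by auto
  have h: "homogeneous ?U (coord z i) (b i) (l i)" if "i \<in> J" for i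
  proof -
    have "e (b i) \<odot>\<^bsub>?U\<^esub> coord z i = coord z i" using z(2)[OF that] by (auto simp: coord_def)
    moreover have "t n \<odot>\<^bsub>?U\<^esub> coord z i = \<zero>\<^bsub>?U\<^esub> \<longleftrightarrow> l i \<le> n" for n
      using z(3)[OF that, of n] by (auto simp: coord_def fun_eq_iff)
    ultimately show ?thesis using z(1)[OF that] by (simp add: homogeneous_def)
  qed
  have "u \<in> lspan R ?U J (coord z)" if u: "u \<in> U" for u
  proof -
    obtain r where r: "r i \<in> carrier R" "u i = r i \<otimes> z i" if "i \<in> J" for i using sp(1)[OF u] by metis
    have "u = lincomb ?U J r (coord z)" using r sp(2)[OF u] by (subst lc) auto
    then show ?thesis using r by (auto simp: lspan_def)
  qed
  moreover have "v i \<odot>\<^bsub>?U\<^esub> coord z i = \<zero>\<^bsub>?U\<^esub>"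
    if v: "v \<in> J \<rightarrow> carrier R" "lincomb ?U J v (coord z) = \<zero>\<^bsub>?U\<^esub>" "i \<in> J" for v i
  proof -
    have "v i \<otimes> z i = \<zero>" using fun_cong[OF v(2)[unfolded lc[OF v(1)]], of i] v(3) by simp
    moreover have "v i \<otimes> \<zero> = \<zero>" using v(1,3) by (auto simp: Pi_iff)
    ultimately show ?thesis by (auto simp: coord_def)
  qed
  ultimately show ?thesis unfolding decomp_def using assms(1) h z(4) by auto
qed

lemma proj_sum_decomp:
  assumes "finite I" "\<And>i. i \<in> I \<Longrightarrow> c (a i) > 0"
  shows "decomp (proj_sum I a) I (coord (\<lambda>i. e (a i))) a (\<lambda>i. c (a i))"
proof -
  interpret P: left_module R "proj_sum I a" by (rule left_module_proj_sum)
  have "decomp ((proj_sum I a)\<lparr>carrier := carrier (proj_sum I a)\<rparr>) I (coord (\<lambda>i. e (a i))) a (\<lambda>i. c (a i))"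
    using assms vanish
    by (intro decomp_coord P.submodule_carrier coord_closed)
      (auto simp: e_idem intro!: bexI[of "\<lambda>r. u i = r \<otimes> e (a i)" "u i" for u i])
  then show ?thesis by simp
qed

text \<open>
  The generator \<open>x i\<close> has annihilator generated by \<open>t\<^bsup>l i\<^esup>\<close>, so the kernel of the obvious map from the
  sum of the modules \<open>R e (a i)\<close> is the sum of the submodules generated by \<open>t\<^bsup>l i\<^esup> e (a i)\<close>, the one
  at \<open>i\<close> being zero if \<open>l i = c (a i)\<close>. It lies in the image of the nilpotent element \<open>t\<close>, which makes
  it superfluous.
\<close>

theorem exists_projective_cover:
  assumes "left_module R M" "decomp M (I :: nat set) x a l"
  shows "\<exists>P p y. projective_cover R M P p \<and> projective R P \<and>
    decomp (P\<lparr>carrier := a_kernel P M p\<rparr>) {i \<in> I. l i < c (a i)} y (\<lambda>i. a i + int (l i)) (\<lambda>i. c (a i) - l i)"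
proof -
  interpret M: left_module R M by fact
  note d = decompD[OF assms(2)]
  have lc: "l i \<le> c (a i)" if "i \<in> I" for i using homogeneous_le[OF assms(1) d(2)[OF that]] .
  have c0: "c (a i) > 0" if "i \<in> I" for i using lc[OF that] d(3)[OF that] by simp
  let ?P = "proj_sum I a"
  interpret P: left_module R ?P by (rule left_module_proj_sum)
  let ?E = "coord (\<lambda>i. e (a i))"
  have dP: "decomp ?P I ?E a (\<lambda>i. c (a i))" by (rule proj_sum_decomp[OF d(1) c0])
  have prP: "projective R ?P" by (rule decomp_projective[OF P.left_module_axioms dP]) simp
  obtain p where p: "p \<in> lhom R ?P M" "\<And>v. v \<in> I \<rightarrow> carrier R \<Longrightarrow> p (lincomb ?P I v ?E) = lincomb M I v x"
  proof (rule decomp_lift[OF P.left_module_axioms dP assms(1), of x])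
    fix i assume i: "i \<in> I"
    show "x i \<in> carrier M" "e (a i) \<odot>\<^bsub>M\<^esub> x i = x i" "t (c (a i)) \<odot>\<^bsub>M\<^esub> x i = \<zero>\<^bsub>M\<^esub>"
      using d(2)[OF i] lc[OF i] by (auto simp: homogeneous_def)
  qed (use that in auto)
  have pv: "p v = lincomb M I v x" "v \<in> I \<rightarrow> carrier R" if v: "v \<in> carrier ?P" for v
  proof -
    show vR: "v \<in> I \<rightarrow> carrier R" using proj_sum_closed[OF v] by auto
    have "v = lincomb ?P I v ?E"
      using v vR d(1) by (subst lincomb_coord) (auto simp: e_idem fun_eq_iff)
    then show "p v = lincomb M I v x" using p(2)[OF vR] by simp
  qed
  have onto: "p ` carrier ?P = carrier M"
  proof
    show "p ` carrier ?P \<subseteq> carrier M" using lhom_closed[OF p(1)] by auto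
    show "carrier M \<subseteq> p ` carrier ?P"
    proof
      fix m assume "m \<in> carrier M"
      then obtain v where v: "v \<in> I \<rightarrow> carrier R" "m = lincomb M I v x" using d(4) by blast
      have "?E \<in> I \<rightarrow> carrier ?P" by (auto simp: coord_def e_idem)
      then have "lincomb ?P I v ?E \<in> carrier ?P" by (rule P.lincomb_closed[OF v(1)])
      then show "m \<in> p ` carrier ?P" using p(2)[OF v(1)] v(2) by (metis imageI)
    qed
  qed
  let ?K = "a_kernel ?P M p"
  have Ksub: "submodule ?K R ?P" by (rule submodule_kernel[OF P.left_module_axioms assms(1) p(1)])
  have KP: "?K \<subseteq> carrier ?P" by (auto simp: a_kernel_def')
  have Kq: "\<exists>q. v i = pv (q * Polynomial.monom 1 (l i)) \<otimes> e (a i)" if v: "v \<in> ?K" and i: "i \<in> I" for v i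
  proof -
    have vP: "v \<in> carrier ?P" and pv0: "p v = \<zero>\<^bsub>M\<^esub>" using v by (auto simp: a_kernel_def')
    have z: "v i \<odot>\<^bsub>M\<^esub> x i = \<zero>\<^bsub>M\<^esub>" using d(5)[OF pv(2)[OF vP] _ i] pv(1)[OF vP] pv0 by simp
    have vi: "v i \<in> carrier R" "v i \<otimes> e (a i) = v i" using vP i by auto
    obtain f where f: "v i \<otimes> e (a i) = pv f \<otimes> e (a i)" using spanning vi by blast
    have "pv f \<odot>\<^bsub>M\<^esub> x i = \<zero>\<^bsub>M\<^esub>"
      using smult_eq_of_e[OF assms(1) homogeneousD(1,2)[OF d(2)[OF i]] vi(1) _ f] z by simp
    then have "Polynomial.monom 1 (l i) dvd f" using homogeneous_pv_zero_iff[OF assms(1) d(2)[OF i]] by simp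
    then obtain q where "f = q * Polynomial.monom 1 (l i)" by (metis dvd_def mult.commute)
    then show ?thesis using f vi by auto
  qed
  let ?J = "{i \<in> I. l i < c (a i)}" and ?z = "\<lambda>i. t (l i) \<otimes> e (a i)"
  have zK: "coord ?z i \<in> ?K" if i: "i \<in> I" for i
  proof -
    have zP: "coord ?z i \<in> carrier ?P"
      using i by (intro coord_closed) (auto simp: m_assoc e_idem)
    have "p (coord ?z i) = lincomb M I (coord ?z i) x" by (rule pv(1)[OF zP])
    also have "\<dots> = \<zero>\<^bsub>M\<^esub>"
      using i homogeneousD(1-3)[OF d(2)[OF i]] d(6)
      by (intro M.lincomb_zero) (auto simp: coord_def M.smult_assoc M.smult_l_null Pi_iff)
    finally show ?thesis using zP by (simp add: a_kernel_def')
  qed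
  have dK: "decomp (?P\<lparr>carrier := ?K\<rparr>) ?J (coord ?z) (\<lambda>i. a i + int (l i)) (\<lambda>i. c (a i) - l i)"
  proof (rule decomp_coord[OF _ _ KP Ksub])
    fix i assume i: "i \<in> ?J"
    then show "coord ?z i \<in> ?K" using zK by auto
    have "e (a i + int (l i)) \<otimes> ?z i = e (a i + int (l i)) \<otimes> (e (a i + int (l i)) \<otimes> t (l i))"
      by (simp add: t_e)
    also have "\<dots> = ?z i" by (simp add: e_idem t_e flip: m_assoc)
    finally show "e (a i + int (l i)) \<otimes> ?z i = ?z i" .
    show "t n \<otimes> ?z i = \<zero> \<longleftrightarrow> c (a i) - l i \<le> n" for n
      using vanish[of "n + l i" "a i"] by (auto simp: t_add m_assoc)
    show "0 < c (a i) - l i" using i by auto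
    fix u assume "u \<in> ?K"
    then show "\<exists>r\<in>carrier R. u i = r \<otimes> ?z i"
      using Kq[of u i] i by (auto simp: pv_mult m_assoc)
  next
    fix u i assume u: "u \<in> ?K" and i: "i \<notin> ?J"
    show "u i = \<zero>"
    proof (cases "i \<in> I")
      case True
      then have "t (l i) \<otimes> e (a i) = \<zero>" using i vanish by auto
      then show ?thesis using Kq[OF u True] by (auto simp: pv_mult m_assoc)
    qed (use subsetD[OF KP u] in auto)
  qed (use d(1) in auto)
  have "U = carrier ?P" if U: "submodule U R ?P" "set_add ?P U ?K = carrier ?P" for U
  proof -
    note DU = P.submoduleD[OF U(1)]
    \<comment> \<open>Since all lengths are positive, the kernel lies in \<open>t\<close> times the cover.\<close>
    have Kt: "\<exists>k'\<in>carrier ?P. k = t 1 \<odot>\<^bsub>?P\<^esub> k'" if k: "k \<in> ?K" for k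
    proof -
      obtain q where q: "k i = pv (q i * Polynomial.monom 1 (l i)) \<otimes> e (a i)" if "i \<in> I" for i
        using Kq[OF k] by metis
      define k' where "k' i = (if i \<in> I then pv (q i * Polynomial.monom 1 (l i - 1)) \<otimes> e (a i) else \<zero>)" for i
      have "k' \<in> carrier ?P" by (auto simp: k'_def m_assoc e_idem)
      moreover have "k i = t 1 \<otimes> k' i" for i
      proof (cases "i \<in> I")
        case True
        have "Polynomial.monom 1 1 * (q i * Polynomial.monom 1 (l i - 1)) = q i * Polynomial.monom (1 :: 'k) (l i)"
          using d(3)[OF True] by (simp add: mult_monom mult.left_commute)
        then have "t 1 \<otimes> pv (q i * Polynomial.monom 1 (l i - 1)) = pv (q i * Polynomial.monom 1 (l i))"
          by (metis pv_mult)
        then show ?thesis using True q[OF True] by (simp add: k'_def flip: m_assoc)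
      qed (use subsetD[OF KP k] in \<open>auto simp: k'_def\<close>)
      ultimately show ?thesis by (intro bexI[of _ k']) auto
    qed
    have iter: "\<exists>u\<in>U. \<exists>z\<in>carrier ?P. y = u \<oplus>\<^bsub>?P\<^esub> t n \<odot>\<^bsub>?P\<^esub> z" if "y \<in> carrier ?P" for y n
    proof (induction n)
      case 0
      have "y = \<zero>\<^bsub>?P\<^esub> \<oplus>\<^bsub>?P\<^esub> t 0 \<odot>\<^bsub>?P\<^esub> y" unfolding t_0 using that by (simp only: P.smult_one P.M.l_zero)
      then show ?case using DU(2) that by blast
    next
      case (Suc n)
      then obtain u z where uz: "u \<in> U" "z \<in> carrier ?P" "y = u \<oplus>\<^bsub>?P\<^esub> t n \<odot>\<^bsub>?P\<^esub> z" by blast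
      have "z \<in> set_add ?P U ?K" using uz(2) U(2) by blast
      then obtain u' k where uk: "u' \<in> U" "k \<in> ?K" "z = u' \<oplus>\<^bsub>?P\<^esub> k" unfolding set_add_def' by blast
      obtain k' where k': "k' \<in> carrier ?P" "k = t 1 \<odot>\<^bsub>?P\<^esub> k'" using Kt[OF uk(2)] by blast
      have car: "u \<in> carrier ?P" "u' \<in> carrier ?P" "k \<in> carrier ?P"
        using uz uk DU(1) KP by blast+
      have "y = u \<oplus>\<^bsub>?P\<^esub> (t n \<odot>\<^bsub>?P\<^esub> u' \<oplus>\<^bsub>?P\<^esub> t n \<odot>\<^bsub>?P\<^esub> k)"
        unfolding uz(3) uk(3) using car by (simp only: P.smult_r_distr pv_closed)
      also have "t n \<odot>\<^bsub>?P\<^esub> k = t (Suc n) \<odot>\<^bsub>?P\<^esub> k'"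
        unfolding k'(2) using P.smult_assoc[of "t n" "t 1" k'] k'(1) t_add[of n 1] by (simp del: proj_sum_simps)
      also have "u \<oplus>\<^bsub>?P\<^esub> (t n \<odot>\<^bsub>?P\<^esub> u' \<oplus>\<^bsub>?P\<^esub> t (Suc n) \<odot>\<^bsub>?P\<^esub> k')
          = (u \<oplus>\<^bsub>?P\<^esub> t n \<odot>\<^bsub>?P\<^esub> u') \<oplus>\<^bsub>?P\<^esub> t (Suc n) \<odot>\<^bsub>?P\<^esub> k'"
        using car k'(1) by (intro P.M.a_assoc[symmetric] P.smult_closed pv_closed)
      finally show ?case using DU(3)[OF uz(1) DU(4)[OF _ uk(1)]] k'(1) pv_closed by blast
    qed
    have "y \<in> U" if y: "y \<in> carrier ?P" for y
    proof -
      define n where "n = (\<Sum>i\<in>I. c (a i))"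
      have tn: "t n \<odot>\<^bsub>?P\<^esub> z = \<zero>\<^bsub>?P\<^esub>" if z: "z \<in> carrier ?P" for z
      proof -
        have "t n \<otimes> z i = \<zero>" for i
        proof (cases "i \<in> I")
          case True
          have "c (a i) \<le> n" unfolding n_def using d(1) True by (intro member_le_sum) auto
          then have v: "t n \<otimes> e (a i) = \<zero>" using vanish by simp
          have zi: "z i \<in> carrier R" "z i \<otimes> e (a i) = z i" using z True by auto
          obtain f where f: "z i \<otimes> e (a i) = pv f \<otimes> e (a i)" using spanning zi by blast
          have "t n \<otimes> z i = pv f \<otimes> (t n \<otimes> e (a i))"
            using f zi by (simp add: t_pv flip: m_assoc)
          then show ?thesis using v by simp
        qed (use z in auto)
        then show ?thesis by auto
      qed
      obtain u z where u: "u \<in> U" "z \<in> carrier ?P" "y = u \<oplus>\<^bsub>?P\<^esub> t n \<odot>\<^bsub>?P\<^esub> z" using iter[OF y] by blast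
      have "u \<in> carrier ?P" using u(1) DU(1) by blast
      then have "y = u" using u(3) tn[OF u(2)] by (simp only: P.M.r_zero)
      then show ?thesis using u(1) by simp
    qed
    then show ?thesis using DU(1) by blast
  qed
  then have "projective_cover R M ?P p"
    unfolding projective_cover_def using prP p(1) onto by blast
  then show ?thesis using dK prP by blast
qed


lemma decomp_cong:
  assumes "decomp M I x a l" "\<And>i. i \<in> I \<Longrightarrow> a i = a' i" "\<And>i. i \<in> I \<Longrightarrow> l i = l' i"
  shows "decomp M I x a' l'"
  using assms unfolding decomp_def by auto

text \<open>
  The carrier of \<^const>\<open>proj_sum\<close> consists of functions on the natural numbers. Renumbering makes the
  result available for index sets of any type, such as disjoint unions.
\<close>

lemma ex_cover_decomp:
  assumes "left_module R M" "decomp M I x a l"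
  shows "\<exists>P p y. projective_cover R M P p \<and> projective R P \<and>
    decomp (P\<lparr>carrier := a_kernel P M p\<rparr>) {i \<in> I. l i < c (a i)} y (\<lambda>i. a i + int (l i)) (\<lambda>i. c (a i) - l i)"
proof -
  obtain g where g: "bij_betw g {0..<card I} I"
    using decompD(1)[OF assms(2)] ex_bij_betw_nat_finite by blast
  let ?n = "{0..<card I}"
  have dn: "decomp M ?n (\<lambda>j. x (g j)) (\<lambda>j. a (g j)) (\<lambda>j. l (g j))" by (rule decomp_reindex[OF assms g])
  obtain P p y where P: "projective_cover R M P p" "projective R P"
    "decomp (P\<lparr>carrier := a_kernel P M p\<rparr>) {j \<in> ?n. l (g j) < c (a (g j))} y
      (\<lambda>j. a (g j) + int (l (g j))) (\<lambda>j. c (a (g j)) - l (g j))"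
    using exists_projective_cover[OF assms(1) dn] by blast
  let ?K = "P\<lparr>carrier := a_kernel P M p\<rparr>" and ?J = "{i \<in> I. l i < c (a i)}"
  interpret P: left_module R P using P(2) by (rule projective_left_module)
  have K: "left_module R ?K"
    by (rule P.left_module_submodule[OF submodule_kernel[OF P.left_module_axioms assms(1)
          projective_coverD(2)[OF P(1)]]])
  let ?h = "inv_into ?n g"
  have h: "?h i \<in> ?n" "g (?h i) = i" if "i \<in> I" for i
    using g that inv_into_into[of i g ?n] f_inv_into_f[of i g ?n] by (auto simp: bij_betw_def)
  have "bij_betw ?h ?J {j \<in> ?n. l (g j) < c (a (g j))}"
    unfolding bij_betw_def
  proof
    show "inj_on ?h ?J" using g by (auto simp: bij_betw_def intro: inj_on_inv_into inj_on_subset)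
    show "?h ` ?J = {j \<in> ?n. l (g j) < c (a (g j))}"
    proof
      show "?h ` ?J \<subseteq> {j \<in> ?n. l (g j) < c (a (g j))}" using h by auto
      show "{j \<in> ?n. l (g j) < c (a (g j))} \<subseteq> ?h ` ?J"
      proof
        fix j assume j: "j \<in> {j \<in> ?n. l (g j) < c (a (g j))}"
        then have "j = ?h (g j)" using g by (simp add: bij_betw_def)
        moreover have "g j \<in> ?J" using j g by (auto simp: bij_betw_def)
        ultimately show "j \<in> ?h ` ?J" by blast
      qed
    qed
  qed
  from decomp_reindex[OF K P(3) this]
  have "decomp ?K ?J (\<lambda>i. y (?h i)) (\<lambda>i. a i + int (l i)) (\<lambda>i. c (a i) - l i)"
    by (rule decomp_cong) (auto simp: h)
  then show ?thesis using P(1,2) by blast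
qed

lemma decomp_zero_module:
  assumes "left_module R M" "decomp M I x a l" "carrier M \<subseteq> {\<zero>\<^bsub>M\<^esub>}"
  shows "I = {}"
proof (rule ccontr)
  interpret M: left_module R M by fact
  assume "I \<noteq> {}"
  then obtain i where i: "i \<in> I" by auto
  have "x i = \<zero>\<^bsub>M\<^esub>" using decompD(6)[OF assms(2)] i assms(3) by auto
  then have "t 0 \<odot>\<^bsub>M\<^esub> x i = \<zero>\<^bsub>M\<^esub>" by (simp add: M.smult_r_null)
  then show False using homogeneousD(4)[OF decompD(2)[OF assms(2) i], of 0] decompD(3)[OF assms(2) i] by simp
qed

subsection \<open>Direct sums of decompositions\<close>

lemma decomp_direct_sum:
  assumes "left_module R A" "left_module R B" "decomp A I x a l" "decomp B J y b k"
  shows "decomp (direct_sum A B) (I <+> J) (case_sum (\<lambda>i. (x i, \<zero>\<^bsub>B\<^esub>)) (\<lambda>j. (\<zero>\<^bsub>A\<^esub>, y j)))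
    (case_sum a b) (case_sum l k)"
proof -
  interpret A: left_module R A by fact
  interpret B: left_module R B by fact
  let ?D = "direct_sum A B" and ?z = "case_sum (\<lambda>i. (x i, \<zero>\<^bsub>B\<^esub>)) (\<lambda>j. (\<zero>\<^bsub>A\<^esub>, y j))"
  have D: "left_module R ?D" by (rule left_module_direct_sum[OF assms(1,2)])
  interpret D: left_module R ?D by fact
  note dA = decompD[OF assms(3)] and dB = decompD[OF assms(4)]
  have zz: "v i \<odot>\<^bsub>B\<^esub> \<zero>\<^bsub>B\<^esub> = \<zero>\<^bsub>B\<^esub>" "v i \<odot>\<^bsub>A\<^esub> \<zero>\<^bsub>A\<^esub> = \<zero>\<^bsub>A\<^esub>"
    if "v \<in> I <+> J \<rightarrow> carrier R" "i \<in> I <+> J" for v i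
    using funcset_mem[OF that] by (auto simp: A.smult_r_null B.smult_r_null)
  have inl: "(\<lambda>m. (m, \<zero>\<^bsub>B\<^esub>)) \<in> lhom R A ?D" and inr: "(\<lambda>m. (\<zero>\<^bsub>A\<^esub>, m)) \<in> lhom R B ?D"
    by (auto simp: lhom_def A.smult_r_null B.smult_r_null)
  have lc: "lincomb ?D (I <+> J) v ?z = (lincomb A I (v \<circ> Inl) x, lincomb B J (v \<circ> Inr) y)"
    if v: "v \<in> I <+> J \<rightarrow> carrier R" for v
  proof -
    have vl: "v \<circ> Inl \<in> I \<rightarrow> carrier R" and vr: "v \<circ> Inr \<in> J \<rightarrow> carrier R" using v by auto
    have zD: "?z \<in> Inl ` I \<union> Inr ` J \<rightarrow> carrier ?D" using dA(6) dB(6) by auto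
    have "lincomb ?D (Inl ` I \<union> Inr ` J) v ?z = lincomb ?D (Inl ` I) v ?z \<oplus>\<^bsub>?D\<^esub> lincomb ?D (Inr ` J) v ?z"
      using dA(1) dB(1) v zD by (intro D.lincomb_Un) auto
    also have "lincomb ?D (Inl ` I) v ?z = lincomb ?D I (v \<circ> Inl) (?z \<circ> Inl)"
      using v zD by (intro D.lincomb_reindex) auto
    also have "\<dots> = (lincomb A I (v \<circ> Inl) x, \<zero>\<^bsub>B\<^esub>)"
      using lhom_lincomb[OF assms(1) D inl dA(1) vl dA(6)] by (simp add: comp_def)
    also have "lincomb ?D (Inr ` J) v ?z = lincomb ?D J (v \<circ> Inr) (?z \<circ> Inr)"
      using v zD by (intro D.lincomb_reindex) auto
    also have "\<dots> = (\<zero>\<^bsub>A\<^esub>, lincomb B J (v \<circ> Inr) y)"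
      using lhom_lincomb[OF assms(2) D inr dB(1) vr dB(6)] by (simp add: comp_def)
    finally show ?thesis
      using A.lincomb_closed[OF vl dA(6)] B.lincomb_closed[OF vr dB(6)] by (simp add: Plus_def comp_def)
  qed
  have h: "homogeneous ?D (?z i) (case_sum a b i) (case_sum l k i) \<and> 0 < case_sum l k i" if "i \<in> I <+> J" for i
    using that dA(2,3) dB(2,3)
    by (auto simp: homogeneous_def A.smult_r_null B.smult_r_null)
  have sp: "m \<in> lspan R ?D (I <+> J) ?z" if m: "m \<in> carrier ?D" for m
  proof -
    obtain v w where vw: "v \<in> I \<rightarrow> carrier R" "fst m = lincomb A I v x" "w \<in> J \<rightarrow> carrier R" "snd m = lincomb B J w y"
      using m dA(4)[of "fst m"] dB(4)[of "snd m"] by auto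
    have vw': "case_sum v w \<in> I <+> J \<rightarrow> carrier R" using vw by auto
    have "m = lincomb ?D (I <+> J) (case_sum v w) ?z"
      using lc[OF vw'] vw by (simp add: comp_def prod_eq_iff)
    then show ?thesis using vw' by (auto simp: lspan_def)
  qed
  have ind: "v i \<odot>\<^bsub>?D\<^esub> ?z i = \<zero>\<^bsub>?D\<^esub>"
    if v: "v \<in> I <+> J \<rightarrow> carrier R" "lincomb ?D (I <+> J) v ?z = \<zero>\<^bsub>?D\<^esub>" "i \<in> I <+> J" for v i
  proof -
    have vl: "v \<circ> Inl \<in> I \<rightarrow> carrier R" and vr: "v \<circ> Inr \<in> J \<rightarrow> carrier R" using v(1) by auto
    have z: "lincomb A I (v \<circ> Inl) x = \<zero>\<^bsub>A\<^esub>" "lincomb B J (v \<circ> Inr) y = \<zero>\<^bsub>B\<^esub>"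
      using v(2) lc[OF v(1)] by auto
    show ?thesis
      using v(3) zz[OF v(1,3)] dA(5)[OF vl z(1)] dB(5)[OF vr z(2)] by auto
  qed
  show ?thesis unfolding decomp_def using dA(1) dB(1) h sp ind by auto
qed

lemma decomp_lmod_iso:
  assumes "left_module R M" "left_module R M'" "lmod_iso R M M'" "decomp M I x a l"
  shows "\<exists>y. decomp M' I y a l"
  using assms decomp_transport[OF assms(1,4,2)] unfolding lmod_iso_def by blast

subsection \<open>Projective dimension in terms of degrees and lengths\<close>

text \<open>
  In terms of degree \<open>a\<close> and length \<open>l\<close> of a uniserial module: its \<open>n\<close>-th syzygy is projective or zero.
\<close>

primrec syzygy_projective :: "nat \<Rightarrow> int \<Rightarrow> nat \<Rightarrow> bool" where
  "syzygy_projective 0 a l \<longleftrightarrow> l = c a"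
| "syzygy_projective (Suc n) a l \<longleftrightarrow> l = c a \<or> syzygy_projective n (a + int l) (c a - l)"

lemma pd_leI:
  fixes M :: "'a fmod"
  assumes "left_module R M" "decomp M I x a l" "\<And>i. i \<in> I \<Longrightarrow> syzygy_projective n (a i) (l i)"
  shows "pd_le R n M"
  using assms
proof (induction n arbitrary: M I x a l)
  case 0
  then show ?case using decomp_projective[OF 0(1,2)] by simp
next
  case (Suc n)
  obtain P p y where P: "projective_cover R M P p" "projective R P"
    "decomp (P\<lparr>carrier := a_kernel P M p\<rparr>) {i \<in> I. l i < c (a i)} y (\<lambda>i. a i + int (l i)) (\<lambda>i. c (a i) - l i)"
    using ex_cover_decomp[OF Suc.prems(1,2)] by blast
  note p = projective_coverD[OF P(1)]
  have K: "left_module R (P\<lparr>carrier := a_kernel P M p\<rparr>)"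
    by (rule left_module_kernel[OF projective_left_module[OF P(2)] Suc.prems(1) p(2)])
  have "pd_le R n (P\<lparr>carrier := a_kernel P M p\<rparr>)"
    using Suc.prems(3) by (intro Suc.IH[OF K P(3)]) fastforce
  moreover have "M \<in> fmods R" using decomp_fg[OF Suc.prems(1,2)] by (simp add: fmods_iff)
  ultimately show ?case using P(2) p by auto
qed

text \<open>
  A projective module is its own projective cover, so the syzygies of all its summands vanish.
\<close>

lemma projective_decomp:
  assumes "projective R V" "V \<in> fmods R" "decomp V I x a l" "i \<in> I"
  shows "l i = c (a i)"
proof -
  interpret V: left_module R V using assms(1) by (rule projective_left_module)
  obtain P p y where P: "projective_cover R V P p" "projective R P"
    "decomp (P\<lparr>carrier := a_kernel P V p\<rparr>) {i \<in> I. l i < c (a i)} y (\<lambda>i. a i + int (l i)) (\<lambda>i. c (a i) - l i)"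
    using ex_cover_decomp[OF V.left_module_axioms assms(3)] by blast
  interpret P: left_module R P using P(2) by (rule projective_left_module)
  note p = projective_coverD[OF P(1)]
  obtain s where s: "s \<in> lhom R V P" "\<And>x. x \<in> carrier V \<Longrightarrow> p (s x) = x"
    using projective_split[OF assms(1) projective_fmods[OF P(2)] p(2,3)] by blast
  have sX: "submodule (s ` carrier V) R P"
    by (rule submodule_image[OF V.left_module_axioms P.left_module_axioms s(1) V.submodule_carrier])
  have "p ` (s ` carrier V) = carrier V" using s(2) by (force simp: image_iff)
  then have onto: "s ` carrier V = carrier P"
    by (rule projective_cover_superfluous[OF P(1) V.left_module_axioms sX])
  have "a_kernel P V p \<subseteq> {\<zero>\<^bsub>P\<^esub>}"
  proof
    fix y assume y: "y \<in> a_kernel P V p"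
    then obtain z where z: "z \<in> carrier V" "y = s z" using onto by (auto simp: a_kernel_def')
    then have "z = \<zero>\<^bsub>V\<^esub>" using s(2) y by (auto simp: a_kernel_def')
    then show "y \<in> {\<zero>\<^bsub>P\<^esub>}" using z lhom_zero[OF V.left_module_axioms P.left_module_axioms s(1)] by simp
  qed
  then have "{i \<in> I. l i < c (a i)} = {}"
    using decomp_zero_module[OF left_module_kernel[OF P.left_module_axioms V.left_module_axioms p(2)] P(3)]
    by simp
  then have "\<not> l i < c (a i)" using assms(4) by blast
  then show ?thesis using homogeneous_le[OF V.left_module_axioms decompD(2)[OF assms(3,4)]] by simp
qed

text \<open>
  Retracts are inherited by syzygies: if \<open>V\<close> is a retract of \<open>M\<close>, the identity of \<open>V\<close> lifts to an
  endomorphism of the projective cover of \<open>V\<close> that factors over a given projective module onto \<open>M\<close>.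
  This lift is bijective, so the syzygy of \<open>V\<close> is a retract of the kernel.
\<close>

lemma pd_le_retract:
  fixes M V :: "'a fmod"
  assumes "pd_le R n M" "V \<in> fmods R" "decomp V I x a l"
    "\<iota> \<in> lhom R V M" "\<rho> \<in> lhom R M V" "\<And>y. y \<in> carrier V \<Longrightarrow> \<rho> (\<iota> y) = y" "i \<in> I"
  shows "syzygy_projective n (a i) (l i)"
  using assms
proof (induction n arbitrary: M V I x a l \<iota> \<rho> i)
  case 0
  have "projective R V"
    by (rule projective_retract[OF _ fmods_left_module[OF 0(2)] 0(4,5)]) (use 0(1,6) in auto)
  then show ?case using projective_decomp[OF _ 0(2,3,7)] by simp
next
  case (Suc n)
  obtain Q g where Q: "projective R Q" "g \<in> lhom R Q M" "g ` carrier Q = carrier M"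
    "pd_le R n (Q\<lparr>carrier := a_kernel Q M g\<rparr>)" and MF: "M \<in> fmods R" using Suc.prems(1) by auto
  interpret V: left_module R V using Suc.prems(2) by (rule fmods_left_module)
  interpret M: left_module R M using MF by (rule fmods_left_module)
  interpret Q: left_module R Q using Q(1) by (rule projective_left_module)
  obtain P p y where P: "projective_cover R V P p" "projective R P"
    "decomp (P\<lparr>carrier := a_kernel P V p\<rparr>) {i \<in> I. l i < c (a i)} y (\<lambda>i. a i + int (l i)) (\<lambda>i. c (a i) - l i)"
    using ex_cover_decomp[OF V.left_module_axioms Suc.prems(3)] by blast
  interpret P: left_module R P using P(2) by (rule projective_left_module)
  note p = projective_coverD[OF P(1)]
  obtain \<alpha> where \<alpha>: "\<alpha> \<in> lhom R P Q" "\<And>y. y \<in> carrier P \<Longrightarrow> g (\<alpha> y) = \<iota> (p y)"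
    using projective_lift[OF P(2) projective_fmods[OF Q(1)] MF Q(2) lhom_comp[OF p(2) Suc.prems(4)] Q(3)] by blast
  obtain \<beta> where \<beta>: "\<beta> \<in> lhom R Q P" "\<And>y. y \<in> carrier Q \<Longrightarrow> p (\<beta> y) = \<rho> (g y)"
    using projective_lift[OF Q(1) projective_fmods[OF P(2)] Suc.prems(2) p(2) lhom_comp[OF Q(2) Suc.prems(5)] p(3)] by blast
  let ?\<theta> = "\<lambda>y. \<beta> (\<alpha> y)"
  have \<theta>: "?\<theta> \<in> lhom R P P" by (rule lhom_comp[OF \<alpha>(1) \<beta>(1)])
  have p\<theta>: "p (?\<theta> y) = p y" if y: "y \<in> carrier P" for y
    using \<beta>(2)[OF lhom_closed[OF \<alpha>(1) y]] \<alpha>(2)[OF y] Suc.prems(6)[OF lhom_closed[OF p(2) y]] by simp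
  let ?KP = "a_kernel P V p" and ?KQ = "a_kernel Q M g"
  let ?MP = "P\<lparr>carrier := ?KP\<rparr>" and ?MQ = "Q\<lparr>carrier := ?KQ\<rparr>"
  have MP: "left_module R ?MP" by (rule left_module_kernel[OF P.left_module_axioms V.left_module_axioms p(2)])
  have b: "bij_betw ?\<theta> ?KP ?KP"
    by (rule kernel_bij_betw[OF projective_cover_comparison[OF Suc.prems(2) P(1) P(1) \<theta>]]) (rule p\<theta>, assumption)+
  have KPs: "?KP \<subseteq> carrier P" and KQs: "?KQ \<subseteq> carrier Q" by (auto simp: a_kernel_def')
  have \<alpha>K: "\<alpha> \<in> lhom R ?MP ?MQ"
    using \<alpha>(2) lhom_closed[OF \<alpha>(1)] lhom_zero[OF V.left_module_axioms M.left_module_axioms Suc.prems(4)]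
    by (intro lhom_restrict[OF \<alpha>(1)]) (auto simp: a_kernel_def')
  have \<beta>K: "\<beta> \<in> lhom R ?MQ ?MP"
    using \<beta>(2) lhom_closed[OF \<beta>(1)] lhom_zero[OF M.left_module_axioms V.left_module_axioms Suc.prems(5)]
    by (intro lhom_restrict[OF \<beta>(1)]) (auto simp: a_kernel_def')
  have \<theta>K: "?\<theta> \<in> lhom R ?MP ?MP" by (rule lhom_comp[OF \<alpha>K \<beta>K])
  have inv: "inv_into ?KP ?\<theta> \<in> lhom R ?MP ?MP"
    using lhom_inv_into[OF MP \<theta>K] b by simp
  show ?case
  proof (cases "l i = c (a i)")
    case False
    then have i: "i \<in> {i \<in> I. l i < c (a i)}"
      using Suc.prems(7) homogeneous_le[OF V.left_module_axioms decompD(2)[OF Suc.prems(3,7)]] by simp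
    have "syzygy_projective n (a i + int (l i)) (c (a i) - l i)"
    proof (rule Suc.IH[OF Q(4) _ P(3) \<alpha>K lhom_comp[OF \<beta>K inv] _ i])
      show "?MP \<in> fmods R" using decomp_fg[OF MP P(3)] by (simp add: fmods_iff)
      show "inv_into ?KP ?\<theta> (\<beta> (\<alpha> y)) = y" if "y \<in> carrier ?MP" for y
        using b that inv_into_f_f[of ?\<theta> ?KP y] by (simp add: bij_betw_def)
    qed
    then show ?thesis by simp
  qed simp
qed

lemma pd_leD:
  fixes M :: "'a fmod"
  assumes "pd_le R n M" "decomp M I x a l" "i \<in> I"
  shows "syzygy_projective n (a i) (l i)"
  by (rule pd_le_retract[OF assms(1) pd_le_fmods[OF assms(1)] assms(2) lhom_id lhom_id _ assms(3)]) simp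

text \<open>
  For an arbitrary projective module onto \<open>M\<close>, the kernel is the direct sum of a syzygy of \<open>M\<close> and
  a projective module.
\<close>

lemma pd_le_kernel:
  fixes M Q :: "'a fmod"
  assumes "pd_le R (Suc n) M" "projective R Q" "g \<in> lhom R Q M" "g ` carrier Q = carrier M"
  shows "pd_le R n (Q\<lparr>carrier := a_kernel Q M g\<rparr>)"
proof -
  have MF: "M \<in> fmods R" using pd_le_fmods[OF assms(1)] .
  interpret M: left_module R M using MF by (rule fmods_left_module)
  interpret Q: left_module R Q using assms(2) by (rule projective_left_module)
  obtain I x a l where dM: "decomp M (I :: nat set) x a l" using exists_decomp MF by (metis fmods_iff)
  obtain P p y where P: "projective_cover R M P p" "projective R P"
    "decomp (P\<lparr>carrier := a_kernel P M p\<rparr>) {i \<in> I. l i < c (a i)} y (\<lambda>i. a i + int (l i)) (\<lambda>i. c (a i) - l i)"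
    using ex_cover_decomp[OF M.left_module_axioms dM] by blast
  interpret P: left_module R P using P(2) by (rule projective_left_module)
  note p = projective_coverD[OF P(1)]
  obtain h where h: "h \<in> lhom R Q P" "\<And>x. x \<in> carrier Q \<Longrightarrow> p (h x) = g x"
    using projective_lift[OF assms(2) projective_fmods[OF P(2)] MF p(2) assms(3) p(3)] by blast
  have hQ: "submodule (h ` carrier Q) R P"
    by (rule submodule_image[OF Q.left_module_axioms P.left_module_axioms h(1) Q.submodule_carrier])
  have "p ` (h ` carrier Q) = carrier M" unfolding image_image using h(2) assms(4) by (simp cong: image_cong)
  then have onto: "h ` carrier Q = carrier P"
    by (rule projective_cover_superfluous[OF P(1) M.left_module_axioms hQ])
  obtain s where s: "s \<in> lhom R P Q" "\<And>x. x \<in> carrier P \<Longrightarrow> h (s x) = x"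
    using projective_split[OF P(2) projective_fmods[OF assms(2)] h(1) onto] by blast
  have gs: "g (s x) = p x" if "x \<in> carrier P" for x
    using h(2)[OF lhom_closed[OF s(1) that]] s(2)[OF that] by simp
  let ?K = "a_kernel Q M g" and ?A = "s ` a_kernel P M p" and ?B = "a_kernel Q P h"
  let ?MK = "Q\<lparr>carrier := ?K\<rparr>" and ?MA = "Q\<lparr>carrier := ?A\<rparr>" and ?MB = "Q\<lparr>carrier := ?B\<rparr>"
  have Ks: "submodule ?K R Q" by (rule submodule_kernel[OF Q.left_module_axioms M.left_module_axioms assms(3)])
  have As: "submodule ?A R Q"
    by (rule submodule_image[OF P.left_module_axioms Q.left_module_axioms s(1)
          submodule_kernel[OF P.left_module_axioms M.left_module_axioms p(2)]])
  have Bs: "submodule ?B R Q" by (rule submodule_kernel[OF Q.left_module_axioms P.left_module_axioms h(1)])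
  have MK: "left_module R ?MK" and MA: "left_module R ?MA" and MB: "left_module R ?MB"
    by (rule Q.left_module_submodule, fact)+
  have AK: "?A \<subseteq> ?K" using gs lhom_closed[OF s(1)] by (auto simp: a_kernel_def')
  have BK: "?B \<subseteq> ?K"
    using h(2) lhom_zero[OF P.left_module_axioms M.left_module_axioms p(2)] by (fastforce simp: a_kernel_def')
  let ?r = "\<lambda>y. y \<ominus>\<^bsub>Q\<^esub> s (h y)"
  have "\<forall>x\<in>carrier P. h (s x) = x" using s(2) by blast
  note r = split_projection[OF Q.left_module_axioms P.left_module_axioms h(1) s(1), OF this]
  have iso: "lmod_iso R ?MK (direct_sum (?MK\<lparr>carrier := ?A\<rparr>) (?MK\<lparr>carrier := ?B\<rparr>))"
  proof (rule lmod_iso_internal_sum[OF MK])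
    show "submodule ?A R ?MK" "submodule ?B R ?MK"
      using submodule_of_submodule_iff[OF Q.left_module_axioms Ks] As Bs AK BK by auto
    show "\<exists>u\<in>?A. \<exists>v\<in>?B. y = u \<oplus>\<^bsub>?MK\<^esub> v" if "y \<in> carrier ?MK" for y
    proof -
      have y: "y \<in> carrier Q" "g y = \<zero>\<^bsub>M\<^esub>" using that by (auto simp: a_kernel_def')
      have "h y \<in> a_kernel P M p" using h(2)[OF y(1)] y lhom_closed[OF h(1)] by (simp add: a_kernel_def')
      then show ?thesis using r(2)[OF y(1)] lhom_closed[OF r(1) y(1)] by auto
    qed
    show "?A \<inter> ?B = {\<zero>\<^bsub>?MK\<^esub>}"
    proof
      show "?A \<inter> ?B \<subseteq> {\<zero>\<^bsub>?MK\<^esub>}"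
      proof
        fix y assume "y \<in> ?A \<inter> ?B"
        then obtain z where z: "z \<in> carrier P" "y = s z" "h y = \<zero>\<^bsub>P\<^esub>" by (auto simp: a_kernel_def')
        then have "z = \<zero>\<^bsub>P\<^esub>" using s(2) by simp
        then show "y \<in> {\<zero>\<^bsub>?MK\<^esub>}" using z lhom_zero[OF P.left_module_axioms Q.left_module_axioms s(1)] by simp
      qed
      show "{\<zero>\<^bsub>?MK\<^esub>} \<subseteq> ?A \<inter> ?B" using Q.submoduleD(2)[OF As] Q.submoduleD(2)[OF Bs] by simp
    qed
  qed
  have "lmod_iso R (P\<lparr>carrier := a_kernel P M p\<rparr>) ?MA"
    unfolding lmod_iso_def
  proof (rule bexI[of _ s])
    have "inj_on s (carrier P)" by (rule inj_on_inverseI[of _ h]) (rule s(2))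
    then show "bij_betw s (carrier (P\<lparr>carrier := a_kernel P M p\<rparr>)) (carrier ?MA)"
      by (auto simp: bij_betw_def a_kernel_def' inj_on_def)
    show "s \<in> lhom R (P\<lparr>carrier := a_kernel P M p\<rparr>) ?MA"
      by (rule lhom_restrict[OF s(1)]) (auto simp: a_kernel_def')
  qed
  then obtain y' where dA: "decomp ?MA {i \<in> I. l i < c (a i)} y' (\<lambda>i. a i + int (l i)) (\<lambda>i. c (a i) - l i)"
    using decomp_lmod_iso[OF left_module_kernel[OF P.left_module_axioms M.left_module_axioms p(2)] MA _ P(3)] by blast
  have prB: "projective R ?MB"
  proof (rule projective_retract[OF assms(2) MB])
    show "(\<lambda>y. y) \<in> lhom R ?MB Q" by (rule lhom_restrict_dom[OF lhom_id]) (auto simp: a_kernel_def')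
    show "?r \<in> lhom R Q ?MB" by (rule r(1))
    show "?r y = y" if "y \<in> carrier ?MB" for y using r(3) that by simp
  qed
  obtain J z b k where dB: "decomp ?MB (J :: nat set) z b k"
    using exists_decomp prB by (metis projective_def)
  have dK: "\<exists>w. decomp ?MK ({i \<in> I. l i < c (a i)} <+> J) w (case_sum (\<lambda>i. a i + int (l i)) b)
      (case_sum (\<lambda>i. c (a i) - l i) k)"
    using decomp_lmod_iso[OF left_module_direct_sum[OF MA MB] MK _ decomp_direct_sum[OF MA MB dA dB]]
      lmod_iso_sym[OF MK iso] by simp
  have kb: "k j = c (b j)" if "j \<in> J" for j
    by (rule projective_decomp[OF prB projective_fmods[OF prB] dB that])
  have "syzygy_projective n (case_sum (\<lambda>i. a i + int (l i)) b i) (case_sum (\<lambda>i. c (a i) - l i) k i)"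
    if "i \<in> {i \<in> I. l i < c (a i)} <+> J" for i
    using that
  proof
    fix j assume "j \<in> J" "i = Inr j"
    then show ?thesis using kb by (cases n) auto
  next
    fix j assume j: "j \<in> {i \<in> I. l i < c (a i)}" "i = Inl j"
    then have "syzygy_projective (Suc n) (a j) (l j)" using pd_leD[OF assms(1) dM] by blast
    then show ?thesis using j by auto
  qed
  then show ?thesis using dK pd_leI[OF MK] by blast
qed

end

section \<open>Ends of the indecomposable projective modules\<close>

context cyclic_nakayama
begin

definition proj_end :: "int \<Rightarrow> int" where
  "proj_end a = a + int (c a)"

lemma proj_end_shift: "proj_end (a + int N * w) = proj_end a + int N * w"
  by (simp add: proj_end_def c_shift)

lemma proj_end_mono: "a \<le> b \<Longrightarrow> proj_end a \<le> proj_end b"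
proof (induction b rule: int_ge_induct)
  case (step b)
  have "proj_end b \<le> proj_end (b + 1)" using c_mono_step[of b] by (simp add: proj_end_def)
  then show ?case using step by simp
qed simp

lemma proj_end_iter_shift: "(proj_end ^^ n) (a + int N * w) = (proj_end ^^ n) a + int N * w"
  by (induction n) (simp_all add: proj_end_shift)

lemma proj_end_iter_mono: "a \<le> b \<Longrightarrow> (proj_end ^^ n) a \<le> (proj_end ^^ n) b"
  by (induction n) (simp_all add: proj_end_mono)

definition end_residue :: "int \<Rightarrow> int" where
  "end_residue a = proj_end a mod int N"

lemma proj_end_mod: "proj_end a mod int N = end_residue (a mod int N)"
proof -
  have "a = a mod int N + int N * (a div int N)" by simp
  then have "proj_end a = proj_end (a mod int N) + int N * (a div int N)" by (metis proj_end_shift)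
  then show ?thesis by (simp add: end_residue_def)
qed

lemma proj_end_iter_mod: "(proj_end ^^ n) a mod int N = (end_residue ^^ n) (a mod int N)"
  by (induction n) (simp_all add: proj_end_mod)

end

locale cyclic_nakayama_ends = cyclic_nakayama R N e pv c
  for R :: "('a, 'm) ring_scheme" (structure) and N e and pv :: "'k::field poly \<Rightarrow> 'a" and c +
  fixes r :: nat
  assumes card_ends: "card (range (\<lambda>a. (a + int (c a)) mod int N)) \<le> r"
begin

text \<open>
  The interval ends that occur in syzygies of order at least \<open>2 r\<close>.
\<close>

definition stable :: "int set" where
  "stable = range (proj_end ^^ r)"

definition residues :: "nat \<Rightarrow> int set" where
  "residues j = (\<lambda>a. a mod int N) ` range (proj_end ^^ j)"

lemma residues_Suc: "residues (Suc j) = end_residue ` residues j"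
  by (force simp: residues_def image_iff proj_end_mod)

lemma finite_residues: "finite (residues j)"
proof (rule finite_subset)
  show "residues j \<subseteq> {0..<int N}" using N_pos by (auto simp: residues_def)
qed simp

lemma residues_antimono: "residues (Suc j) \<subseteq> residues j"
  by (auto simp: residues_def funpow_swap1)

lemma residues_stable: "residues (Suc j) = residues j \<Longrightarrow> residues (Suc (j + i)) = residues (j + i)"
  by (induction i) (auto simp: residues_Suc)

text \<open>The residues of the iterated ends decrease strictly until they are stable.\<close>

lemma residues_r: "residues (Suc r) = residues r"
proof -
  have "\<exists>j. j \<le> r \<and> residues (Suc j) = residues j"
  proof (rule ccontr)
    assume *: "\<not> ?thesis"
    have "card (residues (Suc i)) + i \<le> r" if "i \<le> r" for i
      using that
    proof (induction i)
      case 0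
      have "residues (Suc 0) = range (\<lambda>a. (a + int (c a)) mod int N)"
        by (auto simp: residues_def proj_end_def)
      then show ?case using card_ends by simp
    next
      case (Suc i)
      have "residues (Suc (Suc i)) \<subset> residues (Suc i)" using residues_antimono[of "Suc i"] * Suc.prems by blast
      then have "card (residues (Suc (Suc i))) < card (residues (Suc i))"
        by (rule psubset_card_mono[OF finite_residues])
      then show ?case using Suc by simp
    qed
    from this[of r] have "residues (Suc r) = {}" using finite_residues by simp
    then show False by (simp add: residues_def)
  qed
  then show ?thesis using residues_stable by (metis le_add_diff_inverse)
qed

lemma inj_end_residue: "inj_on end_residue (residues r)"
  using residues_r by (intro eq_card_imp_inj_on finite_residues) (simp add: residues_Suc)

lemma stable_closed: "x \<in> stable \<Longrightarrow> (proj_end ^^ n) x \<in> stable"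
proof -
  assume "x \<in> stable"
  then obtain y where "x = (proj_end ^^ r) y" by (auto simp: stable_def)
  then have "(proj_end ^^ n) x = (proj_end ^^ r) ((proj_end ^^ n) y)"
    by (simp add: add.commute flip: comp_apply[of "proj_end ^^ n"] comp_apply[of "proj_end ^^ r"] funpow_add)
  then show ?thesis by (simp add: stable_def)
qed

lemma stable_shift: "x \<in> stable \<Longrightarrow> x + int N * w \<in> stable"
  by (auto simp: stable_def image_iff simp flip: proj_end_iter_shift)

lemma inj_proj_end: "inj_on proj_end stable"
proof (rule inj_onI)
  fix x y assume *: "x \<in> stable" "y \<in> stable" "proj_end x = proj_end y"
  have "x mod int N = y mod int N"
  proof (rule inj_onD[OF inj_end_residue])
    show "x mod int N \<in> residues r" "y mod int N \<in> residues r"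
      using * by (auto simp: residues_def stable_def)
    show "end_residue (x mod int N) = end_residue (y mod int N)"
      using *(3) by (simp flip: proj_end_mod)
  qed
  then have "int N dvd y - x" by (simp add: mod_eq_dvd_iff dvd_diff_commute)
  then obtain k where k: "y = x + int N * k" by (metis dvd_def diff_eq_eq add.commute)
  then have "int N * k = 0" using *(3) by (simp add: proj_end_shift)
  then show "x = y" using k by simp
qed

lemma inj_proj_end_iter: "inj_on (proj_end ^^ n) stable"
proof (induction n)
  case (Suc n)
  show ?case
  proof (rule inj_onI)
    fix x y assume *: "x \<in> stable" "y \<in> stable" "(proj_end ^^ Suc n) x = (proj_end ^^ Suc n) y"
    then have "(proj_end ^^ n) x = (proj_end ^^ n) y"
      using inj_proj_end stable_closed by (auto simp: inj_on_def)
    then show "x = y" using Suc * by (auto simp: inj_on_def)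
  qed
qed simp

lemma end_residue_period: "\<exists>q>0. \<forall>y\<in>residues r. (end_residue ^^ q) y = y"
proof -
  let ?Y = "residues r"
  have maps: "(end_residue ^^ i) y \<in> ?Y" if "y \<in> ?Y" for i y
    using that residues_r by (induction i) (auto simp: residues_Suc)
  have inj: "inj_on (end_residue ^^ i) ?Y" for i
  proof (induction i)
    case (Suc i)
    show ?case using Suc inj_end_residue maps by (auto simp: inj_on_def)
  qed simp
  \<comment> \<open>Two of the powers agree on the finite set of residues, and the smaller one can be cancelled.\<close>
  let ?F = "\<lambda>i. restrict (end_residue ^^ i) ?Y"
  have "range ?F \<subseteq> (\<Pi>\<^sub>E y\<in>?Y. ?Y)" using maps by auto
  then have "finite (range ?F)" by (rule finite_subset) (intro finite_PiE finite_residues)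
  then have "\<not> inj ?F" using finite_imageD by blast
  then obtain i j where ij: "?F i = ?F j" "i < j" unfolding inj_on_def by (metis nat_neq_iff)
  have "(end_residue ^^ (j - i)) y = y" if y: "y \<in> ?Y" for y
  proof -
    have "(end_residue ^^ i) ((end_residue ^^ (j - i)) y) = (end_residue ^^ j) y"
      using ij(2) by (metis funpow_add comp_apply le_add_diff_inverse less_imp_le)
    also have "\<dots> = (end_residue ^^ i) y" using fun_cong[OF ij(1), of y] y by simp
    finally show ?thesis using inj[of i] maps[OF y] y by (auto simp: inj_on_def)
  qed
  then show ?thesis using ij(2) by (intro exI[of _ "j - i"]) auto
qed

text \<open>
  On the stable ends, \<^term>\<open>proj_end\<close> is a monotone bijection that commutes with the shift by \<open>N\<close>.
  A power that fixes all residues moves every stable end by the same multiple of \<open>N\<close>, because it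
  preserves the order of any two ends at distance less than \<open>N\<close>.
\<close>

lemma proj_end_period: "\<exists>q>0. \<exists>w. \<forall>x\<in>stable. (proj_end ^^ q) x = x + int N * w"
proof -
  obtain q where q: "q > 0" "\<forall>y\<in>residues r. (end_residue ^^ q) y = y" using end_residue_period by blast
  define v where "v x = ((proj_end ^^ q) x - x) div int N" for x
  have v: "(proj_end ^^ q) x = x + int N * v x" if x: "x \<in> stable" for x
  proof -
    have "(proj_end ^^ q) x mod int N = x mod int N"
      using q(2) x by (auto simp: proj_end_iter_mod residues_def stable_def)
    then have "int N dvd (proj_end ^^ q) x - x" by (simp add: mod_eq_dvd_iff)
    then show ?thesis by (simp add: v_def)
  qed
  have near: "v x = v y" if xy: "x \<in> stable" "y \<in> stable" "x \<le> y" "y < x + int N" for x y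
  proof -
    have "x + int N * v x \<le> y + int N * v y"
      using proj_end_iter_mono[OF xy(3), of q] v[OF xy(1)] v[OF xy(2)] by simp
    moreover have "y + int N * v y \<le> (x + int N) + int N * v x"
      using proj_end_iter_mono[of y "x + int N * 1" q] xy(4) v[OF xy(1)] v[OF xy(2)]
        proj_end_iter_shift[of q x 1] by simp
    ultimately have "int N * (v x - v y) < int N * 1" "int N * (v y - v x) < int N * 2"
      "int N * (v y - v x) \<le> int N * 1 + x - y"
      using xy(3,4) by (simp_all add: right_diff_distrib)
    moreover from this(3) have "x \<noteq> y \<Longrightarrow> int N * (v y - v x) < int N * 1" using xy(3) by simp
    ultimately show ?thesis using N_pos
      by (cases "x = y") (simp_all only: mult_less_cancel_left_pos of_nat_0_less_iff, simp_all)
  qed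
  have shift: "v (x + int N * k) = v x" for x k by (simp add: v_def proj_end_iter_shift)
  have "v x = v y" if xy: "x \<in> stable" "y \<in> stable" for x y
  proof -
    define y' where "y' = y + int N * (- ((y - x) div int N))"
    have "y' = x + (y - x) mod int N"
      unfolding y'_def using minus_mult_div_eq_mod[of "y - x" "int N"] by simp
    then have "x \<le> y'" "y' < x + int N" using N_pos by auto
    then have "v x = v y'" using stable_shift[OF xy(2), of "- ((y - x) div int N)"] xy(1)
      unfolding y'_def by (intro near)
    then show ?thesis unfolding y'_def shift .
  qed
  then have "\<exists>w. \<forall>x\<in>stable. v x = w" by metis
  then show ?thesis using v q(1) by metis
qed

subsection \<open>The ends of the syzygies of a uniserial module\<close>

text \<open>
  The \<open>n\<close>-th syzygy of \<open>[a, b)\<close> is the interval from \<open>syz_end a b n\<close> to \<open>syz_end a b (n + 1)\<close>, at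
  least as long as none of the earlier ones is projective.
\<close>

definition syz_end :: "int \<Rightarrow> int \<Rightarrow> nat \<Rightarrow> int" where
  "syz_end a b n = (proj_end ^^ (n div 2)) (if even n then a else b)"

lemma syz_end_Suc: "syz_end a b (Suc n) = syz_end b (proj_end a) n"
  by (auto simp: syz_end_def funpow_swap1 elim!: evenE oddE)

text \<open>
  A syzygy is projective if and only if the next one is zero, that is, if its ends coincide.
\<close>

lemma syzygy_projective_iff:
  assumes "l \<le> c a"
  shows "syzygy_projective n a l \<longleftrightarrow>
    (\<exists>j\<in>{1..Suc n}. syz_end a (a + int l) j = syz_end a (a + int l) (Suc j))"
  using assms
proof (induction n arbitrary: a l)
  case 0
  have "syz_end a (a + int l) 1 = a + int l" "syz_end a (a + int l) (Suc 1) = proj_end a"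
    by (simp_all add: syz_end_def)
  then show ?case by (auto simp: proj_end_def)
next
  case (Suc n)
  let ?b = "a + int l"
  have fb: "?b + int (c a - l) = proj_end a" using Suc.prems by (simp add: proj_end_def of_nat_diff)
  have "proj_end a \<le> proj_end ?b" by (rule proj_end_mono) simp
  then have "c a - l \<le> c ?b" using fb by (simp add: proj_end_def)
  then have IH: "syzygy_projective n ?b (c a - l) \<longleftrightarrow>
      (\<exists>j\<in>{1..Suc n}. syz_end a ?b (Suc j) = syz_end a ?b (Suc (Suc j)))"
    using Suc.IH[of "c a - l" ?b] unfolding fb by (simp add: syz_end_Suc)
  have set_eq: "{1..Suc (Suc n)} = insert 1 (Suc ` {1..Suc n})"
    by (auto simp: image_Suc_atLeastAtMost)
  have "(\<exists>j\<in>{1..Suc (Suc n)}. P j) \<longleftrightarrow> P 1 \<or> (\<exists>j\<in>{1..Suc n}. P (Suc j))" for P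
    unfolding set_eq by blast
  moreover have "l = c a \<longleftrightarrow> syz_end a ?b 1 = syz_end a ?b (Suc 1)"
    by (auto simp: syz_end_def proj_end_def)
  ultimately show ?case using IH by simp
qed

lemma r_pos: "r > 0"
proof -
  have "residues (Suc 0) \<noteq> {}" by (simp add: residues_def)
  then have "card (residues (Suc 0)) > 0" using finite_residues by (simp add: card_gt_0_iff)
  moreover have "residues (Suc 0) = range (\<lambda>a. (a + int (c a)) mod int N)"
    by (auto simp: residues_def proj_end_def)
  ultimately show ?thesis using card_ends by simp
qed

lemma proj_end_iter_eq:
  assumes "(proj_end ^^ n) x = (proj_end ^^ n) y" "n \<ge> r"
  shows "(proj_end ^^ r) x = (proj_end ^^ r) y"
proof -
  have n: "(proj_end ^^ n) z = (proj_end ^^ (n - r)) ((proj_end ^^ r) z)" for z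
    using assms(2) by (metis funpow_add comp_apply le_add_diff_inverse2)
  show ?thesis
    using inj_proj_end_iter[of "n - r"] assms(1) unfolding n by (auto simp: inj_on_def stable_def)
qed

lemma syzygy_projective_bound:
  assumes "syzygy_projective n a l" "l \<le> c a"
  shows "syzygy_projective (2 * r) a l"
proof -
  let ?s = "syz_end a (a + int l)"
  obtain j where j: "j \<ge> 1" "?s j = ?s (Suc j)" using assms syzygy_projective_iff by auto
  have "\<exists>j\<in>{1..Suc (2 * r)}. ?s j = ?s (Suc j)"
  proof (cases "j \<le> Suc (2 * r)")
    case True
    then show ?thesis using j by (intro bexI[of _ j]) auto
  next
    case False
    show ?thesis
    proof (cases "even j")
      case True
      then obtain u where u: "j = 2 * u" by blast
      have "(proj_end ^^ u) a = (proj_end ^^ u) (a + int l)" using j(2) by (simp add: u syz_end_def)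
      then have "(proj_end ^^ r) a = (proj_end ^^ r) (a + int l)"
        by (rule proj_end_iter_eq) (use False u in simp)
      then have "?s (2 * r) = ?s (Suc (2 * r))" by (simp add: syz_end_def)
      then show ?thesis using r_pos by (intro bexI[of _ "2 * r"]) auto
    next
      case odd: False
      then obtain u where u: "j = 2 * u + 1" by (rule oddE)
      have "(proj_end ^^ u) (a + int l) = (proj_end ^^ u) (proj_end a)"
        using j(2) by (simp add: u syz_end_def funpow_swap1)
      then have "(proj_end ^^ r) (a + int l) = (proj_end ^^ r) (proj_end a)"
        by (rule proj_end_iter_eq) (use False u in simp)
      then have "?s (Suc (2 * r)) = ?s (Suc (Suc (2 * r)))" by (simp add: syz_end_def funpow_swap1)
      then show ?thesis by (intro bexI[of _ "Suc (2 * r)"]) auto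
    qed
  qed
  then show ?thesis using syzygy_projective_iff[OF assms(2)] by simp
qed

section \<open>Finitistic, Gorenstein and dominant dimension\<close>

lemma pd_le_bound:
  fixes M :: "'a fmod"
  assumes "pd_le R n M"
  shows "pd_le R (2 * r) M"
proof -
  have M: "fg_module R M" "left_module R M"
    using pd_le_fmods[OF assms] by (auto simp: fmods_iff fg_module_def)
  obtain I x a l where d: "decomp M (I :: nat set) x a l" using exists_decomp[OF M(1)] by blast
  show ?thesis
    by (rule pd_leI[OF M(2) d], rule syzygy_projective_bound[OF pd_leD[OF assms d]])
      (use homogeneous_le[OF M(2) decompD(2)[OF d]] in auto)
qed

lemma proj_dim_bound:
  assumes "M \<in> fmods R" "proj_dim R M < \<infinity>"
  shows "proj_dim R M \<le> enat (2 * r)"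
  using finite_proj_dim_pd_le[OF assms] pd_le_bound proj_dim_le by metis

theorem fin_dim_bound: "fin_dim R \<le> enat (2 * r)"
  unfolding fin_dim_def by (rule Sup_least) (use proj_dim_bound in auto)

theorem gor_dim_bound: "gorenstein R \<Longrightarrow> gor_dim R \<le> enat (2 * r)"
  unfolding gor_dim_def gorenstein_def by (rule Sup_least) (use proj_dim_bound in auto)

lemma left_module_regular: "left_module R (regular_module R)"
proof -
  have "abelian_group (regular_module R)"
    by (rule abelian_groupI)
      (auto simp: regular_module_def a_ac intro!: bexI[of _ "\<ominus> x" for x] l_neg)
  then show ?thesis
    by (intro left_module.intro ring_axioms left_module_axioms.intro)
      (auto simp: regular_module_def l_distr r_distr m_assoc)
qed

lemma fg_regular: "fg_module R (regular_module R)"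
proof (rule fg_moduleI[of _ _ "{()}" "\<lambda>_. \<one>", OF left_module_regular])
  interpret M: left_module R "regular_module R" by (rule left_module_regular)
  have [simp]: "carrier (regular_module R) = carrier R" "r \<odot>\<^bsub>regular_module R\<^esub> s = r \<otimes> s" for r s
    by (simp_all add: regular_module_def)
  show "carrier (regular_module R) \<subseteq> lspan R (regular_module R) {()} (\<lambda>_. \<one>)"
  proof
    fix x assume x: "x \<in> carrier (regular_module R)"
    have "lincomb (regular_module R) {()} (\<lambda>_. x) (\<lambda>_. \<one>) = x \<odot>\<^bsub>regular_module R\<^esub> \<one>"
      using x by (intro M.lincomb_single) auto
    then show "x \<in> lspan R (regular_module R) {()} (\<lambda>_. \<one>)"
      using x by (auto simp: lspan_def intro!: exI[of _ "\<lambda>_. x"])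
  qed
qed (auto simp: regular_module_def)

lemma projective_regular: "projective R (regular_module R)"
proof -
  have [simp]: "carrier (regular_module R) = carrier R" "r \<odot>\<^bsub>regular_module R\<^esub> s = r \<otimes> s"
    "r \<oplus>\<^bsub>regular_module R\<^esub> s = r \<oplus> s" for r s
    by (simp_all add: regular_module_def)
  have "\<exists>h\<in>lhom R (regular_module R) A. \<forall>x\<in>carrier (regular_module R). g (h x) = f x"
    if *: "A \<in> fmods R" "B \<in> fmods R" "g \<in> lhom R A B" "f \<in> lhom R (regular_module R) B"
      "g ` carrier A = carrier B" for A B g f
  proof -
    interpret A: left_module R A using *(1) by (rule fmods_left_module)
    have "f \<one> \<in> g ` carrier A" using lhom_closed[OF *(4), of \<one>] *(5) by simp
    then obtain y where y: "y \<in> carrier A" "g y = f \<one>" by auto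
    have "(\<lambda>x. x \<odot>\<^bsub>A\<^esub> y) \<in> lhom R (regular_module R) A"
      using y by (auto simp: lhom_def A.smult_closed A.smult_l_distr A.smult_assoc)
    moreover have "g (x \<odot>\<^bsub>A\<^esub> y) = f x" if "x \<in> carrier R" for x
      using lhom_smult[OF *(3) that y(1)] lhom_smult[OF *(4), of x \<one>] that y(2) by simp
    ultimately show ?thesis by (intro bexI[of _ "\<lambda>x. x \<odot>\<^bsub>A\<^esub> y"]) auto
  qed
  then show ?thesis using fg_regular unfolding projective_def by auto
qed

lemma injective_retract:
  assumes "injective R E" "fg_module R M" "\<iota> \<in> lhom R M E" "\<rho> \<in> lhom R E M"
    "\<And>x. x \<in> carrier M \<Longrightarrow> \<rho> (\<iota> x) = x"
  shows "injective R M"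
proof -
  have "\<exists>h\<in>lhom R B M. \<forall>x\<in>carrier A. h (g x) = f x"
    if *: "A \<in> fmods R" "B \<in> fmods R" "g \<in> lhom R A B" "f \<in> lhom R A M" "inj_on g (carrier A)" for A B g f
  proof -
    have "\<exists>h \<in> lhom R B E. \<forall>x \<in> carrier A. h (g x) = \<iota> (f x)"
      using assms(1)[unfolded injective_def, THEN conjunct2, rule_format, OF *(1-3) lhom_comp[OF *(4) assms(3)] *(5)] .
    then obtain h where h: "h \<in> lhom R B E" "\<And>x. x \<in> carrier A \<Longrightarrow> h (g x) = \<iota> (f x)" by auto
    show ?thesis
      using h assms(5) lhom_closed[OF *(4)]
      by (intro bexI[of _ "\<lambda>x. \<rho> (h x)"] lhom_comp[OF h(1) assms(4)]) auto
  qed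
  then show ?thesis using assms(2) unfolding injective_def by blast
qed

text \<open>
  If the first \<open>2 r + 1\<close> terms of an injective resolution of the ring are projective, they form a
  projective resolution of the last cokernel. By the bound on projective dimensions this resolution
  splits at its end, that is, at the ring itself.
\<close>

lemma selfinjective_if_long_dominant:
  assumes res: "minimal_injective_resolution R (regular_module R) I \<iota> d"
    and proj: "\<And>i. i \<le> 2 * r \<Longrightarrow> projective R (I i)"
  shows "selfinjective R"
proof -
  have inj: "injective R (I i)" for i using res by (simp add: minimal_injective_resolution_def)
  have \<iota>: "\<iota> \<in> lhom R (regular_module R) (I 0)" "inj_on \<iota> (carrier (regular_module R))"
    "\<iota> ` carrier (regular_module R) = a_kernel (I 0) (I (Suc 0)) (d 0)"
    and dl: "\<And>i. d i \<in> lhom R (I i) (I (Suc i))"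
    and dk: "\<And>i. d i ` carrier (I i) = a_kernel (I (Suc i)) (I (Suc (Suc i))) (d (Suc i))"
    using res by (auto simp: minimal_injective_resolution_def)
  have fgI: "fg_module R (I i)" for i using inj[of i] by (simp add: injective_def)
  have lmI: "left_module R (I i)" for i using fgI[of i] by (simp add: fg_module_def)
  \<comment> \<open>\<open>J 0\<close> is a copy of the ring, and \<open>J (i + 1)\<close> is the cokernel of the inclusion of \<open>J i\<close> into \<open>I i\<close>.\<close>
  define J where "J i = (I i)\<lparr>carrier := a_kernel (I i) (I (Suc i)) (d i)\<rparr>" for i
  have lmJ: "left_module R (J i)" for i
    unfolding J_def by (rule left_module_kernel[OF lmI lmI dl])
  have dJ: "d i \<in> lhom R (I i) (J (Suc i))" "d i ` carrier (I i) = carrier (J (Suc i))" for i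
  proof -
    show "d i \<in> lhom R (I i) (J (Suc i))"
      unfolding J_def by (rule lhom_restrict_cod[OF dl]) (simp add: dk)
    show "d i ` carrier (I i) = carrier (J (Suc i))" by (simp add: J_def dk)
  qed
  have Jk: "(I i)\<lparr>carrier := a_kernel (I i) (J (Suc i)) (d i)\<rparr> = J i" for i
    by (simp add: J_def a_kernel_def')
  have J0: "\<iota> \<in> lhom R (regular_module R) (J 0)" "bij_betw \<iota> (carrier (regular_module R)) (carrier (J 0))"
  proof -
    show "\<iota> \<in> lhom R (regular_module R) (J 0)"
      unfolding J_def by (rule lhom_restrict_cod[OF \<iota>(1)]) (simp add: \<iota>(3))
    show "bij_betw \<iota> (carrier (regular_module R)) (carrier (J 0))" using \<iota> by (simp add: J_def bij_betw_def)
  qed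
  have JF: "J i \<in> fmods R" for i
  proof (cases i)
    case 0
    then show ?thesis
      using fg_module_image[OF fg_regular lmJ J0(1)] J0(2) by (simp add: fmods_iff bij_betw_def)
  next
    case (Suc j)
    then show ?thesis using fg_module_image[OF fgI lmJ dJ] by (simp add: fmods_iff)
  qed
  have up: "pd_le R i (J i)" if "i \<le> Suc (2 * r)" for i
    using that
  proof (induction i)
    case 0
    have "lmod_iso R (regular_module R) (J 0)" using J0 unfolding lmod_iso_def by blast
    then show ?case using projective_iso[OF projective_regular lmJ] by simp
  next
    case (Suc i)
    then have "projective R (I i)" "pd_le R i (J i)" using proj by auto
    then show ?case
      unfolding pd_le.simps using JF[of "Suc i"] dJ[of i] Jk[of i]
      by (intro conjI exI[of _ "I i"] exI[of _ "d i"]) auto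
  qed
  have down: "pd_le R (2 * r - k) (J (Suc (2 * r - k)))" if "k \<le> 2 * r" for k
    using that
  proof (induction k)
    case 0
    show ?case using pd_le_bound[OF up[of "Suc (2 * r)"]] by simp
  next
    case (Suc k)
    then have eq: "2 * r - k = Suc (2 * r - Suc k)" by simp
    then have 1: "pd_le R (Suc (2 * r - Suc k)) (J (Suc (Suc (2 * r - Suc k))))" using Suc by simp
    have 2: "projective R (I (Suc (2 * r - Suc k)))" using Suc.prems by (intro proj) simp
    show ?case using pd_le_kernel[OF 1 2 dJ] unfolding Jk .
  qed
  have "projective R (J (Suc 0))" using down[of "2 * r"] by simp
  then obtain s where s: "s \<in> lhom R (J (Suc 0)) (I 0)" "\<And>x. x \<in> carrier (J (Suc 0)) \<Longrightarrow> d 0 (s x) = x"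
    using projective_split[OF _ _ dJ] fgI fmods_iff by metis
  let ?p = "\<lambda>y. y \<ominus>\<^bsub>I 0\<^esub> s (d 0 y)"
  have "\<forall>x\<in>carrier (J (Suc 0)). d 0 (s x) = x" using s(2) by blast
  note sp = split_projection[OF lmI lmJ dJ(1) s(1), OF this]
  have p: "?p \<in> lhom R (I 0) (J 0)" using sp(1) unfolding Jk .
  let ?\<rho> = "\<lambda>y. inv_into (carrier (regular_module R)) \<iota> (?p y)"
  have "?\<rho> \<in> lhom R (I 0) (regular_module R)"
    by (rule lhom_comp[OF p lhom_inv_into[OF left_module_regular J0]])
  moreover have "?\<rho> (\<iota> x) = x" if x: "x \<in> carrier (regular_module R)" for x
  proof -
    have "\<iota> x \<in> a_kernel (I 0) (J (Suc 0)) (d 0)"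
      using \<iota>(3) x by (auto simp: a_kernel_def' J_def)
    then have "?p (\<iota> x) = \<iota> x" by (rule sp(3))
    then show ?thesis using inv_into_f_f[OF \<iota>(2) x] by simp
  qed
  ultimately show ?thesis
    unfolding selfinjective_def by (intro injective_retract[OF inj[of 0] fg_regular \<iota>(1)]) auto
qed

theorem dom_dim_bound:
  assumes "\<not> selfinjective R"
  shows "dom_dim R \<le> enat (2 * r)"
  unfolding dom_dim_def
proof (rule Sup_least)
  fix n assume "n \<in> {enat (m + 1) | m. \<exists>I \<iota> d. minimal_injective_resolution R (regular_module R) I \<iota> d \<and>
    (\<forall>i\<le>m. projective R (I i))}"
  then obtain m I \<iota> d where m: "n = enat (m + 1)" "minimal_injective_resolution R (regular_module R) I \<iota> d"
    "\<forall>i\<le>m. projective R (I i)" by blast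
  have "m < 2 * r"
    using selfinjective_if_long_dominant[OF m(2)] m(3) assms by (meson le_trans not_less)
  then show "n \<le> enat (2 * r)" using m(1) by simp
qed

end

section \<open>The group \<open>K\<^sub>0\<close> and the syzygy map\<close>

text \<open>
  Preimages of independent elements are independent.
\<close>

lemma subgroup_rank_hom_image:
  assumes "comm_group G" "f \<in> hom G G" "H \<subseteq> carrier G"
  shows "subgroup_rank G (f ` H) \<le> subgroup_rank G H"
proof -
  interpret G: comm_group G by fact
  interpret f: group_hom G G f by (simp add: group_hom_def group_hom_axioms_def assms(2) G.is_group)
  have fp: "f (\<Otimes>\<^bsub>G\<^esub>x\<in>A. g x) = (\<Otimes>\<^bsub>G\<^esub>x\<in>A. f (g x))" if "finite A" "g \<in> A \<rightarrow> carrier G" for A and g :: "'a \<Rightarrow> 'a"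
    using that
  proof (induction A)
    case (insert x A)
    then have "(\<Otimes>\<^bsub>G\<^esub>y\<in>A. g y) \<in> carrier G" by (intro G.finprod_closed) auto
    then show ?case using insert by (simp add: Pi_iff)
  qed simp
  show ?thesis
    unfolding subgroup_rank_def
  proof (rule Sup_least)
    fix n assume "n \<in> {enat (card S) | S. S \<subseteq> f ` H \<and> int_independent G S}"
    then obtain S where S: "n = enat (card S)" "S \<subseteq> f ` H" "int_independent G S" by blast
    then have "\<forall>y\<in>S. \<exists>x\<in>H. f x = y" by blast
    then obtain g where g: "\<And>y. y \<in> S \<Longrightarrow> g y \<in> H" "\<And>y. y \<in> S \<Longrightarrow> f (g y) = y" by metis
    have fin: "finite S" and SG: "S \<subseteq> carrier G" using S(3) by (auto simp: int_independent_def)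
    have inj: "inj_on g S" using g(2) by (rule inj_on_inverseI)
    have gG: "g ` S \<subseteq> carrier G" using g(1) assms(3) by auto
    have "int_independent G (g ` S)"
      unfolding int_independent_def
    proof (intro conjI allI impI ballI)
      fix k :: "'a \<Rightarrow> int" and x
      assume k: "(\<Otimes>\<^bsub>G\<^esub>x\<in>g ` S. x [^]\<^bsub>G\<^esub> k x) = \<one>\<^bsub>G\<^esub>" and x: "x \<in> g ` S"
      have "\<one>\<^bsub>G\<^esub> = f (\<Otimes>\<^bsub>G\<^esub>x\<in>g ` S. x [^]\<^bsub>G\<^esub> k x)" unfolding k by simp
      also have "\<dots> = (\<Otimes>\<^bsub>G\<^esub>x\<in>g ` S. f (x [^]\<^bsub>G\<^esub> k x))"
        by (rule fp) (use fin gG in auto)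
      also have "\<dots> = (\<Otimes>\<^bsub>G\<^esub>y\<in>S. f (g y [^]\<^bsub>G\<^esub> k (g y)))"
        by (rule G.finprod_reindex[OF _ inj]) (use gG in auto)
      also have "\<dots> = (\<Otimes>\<^bsub>G\<^esub>y\<in>S. y [^]\<^bsub>G\<^esub> k (g y))"
      proof (rule G.finprod_cong')
        fix y assume y: "y \<in> S"
        then show "f (g y [^]\<^bsub>G\<^esub> k (g y)) = y [^]\<^bsub>G\<^esub> k (g y)"
          using f.hom_int_pow[of "g y" "k (g y)"] gG g(2)[OF y] by auto
      qed (use SG in auto)
      finally have "\<forall>y\<in>S. k (g y) = 0"
        using S(3)[unfolded int_independent_def, THEN conjunct2, THEN conjunct2, rule_format, of "\<lambda>y. k (g y)"]
        by auto
      then show "k x = 0" using x by auto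
    qed (use fin gG in auto)
    then have "enat (card (g ` S)) \<in> {enat (card S) | S. S \<subseteq> H \<and> int_independent G S}"
      using g(1) by blast
    then show "n \<le> Sup {enat (card S) | S. S \<subseteq> H \<and> int_independent G S}"
      unfolding S(1) card_image[OF inj, symmetric] by (rule Sup_upper)
  qed
qed

abbreviation K0_free :: "('a, 'r) ring_scheme \<Rightarrow> ('a fmod \<Rightarrow>\<^sub>0 int) monoid" where
  "K0_free R \<equiv> free_Abelian_group (fmods R)"

lemma K0_relations_subgroup: "subgroup (K0_relations R) (K0_free R)"
  unfolding K0_relations_def
proof (rule group.generate_is_subgroup[OF group_free_Abelian_group])
  have "Poly_Mapping.keys (frag_of A1 - (frag_of A2 + frag_of A3)) \<subseteq> fmods R"
    if "A1 \<in> fmods R" "A2 \<in> fmods R" "A3 \<in> fmods R" for A1 A2 A3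
    using that keys_diff[of "frag_of A1" "frag_of A2 + frag_of A3"] keys_add[of "frag_of A2" "frag_of A3"]
    by (auto simp: keys_frag_of)
  then show "{frag_of A1 - (frag_of A2 + frag_of A3) | A1 A2 A3.
         A1 \<in> fmods R \<and> A2 \<in> fmods R \<and> A3 \<in> fmods R \<and> lmod_iso R A1 (direct_sum A2 A3)} \<union>
      {frag_of P | P. P \<in> fmods R \<and> projective R P} \<subseteq> carrier (K0_free R)"
    by (auto simp: keys_frag_of)
qed

lemma K0_relations_keys: "h \<in> K0_relations R \<Longrightarrow> Poly_Mapping.keys h \<subseteq> fmods R"
  using subsetD[OF subgroup.subset[OF K0_relations_subgroup], of h R] by simp

lemma K0_relations_zero: "0 \<in> K0_relations R"
  using subgroup.one_closed[OF K0_relations_subgroup] by simp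

lemma K0_relations_add: "g \<in> K0_relations R \<Longrightarrow> h \<in> K0_relations R \<Longrightarrow> g + h \<in> K0_relations R"
  using subgroup.m_closed[OF K0_relations_subgroup] by simp

lemma K0_relations_minus: "h \<in> K0_relations R \<Longrightarrow> - h \<in> K0_relations R"
  using subgroup.m_inv_closed[OF K0_relations_subgroup, of h R] K0_relations_keys[of h R] by simp

lemma K0_relations_diff: "g \<in> K0_relations R \<Longrightarrow> h \<in> K0_relations R \<Longrightarrow> g - h \<in> K0_relations R"
  using K0_relations_add[of g R "- h"] K0_relations_minus[of h R] by simp

lemma K0_relations_sum: "(\<And>i. i \<in> I \<Longrightarrow> g i \<in> K0_relations R) \<Longrightarrow> sum g I \<in> K0_relations R"
  by (induction I rule: infinite_finite_induct) (auto simp: K0_relations_zero K0_relations_add)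

lemma K0_relations_direct_sum:
  "A1 \<in> fmods R \<Longrightarrow> A2 \<in> fmods R \<Longrightarrow> A3 \<in> fmods R \<Longrightarrow> lmod_iso R A1 (direct_sum A2 A3) \<Longrightarrow>
    frag_of A1 - (frag_of A2 + frag_of A3) \<in> K0_relations R"
  unfolding K0_relations_def by (rule generate.incl) blast

lemma K0_relations_projective: "projective R P \<Longrightarrow> frag_of P \<in> K0_relations R"
  unfolding K0_relations_def using projective_fmods by (intro generate.incl) blast

text \<open>
  An isomorphism \<open>A \<cong> B\<close> is an isomorphism \<open>A \<cong> B \<oplus> 0\<close>, and the zero module is projective.
\<close>

lemma K0_relations_iso:
  assumes "A \<in> fmods R" "B \<in> fmods R" "lmod_iso R A B"
  shows "frag_of A - frag_of B \<in> K0_relations R"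
proof -
  interpret B: left_module R B using assms(2) by (rule fmods_left_module)
  let ?Z = "B\<lparr>carrier := {\<zero>\<^bsub>B\<^esub>}\<rparr>"
  interpret Z: left_module R ?Z by (rule B.left_module_submodule[OF B.submodule_zero])
  have pZ: "projective R ?Z"
    by (rule projective_zero_module[OF Z.left_module_axioms]) (simp add: zero_module_def)
  have "lmod_iso R B (direct_sum B ?Z)"
    unfolding lmod_iso_def
    by (rule bexI[of _ "\<lambda>x. (x, \<zero>\<^bsub>B\<^esub>)"])
      (auto simp: bij_betw_def inj_on_def lhom_def B.smult_r_null)
  then have "lmod_iso R A (direct_sum B ?Z)" by (rule lmod_iso_trans[OF assms(3)])
  then have "frag_of A - (frag_of B + frag_of ?Z) \<in> K0_relations R"
    by (intro K0_relations_direct_sum assms projective_fmods[OF pZ])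
  from K0_relations_add[OF this K0_relations_projective[OF pZ]] show ?thesis by (simp add: algebra_simps)
qed

lemma K0_coset_eq: "K0_coset R g = {h + g | h. h \<in> K0_relations R}"
  by (auto simp: K0_coset_def r_coset_def)

lemma K0_coset_mem: "g \<in> K0_coset R g"
  using K0_relations_zero[of R] by (auto simp: K0_coset_eq intro!: exI[of _ 0])

lemma K0_coset_eqI: "g - h \<in> K0_relations R \<Longrightarrow> K0_coset R g = K0_coset R h"
proof -
  assume gh: "g - h \<in> K0_relations R"
  have "\<exists>k'. k + g = k' + h \<and> k' \<in> K0_relations R" if "k \<in> K0_relations R" for k
    using K0_relations_add[OF that gh] by (intro exI[of _ "k + (g - h)"]) simp
  moreover have "\<exists>k'. k + h = k' + g \<and> k' \<in> K0_relations R" if "k \<in> K0_relations R" for k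
    using K0_relations_diff[OF that gh] by (intro exI[of _ "k - (g - h)"]) simp
  ultimately show ?thesis unfolding K0_coset_eq by blast
qed

lemma comm_group_K0: "comm_group (K0 R)"
  unfolding K0_def by (rule comm_group.abelian_FactGroup[OF abelian_free_Abelian_group K0_relations_subgroup])

lemma carrier_K0: "carrier (K0 R) = {K0_coset R g | g. Poly_Mapping.keys g \<subseteq> fmods R}"
  unfolding K0_def carrier_FactGroup K0_coset_def by auto

lemma mult_K0:
  assumes "Poly_Mapping.keys g \<subseteq> fmods R" "Poly_Mapping.keys h \<subseteq> fmods R"
  shows "K0_coset R g \<otimes>\<^bsub>K0 R\<^esub> K0_coset R h = K0_coset R (g + h)"
proof -
  have "K0_relations R \<lhd> K0_free R"
    by (rule comm_group.subgroup_imp_normal[OF abelian_free_Abelian_group K0_relations_subgroup])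
  from normal.rcos_sum[OF this, of g h] show ?thesis using assms by (simp add: K0_def K0_coset_def)
qed

context cyclic_nakayama
begin

lemma syzygy_decomp:
  assumes "M \<in> fmods R" "decomp M I x a l"
  shows "syzygy R M \<in> fmods R"
    "\<exists>y. decomp (syzygy R M) {i \<in> I. l i < c (a i)} y (\<lambda>i. a i + int (l i)) (\<lambda>i. c (a i) - l i)"
proof -
  have M: "left_module R M" using assms(1) by (rule fmods_left_module)
  obtain P p y where P: "projective_cover R M P p" "projective R P"
    "decomp (P\<lparr>carrier := a_kernel P M p\<rparr>) {i \<in> I. l i < c (a i)} y (\<lambda>i. a i + int (l i)) (\<lambda>i. c (a i) - l i)"
    using ex_cover_decomp[OF M assms(2)] by blast
  let ?K = "P\<lparr>carrier := a_kernel P M p\<rparr>"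
  have "\<exists>K P p. projective_cover R M P p \<and> K = P\<lparr>carrier := a_kernel P M p\<rparr>" using P(1) by blast
  then have "\<exists>P p. projective_cover R M P p \<and> syzygy R M = P\<lparr>carrier := a_kernel P M p\<rparr>"
    unfolding syzygy_def by (rule someI_ex)
  then obtain P' p' where P': "projective_cover R M P' p'" "syzygy R M = P'\<lparr>carrier := a_kernel P' M p'\<rparr>"
    by blast
  have K: "left_module R ?K"
    by (rule left_module_kernel[OF projective_left_module[OF P(2)] M projective_coverD(2)[OF P(1)]])
  have S: "left_module R (syzygy R M)"
    unfolding P'(2) by (rule left_module_kernel[OF projective_left_module[OF projective_coverD(1)[OF P'(1)]] M
          projective_coverD(2)[OF P'(1)]])
  have "lmod_iso R ?K (syzygy R M)"
    unfolding P'(2) by (rule projective_cover_unique[OF assms(1) P(1) P'(1)])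
  then show ex: "\<exists>y. decomp (syzygy R M) {i \<in> I. l i < c (a i)} y (\<lambda>i. a i + int (l i)) (\<lambda>i. c (a i) - l i)"
    by (rule decomp_lmod_iso[OF K S _ P(3)])
  then show "syzygy R M \<in> fmods R" using decomp_fg[OF S] by (auto simp: fmods_iff)
qed

lemma syzygy_fmods: "M \<in> fmods R \<Longrightarrow> syzygy R M \<in> fmods R"
  using exists_decomp[of M] syzygy_decomp(1) by (metis fmods_iff)

lemma decomp_subset:
  assumes "left_module R M" "decomp M I x a l" "J \<subseteq> I"
  shows "decomp (M\<lparr>carrier := lspan R M J x\<rparr>) J x a l" "submodule (lspan R M J x) R M"
proof -
  interpret M: left_module R M by fact
  note d = decompD[OF assms(2)]
  have J: "finite J" "x \<in> J \<rightarrow> carrier M" using d(1,6) assms(3) finite_subset by auto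
  show sub: "submodule (lspan R M J x) R M" by (rule M.submodule_lspan[OF J])
  let ?U = "M\<lparr>carrier := lspan R M J x\<rparr>"
  have xU: "x \<in> J \<rightarrow> lspan R M J x" using M.lspan_gen[OF J] by auto
  note lc = M.lincomb_submodule(1)[OF sub J(1) _ xU]
  have h: "homogeneous ?U (x i) (a i) (l i)" "l i > 0" if "i \<in> J" for i
    using d(2,3)[of i] that assms(3) xU by (auto simp: homogeneous_def)
  have sp: "carrier ?U \<subseteq> lspan R ?U J x"
  proof
    fix m assume "m \<in> carrier ?U"
    then obtain v where "v \<in> J \<rightarrow> carrier R" "m = lincomb M J v x" by (auto simp: lspan_def)
    then show "m \<in> lspan R ?U J x"
      unfolding lspan_def[of R ?U] by (intro CollectI exI[of _ v]) (simp add: lc)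
  qed
  have ind: "v i \<odot>\<^bsub>?U\<^esub> x i = \<zero>\<^bsub>?U\<^esub>"
    if v: "v \<in> J \<rightarrow> carrier R" "lincomb ?U J v x = \<zero>\<^bsub>?U\<^esub>" "i \<in> J" for v i
  proof -
    let ?v = "\<lambda>i. if i \<in> J then v i else \<zero>"
    have v': "?v \<in> I \<rightarrow> carrier R" using v(1) by auto
    have "lincomb M I ?v x = \<zero>\<^bsub>M\<^esub>"
      using M.lincomb_extend[OF d(1) assms(3) v(1) d(6)] lc[OF v(1)] v(2) by simp
    then have "?v i \<odot>\<^bsub>M\<^esub> x i = \<zero>\<^bsub>M\<^esub>" by (rule d(5)[OF v']) (use v(3) assms(3) in auto)
    then show ?thesis using v(3) by simp
  qed
  show "decomp ?U J x a l" unfolding decomp_def using J(1) h sp ind by auto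
qed

lemma decomp_split:
  assumes "left_module R M" "decomp M (I \<union> J) x a l" "I \<inter> J = {}"
  shows "lmod_iso R M (direct_sum (M\<lparr>carrier := lspan R M I x\<rparr>) (M\<lparr>carrier := lspan R M J x\<rparr>))"
proof (rule lmod_iso_internal_sum[OF assms(1)])
  interpret M: left_module R M by fact
  note d = decompD[OF assms(2)]
  have fin: "finite I" "finite J" using d(1) by auto
  show I: "submodule (lspan R M I x) R M" and J: "submodule (lspan R M J x) R M"
    using decomp_subset(2)[OF assms(1,2)] by auto
  show "\<exists>u\<in>lspan R M I x. \<exists>v\<in>lspan R M J x. m = u \<oplus>\<^bsub>M\<^esub> v" if m: "m \<in> carrier M" for m
  proof -
    obtain v where v: "v \<in> I \<union> J \<rightarrow> carrier R" "m = lincomb M (I \<union> J) v x" using d(4)[OF m] by blast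
    have "m = lincomb M I v x \<oplus>\<^bsub>M\<^esub> lincomb M J v x"
      unfolding v(2) by (rule M.lincomb_Un[OF fin assms(3) v(1) d(6)])
    moreover have "v \<in> I \<rightarrow> carrier R" "v \<in> J \<rightarrow> carrier R" using v(1) by auto
    ultimately show ?thesis unfolding lspan_def by blast
  qed
  show "lspan R M I x \<inter> lspan R M J x = {\<zero>\<^bsub>M\<^esub>}"
  proof
    show "{\<zero>\<^bsub>M\<^esub>} \<subseteq> lspan R M I x \<inter> lspan R M J x"
      using M.submoduleD(2)[OF I] M.submoduleD(2)[OF J] by simp
    show "lspan R M I x \<inter> lspan R M J x \<subseteq> {\<zero>\<^bsub>M\<^esub>}"
    proof
      fix m assume "m \<in> lspan R M I x \<inter> lspan R M J x"
      then obtain v w where v: "v \<in> I \<rightarrow> carrier R" "m = lincomb M I v x"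
        and w: "w \<in> J \<rightarrow> carrier R" "m = lincomb M J w x" by (auto simp: lspan_def)
      let ?u = "\<lambda>i. if i \<in> I then v i else \<ominus> w i"
      have u: "?u \<in> I \<union> J \<rightarrow> carrier R" using v(1) w(1) by (auto simp: Pi_iff)
      have xI: "x \<in> I \<rightarrow> carrier M" and xJ: "x \<in> J \<rightarrow> carrier M" using d(6) by auto
      have m: "m \<in> carrier M" unfolding v(2) by (rule M.lincomb_closed[OF v(1) xI])
      have 1: "lincomb M I ?u x = m" unfolding v(2) using v(1) xI by (intro M.lincomb_cong) auto
      have "lincomb M J ?u x = lincomb M J (\<lambda>i. (\<ominus> \<one>) \<otimes> w i) x"
      proof (rule M.lincomb_cong)
        fix i assume i: "i \<in> J"
        then have "i \<notin> I" "w i \<in> carrier R" using assms(3) w(1) by auto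
        then show "?u i \<odot>\<^bsub>M\<^esub> x i = ((\<ominus> \<one>) \<otimes> w i) \<odot>\<^bsub>M\<^esub> x i" by (simp add: l_minus)
      qed (use w(1) xJ in auto)
      also have "\<dots> = (\<ominus> \<one>) \<odot>\<^bsub>M\<^esub> m"
        unfolding w(2) by (rule M.lincomb_smult[symmetric, OF fin(2) _ w(1) xJ]) simp
      finally have 2: "lincomb M J ?u x = \<ominus>\<^bsub>M\<^esub> m" using m by (simp add: M.smult_minus_one)
      have "lincomb M (I \<union> J) ?u x = \<zero>\<^bsub>M\<^esub>"
        using M.lincomb_Un[OF fin assms(3) u d(6)] 1 2 m by (simp add: M.M.r_neg)
      then have "?u i \<odot>\<^bsub>M\<^esub> x i = \<zero>\<^bsub>M\<^esub>" if "i \<in> I" for i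
        by (rule d(5)[OF u]) (use that in simp)
      then have "m = \<zero>\<^bsub>M\<^esub>" unfolding 1[symmetric] by (rule M.lincomb_zero)
      then show "m \<in> {\<zero>\<^bsub>M\<^esub>}" by simp
    qed
  qed
qed

definition uniserial :: "'a fmod \<Rightarrow> int \<Rightarrow> nat \<Rightarrow> bool" where
  "uniserial U a l \<longleftrightarrow> U \<in> fmods R \<and> (\<exists>x. decomp U {()} x (\<lambda>_. a) (\<lambda>_. l))"

text \<open>
  The class of the uniserial module of degree \<open>a\<close> and length \<open>l\<close>. It is set to zero for the zero
  module and for projective modules, whose classes vanish in \<open>K\<^sub>0\<close>. With this convention, degree
  \<open>a + l\<close> and length \<open>c a - l\<close> describe the class of the syzygy in all cases, including \<open>l = 0\<close>.
\<close>

definition uniserial_class :: "int \<Rightarrow> nat \<Rightarrow> 'a fmod \<Rightarrow>\<^sub>0 int" where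
  "uniserial_class a l = (if l = 0 \<or> l = c a then 0 else frag_of (SOME U. uniserial U a l))"

lemma uniserial_class_shift: "uniserial_class (a + int N * w) l = uniserial_class a l"
proof -
  have "uniserial U (a + int N * w) l \<longleftrightarrow> uniserial U a l" for U
    by (simp add: uniserial_def decomp_def homogeneous_def e_shift)
  then show ?thesis by (simp add: uniserial_class_def c_shift)
qed

lemma uniserial_class_eq:
  assumes "uniserial U a l"
  shows "frag_of U - uniserial_class a l \<in> K0_relations R" "0 < l" "l \<le> c a"
proof -
  obtain x where U: "U \<in> fmods R" "decomp U {()} x (\<lambda>_. a) (\<lambda>_. l)" using assms by (auto simp: uniserial_def)
  have lU: "left_module R U" using U(1) by (rule fmods_left_module)
  show l: "0 < l" "l \<le> c a" using decompD(3)[OF U(2)] homogeneous_le[OF lU decompD(2)[OF U(2)]] by auto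
  show "frag_of U - uniserial_class a l \<in> K0_relations R"
  proof (cases "l = c a")
    case True
    then have "projective R U" by (intro decomp_projective[OF lU U(2)]) simp
    then show ?thesis using True K0_relations_projective by (simp add: uniserial_class_def)
  next
    case False
    define V where "V = (SOME U. uniserial U a l)"
    have "uniserial V a l" unfolding V_def using assms by (rule someI)
    then obtain y where V: "V \<in> fmods R" "decomp V {()} y (\<lambda>_. a) (\<lambda>_. l)" by (auto simp: uniserial_def)
    have "lmod_iso R U V" by (rule decomp_iso[OF lU U(2) fmods_left_module[OF V(1)] V(2)]) simp
    then have "frag_of U - frag_of V \<in> K0_relations R" by (rule K0_relations_iso[OF U(1) V(1)])
    then show ?thesis using False l by (simp add: uniserial_class_def V_def)
  qed
qed

lemma decomp_uniserial:
  assumes "M \<in> fmods R" "decomp M I x a l" "i \<in> I"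
  shows "uniserial (M\<lparr>carrier := lspan R M {i} x\<rparr>) (a i) (l i)"
proof -
  have M: "left_module R M" using assms(1) by (rule fmods_left_module)
  let ?U = "M\<lparr>carrier := lspan R M {i} x\<rparr>"
  have d: "decomp ?U {i} x a l" and s: "submodule (lspan R M {i} x) R M"
    using decomp_subset[OF M assms(2), of "{i}"] assms(3) by auto
  have U: "left_module R ?U" by (rule left_module.left_module_submodule[OF M s])
  have "decomp ?U {()} (\<lambda>_. x i) (\<lambda>_. a i) (\<lambda>_. l i)"
    by (rule decomp_reindex[OF U d]) (simp add: bij_betw_def)
  then show ?thesis using decomp_fg[OF U d] by (auto simp: uniserial_def fmods_iff)
qed

lemma decomp_class:
  assumes "M \<in> fmods R" "decomp M I x a l"
  shows "frag_of M - (\<Sum>i\<in>I. uniserial_class (a i) (l i)) \<in> K0_relations R"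
proof -
  have "finite I" using decompD(1)[OF assms(2)] .
  then show ?thesis
    using assms
  proof (induction I arbitrary: M)
    case empty
    then have "left_module R M" by (simp add: fmods_left_module)
    from decomp_projective[OF this empty(2)] show ?case by (simp add: K0_relations_projective)
  next
    case (insert i I)
    have M: "left_module R M" using insert.prems(1) by (rule fmods_left_module)
    have d: "decomp M (I \<union> {i}) x a l" using insert.prems(2) by simp
    let ?A = "M\<lparr>carrier := lspan R M I x\<rparr>" and ?B = "M\<lparr>carrier := lspan R M {i} x\<rparr>"
    have A: "decomp ?A I x a l" "submodule (lspan R M I x) R M" using decomp_subset[OF M d] by auto
    have B: "uniserial ?B (a i) (l i)" by (rule decomp_uniserial[OF insert.prems]) simp
    have AF: "?A \<in> fmods R"
      using decomp_fg[OF left_module.left_module_submodule[OF M A(2)] A(1)] by (simp add: fmods_iff)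
    have BF: "?B \<in> fmods R" using B by (simp add: uniserial_def)
    have "lmod_iso R M (direct_sum ?A ?B)" by (rule decomp_split[OF M d]) (use insert.hyps in simp)
    then have "frag_of M - (frag_of ?A + frag_of ?B) \<in> K0_relations R"
      by (rule K0_relations_direct_sum[OF insert.prems(1) AF BF])
    from K0_relations_add[OF K0_relations_add[OF this insert.IH[OF AF A(1)]] uniserial_class_eq(1)[OF B]]
    show ?case using insert.hyps by (simp add: algebra_simps)
  qed
qed

text \<open>
  The additive extension of the syzygy to the free abelian group, from which \<^const>\<open>K0_syzygy\<close> is made.
\<close>

definition syz_ext :: "('a fmod \<Rightarrow>\<^sub>0 int) \<Rightarrow> ('a fmod \<Rightarrow>\<^sub>0 int)" where
  "syz_ext = frag_extend (\<lambda>M. frag_of (syzygy R M))"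

lemma syz_ext_of: "syz_ext (frag_of M) = frag_of (syzygy R M)"
  and syz_ext_0: "syz_ext 0 = 0"
  and syz_ext_add: "syz_ext (g + h) = syz_ext g + syz_ext h"
  and syz_ext_diff: "syz_ext (g - h) = syz_ext g - syz_ext h"
  and syz_ext_minus: "syz_ext (- g) = - syz_ext g"
  by (simp_all add: syz_ext_def frag_extend_add frag_extend_diff frag_extend_minus)

lemma syz_ext_keys: "Poly_Mapping.keys g \<subseteq> fmods R \<Longrightarrow> Poly_Mapping.keys (syz_ext g) \<subseteq> fmods R"
  using keys_frag_extend[of "\<lambda>M. frag_of (syzygy R M)" g] syzygy_fmods
  by (auto simp: syz_ext_def keys_frag_of)

text \<open>
  Any decomposition of \<open>M\<close> computes the class of the syzygy of \<open>M\<close>. For a direct sum, the union of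
  decompositions of the summands can be taken, which is why the syzygy is additive in \<open>K\<^sub>0\<close>.
\<close>

lemma syzygy_class:
  assumes "M \<in> fmods R" "decomp M I x a l"
  shows "frag_of (syzygy R M) - (\<Sum>i\<in>I. uniserial_class (a i + int (l i)) (c (a i) - l i)) \<in> K0_relations R"
proof -
  have M: "left_module R M" using assms(1) by (rule fmods_left_module)
  obtain y where y: "decomp (syzygy R M) {i \<in> I. l i < c (a i)} y (\<lambda>i. a i + int (l i)) (\<lambda>i. c (a i) - l i)"
    using syzygy_decomp(2)[OF assms] by blast
  have "(\<Sum>i\<in>{i \<in> I. l i < c (a i)}. uniserial_class (a i + int (l i)) (c (a i) - l i))
      = (\<Sum>i\<in>I. uniserial_class (a i + int (l i)) (c (a i) - l i))"
    using decompD(1)[OF assms(2)] by (intro sum.mono_neutral_left) (auto simp: uniserial_class_def)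
  then show ?thesis using decomp_class[OF syzygy_decomp(1)[OF assms] y] by simp
qed

lemma syz_ext_generators:
  assumes "h \<in> {frag_of A1 - (frag_of A2 + frag_of A3) | A1 A2 A3.
      A1 \<in> fmods R \<and> A2 \<in> fmods R \<and> A3 \<in> fmods R \<and> lmod_iso R A1 (direct_sum A2 A3)} \<union>
    {frag_of P | P. P \<in> fmods R \<and> projective R P}"
  shows "syz_ext h \<in> K0_relations R"
  using assms
proof (elim UnE CollectE exE conjE)
  fix P assume P: "h = frag_of P" "P \<in> fmods R" "projective R P"
  obtain I x a l where d: "decomp P (I :: nat set) x a l" using exists_decomp P(2) by (metis fmods_iff)
  have "c (a i) - l i = 0" if "i \<in> I" for i using projective_decomp[OF P(3,2) d that] by simp
  then have "(\<Sum>i\<in>I. uniserial_class (a i + int (l i)) (c (a i) - l i)) = 0"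
    by (intro sum.neutral) (auto simp: uniserial_class_def)
  then show ?thesis using syzygy_class[OF P(2) d] by (simp add: P(1) syz_ext_of)
next
  fix A1 A2 A3 assume A: "h = frag_of A1 - (frag_of A2 + frag_of A3)" "A1 \<in> fmods R" "A2 \<in> fmods R"
    "A3 \<in> fmods R" "lmod_iso R A1 (direct_sum A2 A3)"
  note lm = A(2-4)[THEN fmods_left_module]
  obtain I x a l where d2: "decomp A2 (I :: nat set) x a l" using exists_decomp A(3) by (metis fmods_iff)
  obtain J y b k where d3: "decomp A3 (J :: nat set) y b k" using exists_decomp A(4) by (metis fmods_iff)
  obtain z where d1: "decomp A1 (I <+> J) z (case_sum a b) (case_sum l k)"
    using decomp_lmod_iso[OF left_module_direct_sum[OF lm(2,3)] lm(1) lmod_iso_sym[OF lm(1) A(5)]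
        decomp_direct_sum[OF lm(2,3) d2 d3]] by blast
  have "(\<Sum>i\<in>I <+> J. uniserial_class (case_sum a b i + int (case_sum l k i)) (c (case_sum a b i) - case_sum l k i))
    = (\<Sum>i\<in>I. uniserial_class (a i + int (l i)) (c (a i) - l i))
      + (\<Sum>i\<in>J. uniserial_class (b i + int (k i)) (c (b i) - k i))"
    using decompD(1)[OF d2] decompD(1)[OF d3] by (subst sum.Plus) auto
  then have "frag_of (syzygy R A1) - (frag_of (syzygy R A2) + frag_of (syzygy R A3)) =
    (frag_of (syzygy R A1) - (\<Sum>i\<in>I <+> J. uniserial_class (case_sum a b i + int (case_sum l k i)) (c (case_sum a b i) - case_sum l k i)))
     - (frag_of (syzygy R A2) - (\<Sum>i\<in>I. uniserial_class (a i + int (l i)) (c (a i) - l i)))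
     - (frag_of (syzygy R A3) - (\<Sum>i\<in>J. uniserial_class (b i + int (k i)) (c (b i) - k i)))"
    by (simp add: algebra_simps)
  also have "\<dots> \<in> K0_relations R"
    by (intro K0_relations_diff syzygy_class[OF A(2) d1] syzygy_class[OF A(3) d2] syzygy_class[OF A(4) d3])
  finally show ?thesis by (simp add: A(1) syz_ext_of syz_ext_add syz_ext_diff)
qed

lemma syz_ext_relations:
  assumes "h \<in> K0_relations R"
  shows "syz_ext h \<in> K0_relations R"
  using assms unfolding K0_relations_def
proof (induction rule: generate.induct)
  case one
  show ?case using K0_relations_zero[of R] by (simp add: syz_ext_0 K0_relations_def)
next
  case (eng h1 h2)
  then show ?case using K0_relations_add[of "syz_ext h1" R "syz_ext h2"] by (simp add: syz_ext_add K0_relations_def)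
next
  case (incl h)
  from syz_ext_generators[OF this] show ?case by (simp add: K0_relations_def)
next
  case (inv h)
  have "h \<in> K0_relations R" unfolding K0_relations_def using inv by (rule generate.incl)
  then have "inv\<^bsub>K0_free R\<^esub> h = - h" using K0_relations_keys[of h R] by simp
  then show ?case
    using K0_relations_minus[OF syz_ext_generators[OF inv]] by (simp add: syz_ext_minus K0_relations_def)
qed

end

context cyclic_nakayama_ends
begin

lemma syz_ext_iter_diff: "(syz_ext ^^ n) (g - h) = (syz_ext ^^ n) g - (syz_ext ^^ n) h"
  by (induction n) (simp_all add: syz_ext_diff)

lemma syz_ext_iter_sum: "(syz_ext ^^ n) (sum g I) = (\<Sum>i\<in>I. (syz_ext ^^ n) (g i))"
proof -
  have "(syz_ext ^^ n) 0 = 0" "(syz_ext ^^ n) (g + h) = (syz_ext ^^ n) g + (syz_ext ^^ n) h" for g h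
    by (induction n) (simp_all add: syz_ext_0 syz_ext_add)
  then show ?thesis by (induction I rule: infinite_finite_induct) simp_all
qed

lemma syz_ext_iter_relations: "h \<in> K0_relations R \<Longrightarrow> (syz_ext ^^ n) h \<in> K0_relations R"
  by (induction n) (simp_all add: syz_ext_relations)

lemma syz_ext_uniserial:
  assumes "uniserial U a l"
  shows "(syz_ext ^^ n) (uniserial_class a l)
    - uniserial_class (syz_end a (a + int l) n) (nat (syz_end a (a + int l) (Suc n) - syz_end a (a + int l) n))
    \<in> K0_relations R"
  using assms
proof (induction n arbitrary: U a l)
  case 0
  show ?case using K0_relations_zero[of R] by (simp add: syz_end_def)
next
  case (Suc n)
  let ?b = "a + int l"
  have l: "0 < l" "l \<le> c a" using uniserial_class_eq[OF Suc.prems] by auto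
  have fb: "?b + int (c a - l) = proj_end a" using l by (simp add: proj_end_def of_nat_diff)
  let ?v = "uniserial_class (syz_end a ?b (Suc n)) (nat (syz_end a ?b (Suc (Suc n)) - syz_end a ?b (Suc n)))"
  have v: "?v = uniserial_class (syz_end ?b (proj_end a) n)
      (nat (syz_end ?b (proj_end a) (Suc n) - syz_end ?b (proj_end a) n))"
    by (simp add: syz_end_Suc)
  show ?case
  proof (cases "l = c a")
    case True
    then have "proj_end a = ?b" by (simp add: proj_end_def)
    \<comment> \<open>The projective module \<open>U\<close> has class zero, and all later lengths are zero or those of projective modules.\<close>
    then have "syz_end ?b (proj_end a) (Suc n) - syz_end ?b (proj_end a) n = 0 \<or>
      syz_end ?b (proj_end a) (Suc n) = proj_end (syz_end ?b (proj_end a) n)"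
      by (cases "even n") (auto simp: syz_end_def elim!: oddE)
    then have "?v = 0" unfolding v by (auto simp: uniserial_class_def proj_end_def)
    moreover have "(syz_ext ^^ Suc n) (uniserial_class a l) = 0"
      using True by (induction n) (simp_all add: uniserial_class_def syz_ext_0)
    ultimately show ?thesis using K0_relations_zero[of R] by simp
  next
    case False
    then have lc: "l < c a" using l by simp
    obtain x where U: "U \<in> fmods R" "decomp U {()} x (\<lambda>_. a) (\<lambda>_. l)" using Suc.prems by (auto simp: uniserial_def)
    have S: "uniserial (syzygy R U) ?b (c a - l)"
    proof -
      have "{i \<in> {()}. l < c a} = {()}" using lc by auto
      then show ?thesis using syzygy_decomp[OF U] unfolding uniserial_def by (simp only:)
    qed
    have 1: "syz_ext (uniserial_class a l) - uniserial_class ?b (c a - l) \<in> K0_relations R"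
    proof -
      have "syz_ext (frag_of U - uniserial_class a l) \<in> K0_relations R"
        by (rule syz_ext_relations[OF uniserial_class_eq(1)[OF Suc.prems]])
      from K0_relations_diff[OF uniserial_class_eq(1)[OF S] this]
      show ?thesis by (simp add: syz_ext_diff syz_ext_of)
    qed
    have 2: "(syz_ext ^^ n) (uniserial_class ?b (c a - l)) - ?v \<in> K0_relations R"
      using Suc.IH[OF S] unfolding fb v .
    from K0_relations_add[OF syz_ext_iter_relations[OF 1, of n] 2]
    show ?thesis by (simp add: syz_ext_iter_diff funpow_swap1)
  qed
qed

text \<open>
  The ends of the \<open>(2 r)\<close>-th syzygies are stable, so a power of \<^term>\<open>proj_end\<close> acts on them as a
  translation by a multiple of \<open>N\<close>, which does not change the modules.
\<close>

lemma syz_ext_periodic: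
  "\<exists>q>0. \<forall>g. Poly_Mapping.keys g \<subseteq> fmods R \<longrightarrow>
    (syz_ext ^^ (2 * r + q)) g - (syz_ext ^^ (2 * r)) g \<in> K0_relations R"
proof -
  obtain p w where p: "p > 0" "\<And>x. x \<in> stable \<Longrightarrow> (proj_end ^^ p) x = x + int N * w"
    using proj_end_period by blast
  have per: "syz_end a b (2 * r + 2 * p) = syz_end a b (2 * r) + int N * w"
    "syz_end a b (Suc (2 * r + 2 * p)) = syz_end a b (Suc (2 * r)) + int N * w" for a b
  proof -
    have *: "(proj_end ^^ (r + p)) x = (proj_end ^^ r) x + int N * w" for x
      using p(2)[of "(proj_end ^^ r) x"] by (simp add: stable_def add.commute[of r] funpow_add)
    show "syz_end a b (2 * r + 2 * p) = syz_end a b (2 * r) + int N * w"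
      "syz_end a b (Suc (2 * r + 2 * p)) = syz_end a b (Suc (2 * r)) + int N * w"
      by (simp_all add: syz_end_def *)
  qed
  have uni: "(syz_ext ^^ (2 * r + 2 * p)) (uniserial_class a l) - (syz_ext ^^ (2 * r)) (uniserial_class a l)
      \<in> K0_relations R" if U: "uniserial U a l" for U a l
    using K0_relations_diff[OF syz_ext_uniserial[OF U, of "2 * r + 2 * p"] syz_ext_uniserial[OF U, of "2 * r"]]
    by (simp add: per uniserial_class_shift)
  have "(syz_ext ^^ (2 * r + 2 * p)) g - (syz_ext ^^ (2 * r)) g \<in> K0_relations R"
    if "Poly_Mapping.keys g \<subseteq> fmods R" for g
    using that
  proof (induction g rule: frag_induction)
    case zero
    show ?case using K0_relations_zero[of R] syz_ext_iter_sum[of _ _ "{}"] by simp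
  next
    case (diff g h)
    from K0_relations_diff[OF diff] show ?case by (simp add: syz_ext_iter_diff algebra_simps)
  next
    case (one M)
    obtain I x a l where d: "decomp M (I :: nat set) x a l" using exists_decomp one by (metis fmods_iff)
    let ?s = "\<Sum>i\<in>I. uniserial_class (a i) (l i)"
    have m: "frag_of M - ?s \<in> K0_relations R" by (rule decomp_class[OF one d])
    have "(\<Sum>i\<in>I. (syz_ext ^^ (2 * r + 2 * p)) (uniserial_class (a i) (l i))
        - (syz_ext ^^ (2 * r)) (uniserial_class (a i) (l i))) \<in> K0_relations R"
      by (intro K0_relations_sum uni[OF decomp_uniserial[OF one d]])
    then have s: "(syz_ext ^^ (2 * r + 2 * p)) ?s - (syz_ext ^^ (2 * r)) ?s \<in> K0_relations R"
      by (simp add: syz_ext_iter_sum sum_subtractf)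
    from K0_relations_add[OF K0_relations_diff[OF syz_ext_iter_relations[OF m, of "2 * r + 2 * p"]
          syz_ext_iter_relations[OF m, of "2 * r"]] s]
    show ?case by (simp add: syz_ext_iter_diff algebra_simps)
  qed
  then show ?thesis using p(1) by (intro exI[of _ "2 * p"]) simp
qed

lemma K0_syzygy_coset: "K0_syzygy R (K0_coset R g) = K0_coset R (syz_ext g)"
proof -
  have "K0_coset R (syz_ext h) = K0_coset R (syz_ext g)" if "h \<in> K0_coset R g" for h
  proof (rule K0_coset_eqI)
    obtain k where "k \<in> K0_relations R" "h = k + g" using \<open>h \<in> K0_coset R g\<close> by (auto simp: K0_coset_eq)
    then show "syz_ext h - syz_ext g \<in> K0_relations R" by (simp add: syz_ext_add syz_ext_relations)
  qed
  then have "K0_syzygy R (K0_coset R g) = (\<Union>h\<in>K0_coset R g. K0_coset R (syz_ext g))"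
    unfolding K0_syzygy_def syz_ext_def by (intro SUP_cong) auto
  moreover have "K0_coset R g \<noteq> {}" using K0_coset_mem[of g R] by blast
  ultimately show ?thesis by simp
qed

lemma K0_syzygy_iter_coset: "(K0_syzygy R ^^ n) (K0_coset R g) = K0_coset R ((syz_ext ^^ n) g)"
  by (induction n) (simp_all add: K0_syzygy_coset)

lemma K0_syzygy_hom: "K0_syzygy R \<in> hom (K0 R) (K0 R)"
proof (rule homI)
  fix x assume "x \<in> carrier (K0 R)"
  then obtain g where "x = K0_coset R g" "Poly_Mapping.keys g \<subseteq> fmods R" by (auto simp: carrier_K0)
  then show "K0_syzygy R x \<in> carrier (K0 R)"
    using syz_ext_keys[of g] unfolding carrier_K0 by (intro CollectI exI[of _ "syz_ext g"]) (simp add: K0_syzygy_coset)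
next
  fix x y assume "x \<in> carrier (K0 R)" "y \<in> carrier (K0 R)"
  then obtain g h where "x = K0_coset R g" "Poly_Mapping.keys g \<subseteq> fmods R"
    "y = K0_coset R h" "Poly_Mapping.keys h \<subseteq> fmods R" by (auto simp: carrier_K0)
  then show "K0_syzygy R (x \<otimes>\<^bsub>K0 R\<^esub> y) = K0_syzygy R x \<otimes>\<^bsub>K0 R\<^esub> K0_syzygy R y"
    using syz_ext_keys by (simp add: mult_K0 K0_syzygy_coset syz_ext_add)
qed

lemma K0_add_carrier: "K0_add R M \<subseteq> carrier (K0 R)"
proof -
  have "K0_class R ` indec_summands R M \<subseteq> carrier (K0 R)"
    by (auto simp: carrier_K0 K0_class_def indec_summands_def indecomposable_def keys_frag_of
        intro!: exI[of _ "frag_of V" for V])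
  then show ?thesis
    unfolding K0_add_def by (rule group.generate_incl[OF comm_group.axioms(2)[OF comm_group_K0]])
qed

lemma K0_syzygy_periodic:
  "\<exists>q>0. \<forall>H \<subseteq> carrier (K0 R). (K0_syzygy R ^^ (2 * r + q)) ` H = (K0_syzygy R ^^ (2 * r)) ` H"
proof -
  obtain q where q: "q > 0" "\<And>g. Poly_Mapping.keys g \<subseteq> fmods R \<Longrightarrow>
    (syz_ext ^^ (2 * r + q)) g - (syz_ext ^^ (2 * r)) g \<in> K0_relations R" using syz_ext_periodic by blast
  have "(K0_syzygy R ^^ (2 * r + q)) x = (K0_syzygy R ^^ (2 * r)) x" if "x \<in> carrier (K0 R)" for x
    using that K0_coset_eqI[OF q(2)] by (auto simp: carrier_K0 K0_syzygy_iter_coset)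
  then show ?thesis using q(1) by (intro exI[of _ q]) (auto intro!: image_cong)
qed

text \<open>
  The ranks of the iterated images are weakly decreasing, and they are periodic from \<open>2 r\<close> on.
\<close>

lemma phi_bound: "phi R M \<le> 2 * r"
proof -
  let ?H = "K0_add R M" and ?L = "K0_syzygy R"
  let ?rk = "\<lambda>t. subgroup_rank (K0 R) ((?L ^^ t) ` ?H)"
  have HK: "(?L ^^ t) ` ?H \<subseteq> carrier (K0 R)" for t
    using K0_add_carrier[of M] K0_syzygy_hom by (induction t) (auto simp: hom_def)
  have step: "?rk (Suc t) \<le> ?rk t" for t
    using subgroup_rank_hom_image[OF comm_group_K0 K0_syzygy_hom HK[of t]] by (simp add: image_comp comp_def)
  have anti: "?rk (t + j) \<le> ?rk t" for t j
    by (induction j) (use step order_trans in \<open>auto\<close>)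
  obtain q where q: "q > 0" "\<And>H. H \<subseteq> carrier (K0 R) \<Longrightarrow> (?L ^^ (2 * r + q)) ` H = (?L ^^ (2 * r)) ` H"
    using K0_syzygy_periodic by blast
  have per: "?rk (2 * r + q * j) = ?rk (2 * r)" for j
  proof (induction j)
    case (Suc j)
    have "(?L ^^ (2 * r + q * Suc j)) ` ?H = (?L ^^ (2 * r + q)) ` ((?L ^^ (q * j)) ` ?H)"
      by (simp add: image_comp algebra_simps flip: funpow_add)
    also have "\<dots> = (?L ^^ (2 * r)) ` ((?L ^^ (q * j)) ` ?H)" by (rule q(2)[OF HK])
    also have "\<dots> = (?L ^^ (2 * r + q * j)) ` ?H" by (simp add: image_comp flip: funpow_add)
    finally show ?case using Suc by simp
  qed simp
  \<comment> \<open>The rank at \<open>2 r + j\<close> lies between those at \<open>2 r\<close> and at \<open>2 r + q j\<close>, which are equal.\<close>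
  have "?rk (2 * r) = ?rk (2 * r + j)" for j
  proof (rule antisym)
    have "?rk (2 * r) = ?rk (2 * r + q * j)" by (simp only: per)
    also have "\<dots> = ?rk ((2 * r + j) + (q * j - j))" using q(1) by (simp add: Suc_leI)
    also have "\<dots> \<le> ?rk (2 * r + j)" by (rule anti)
    finally show "?rk (2 * r) \<le> ?rk (2 * r + j)" .
  qed (rule anti)
  then show ?thesis unfolding phi_def by (intro Least_le) auto
qed

theorem phi_dim_bound: "phi_dim R \<le> enat (2 * r)"
  unfolding phi_dim_def by (rule Sup_least) (use phi_bound in auto)

end

section \<open>The path algebra of the cyclic quiver\<close>

text \<open>
  The integers are the vertices of the universal cover of the cyclic quiver, a line; \<open>vertex\<close> is the
  projection to the cyclic quiver, with values in \<open>{1..N}\<close>. Every path is the image of a unique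
  interval up to a shift by a multiple of \<open>N\<close>.
\<close>

definition vertex :: "nat \<Rightarrow> int \<Rightarrow> nat" where
  "vertex N a = nat ((a - 1) mod int N) + 1"

definition path_from :: "nat \<Rightarrow> int \<Rightarrow> nat \<Rightarrow> (nat, nat) qpath" where
  "path_from N a n = (vertex N a, map (\<lambda>j. vertex N (a + int j)) [0..<n], vertex N (a + int n))"

locale cyclic_paths =
  fixes N :: nat
  assumes N_pos: "N > 0"
begin

lemma vertex_range: "1 \<le> vertex N a" "vertex N a \<le> N"
proof -
  show "1 \<le> vertex N a" by (simp add: vertex_def)
  have "(a - 1) mod int N < int N" using N_pos by simp
  then show "vertex N a \<le> N" using N_pos by (simp add: vertex_def nat_less_iff Suc_le_eq)
qed

lemma vertex_eq_iff: "vertex N a = vertex N b \<longleftrightarrow> int N dvd a - b"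
proof -
  have "vertex N a = vertex N b \<longleftrightarrow> (a - 1) mod int N = (b - 1) mod int N"
    using N_pos by (simp add: vertex_def nat_eq_iff)
  then show ?thesis by (simp add: mod_eq_dvd_iff)
qed

lemma vertex_of_nat: "s \<ge> 1 \<Longrightarrow> vertex N (int s) = (s - 1) mod N + 1"
  by (cases s) (simp_all add: vertex_def zmod_int[symmetric])

lemma vertex_id: "v \<in> {1..N} \<Longrightarrow> vertex N (int v) = v"
  by (subst vertex_of_nat) auto

lemma vertex_Suc: "vertex N a mod N + 1 = vertex N (a + 1)"
proof -
  have "vertex N (int (vertex N a) + 1) = vertex N a mod N + 1"
    using vertex_of_nat[of "vertex N a + 1"] by (simp add: add.commute)
  moreover have "vertex N (int (vertex N a)) = vertex N a" using vertex_range by (intro vertex_id) auto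
  then have "int N dvd int (vertex N a) - a" by (simp add: vertex_eq_iff)
  then have "vertex N (int (vertex N a) + 1) = vertex N (a + 1)" by (simp add: vertex_eq_iff)
  ultimately show ?thesis by simp
qed

lemma path_from_cong: "int N dvd a - b \<Longrightarrow> path_from N a n = path_from N b n"
  by (auto simp: path_from_def vertex_eq_iff)

lemma path_from_eq_iff: "path_from N a n = path_from N b m \<longleftrightarrow> n = m \<and> int N dvd a - b"
proof
  assume "path_from N a n = path_from N b m"
  then have "vertex N a = vertex N b" "length (map (\<lambda>j. vertex N (a + int j)) [0..<n]) = length (map (\<lambda>j. vertex N (b + int j)) [0..<m])"
    unfolding path_from_def by (metis prod.inject)+
  then show "n = m \<and> int N dvd a - b" by (simp add: vertex_eq_iff)
qed (auto intro: path_from_cong)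

lemma path_from_shift: "path_from N (a + int N * w) n = path_from N a n"
  by (rule path_from_cong) simp

lemma cas_cyclic: "pre_digraph.cas (cyclic_quiver N) u p v \<longleftrightarrow>
    p = map (\<lambda>j. vertex N (int u + int j)) [0..<length p] \<and> v = vertex N (int u + int (length p))"
  if "u \<in> {1..N}" "set p \<subseteq> {1..N}"
  using that
proof (induction p arbitrary: u)
  case Nil
  then show ?case using vertex_id[of u] by (auto simp: pre_digraph.cas.simps)
next
  case (Cons x p)
  let ?u = "u mod N + 1"
  have u: "vertex N (int u) = u" using Cons.prems by (intro vertex_id) auto
  have u': "?u = vertex N (int u + 1)" using vertex_Suc[of "int u"] u by simp
  have "?u \<in> {1..N}" using u' vertex_range[of "int u + 1"] by simp
  then have IH: "pre_digraph.cas (cyclic_quiver N) ?u p v \<longleftrightarrow>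
      p = map (\<lambda>j. vertex N (int ?u + int j)) [0..<length p] \<and> v = vertex N (int ?u + int (length p))"
    using Cons by auto
  have sh: "vertex N (int ?u + int j) = vertex N (int u + 1 + int j)" for j
  proof -
    have "vertex N (int ?u) = ?u" using \<open>?u \<in> {1..N}\<close> by (rule vertex_id)
    then have "int N dvd int ?u - (int u + 1)" using u' vertex_eq_iff by metis
    then show ?thesis by (simp add: vertex_eq_iff)
  qed
  have "[0..<length (x # p)] = 0 # map Suc [0..<length p]" by (simp add: upt_conv_Cons map_Suc_upt del: upt_Suc)
  then have m: "map (\<lambda>j. vertex N (int u + int j)) [0..<length (x # p)]
      = u # map (\<lambda>j. vertex N (int u + 1 + int j)) [0..<length p]"
    by (simp add: u comp_def algebra_simps del: upt_Suc)
  have "pre_digraph.cas (cyclic_quiver N) u (x # p) v \<longleftrightarrow> x = u \<and> pre_digraph.cas (cyclic_quiver N) ?u p v"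
    by (auto simp: pre_digraph.cas.simps cyclic_quiver_def)
  then show ?case unfolding m IH sh by (auto simp: algebra_simps)
qed

lemma qpaths_cyclic: "qpaths (cyclic_quiver N) = {path_from N a n | a n. True}"
proof -
  have "pre_digraph.awalk (cyclic_quiver N) u p v \<longleftrightarrow> (\<exists>a n. (u, p, v) = path_from N a n)" for u p v
  proof
    assume "pre_digraph.awalk (cyclic_quiver N) u p v"
    then have *: "u \<in> {1..N}" "set p \<subseteq> {1..N}" "pre_digraph.cas (cyclic_quiver N) u p v"
      by (auto simp: pre_digraph.awalk_def cyclic_quiver_def)
    then have "(u, p, v) = path_from N (int u) (length p)"
      using cas_cyclic[OF *(1,2)] vertex_id[OF *(1)] by (simp add: path_from_def)
    then show "\<exists>a n. (u, p, v) = path_from N a n" by blast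
  next
    assume "\<exists>a n. (u, p, v) = path_from N a n"
    then obtain a n where an: "(u, p, v) = path_from N a n" by blast
    then have u: "u = vertex N a" and p: "p = map (\<lambda>j. vertex N (a + int j)) [0..<n]" and v: "v = vertex N (a + int n)"
      by (auto simp: path_from_def)
    have uN: "u \<in> {1..N}" using u vertex_range by simp
    have pN: "set p \<subseteq> {1..N}" using p vertex_range by auto
    have "vertex N (int u) = vertex N a" using vertex_id[OF uN] u by simp
    then have "int N dvd int u - a" by (simp add: vertex_eq_iff)
    then have "vertex N (int u + int j) = vertex N (a + int j)" for j by (simp add: vertex_eq_iff)
    then have "pre_digraph.cas (cyclic_quiver N) u p v" using cas_cyclic[OF uN pN] p v by simp
    then show "pre_digraph.awalk (cyclic_quiver N) u p v"
      using uN pN by (auto simp: pre_digraph.awalk_def cyclic_quiver_def)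
  qed
  then have "qpaths (cyclic_quiver N) = {(u, p, v). \<exists>a n. (u, p, v) = path_from N a n}" by (simp add: qpaths_def)
  also have "\<dots> = {path_from N a n | a n. True}"
  proof (rule Set.set_eqI)
    fix z :: "(nat, nat) qpath"
    show "z \<in> {(u, p, v). \<exists>a n. (u, p, v) = path_from N a n} \<longleftrightarrow> z \<in> {path_from N a n | a n. True}"
      by (cases z) simp
  qed
  finally show ?thesis .
qed

lemma path_from_append: "vertex N (a + int n) = vertex N b \<Longrightarrow>
    qpath_prod (path_from N b m) (path_from N a n) k = Poly_Mapping.single (path_from N a (n + m)) k"
  and path_from_append_ne: "vertex N (a + int n) \<noteq> vertex N b \<Longrightarrow> qpath_prod (path_from N b m) (path_from N a n) k = 0"
proof -
  assume *: "vertex N (a + int n) = vertex N b"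
  then have d: "int N dvd a + int n - b" by (simp add: vertex_eq_iff)
  have "vertex N (a + int (j + n)) = vertex N (b + int j)" for j
    using d by (simp add: vertex_eq_iff algebra_simps)
  moreover have "[0..<n + m] = [0..<n] @ map (\<lambda>j. j + n) [0..<m]"
    unfolding upt_add_eq_append[OF le0] map_add_upt by (simp add: add.commute)
  ultimately have l: "map (\<lambda>j. vertex N (a + int j)) [0..<n + m]
     = map (\<lambda>j. vertex N (a + int j)) [0..<n] @ map (\<lambda>j. vertex N (b + int j)) [0..<m]"
    by (simp add: comp_def del: of_nat_add)
  have "vertex N (b + int m) = vertex N (a + int (n + m))"
    using d dvd_minus_iff[of "int N" "a + int n - b"] by (simp add: vertex_eq_iff algebra_simps)
  then show "qpath_prod (path_from N b m) (path_from N a n) k = Poly_Mapping.single (path_from N a (n + m)) k"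
    using * l by (simp add: qpath_prod_def path_from_def)
qed (simp add: qpath_prod_def path_from_def)

abbreviation KQ :: "((nat, nat) qpath \<Rightarrow>\<^sub>0 'k::field) ring" where
  "KQ \<equiv> path_algebra (cyclic_quiver N)"

lemma KQ_carrier: "f \<in> carrier KQ \<longleftrightarrow> Poly_Mapping.keys f \<subseteq> qpaths (cyclic_quiver N)"
  and KQ_zero: "\<zero>\<^bsub>KQ\<^esub> = 0"
  and KQ_add: "f \<oplus>\<^bsub>KQ\<^esub> g = f + g"
  by (simp_all add: path_algebra_def)

abbreviation path_coeff :: "((nat, nat) qpath \<Rightarrow>\<^sub>0 'k::field) \<Rightarrow> int \<Rightarrow> nat \<Rightarrow> 'k" where
  "path_coeff f a n \<equiv> Poly_Mapping.lookup f (path_from N a n)"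

lemma KQ_eqI:
  assumes "f \<in> carrier KQ" "g \<in> carrier KQ" "\<And>a n. path_coeff f a n = path_coeff g a n"
  shows "f = g"
proof (rule poly_mapping_eqI)
  fix z
  show "Poly_Mapping.lookup f z = Poly_Mapping.lookup g z"
  proof (cases "z \<in> qpaths (cyclic_quiver N)")
    case True
    then show ?thesis using assms(3) by (auto simp: qpaths_cyclic)
  next
    case False
    then have "z \<notin> Poly_Mapping.keys f" "z \<notin> Poly_Mapping.keys g" using assms by (auto simp: KQ_carrier)
    then show ?thesis by (simp add: in_keys_iff)
  qed
qed

lemma KQ_mult_closed:
  assumes "f \<in> carrier KQ" "g \<in> carrier KQ"
  shows "f \<otimes>\<^bsub>KQ\<^esub> g \<in> carrier KQ"
proof -
  have "Poly_Mapping.keys (qpath_prod x y k) \<subseteq> qpaths (cyclic_quiver N)"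
    if xy: "x \<in> Poly_Mapping.keys f" "y \<in> Poly_Mapping.keys g" for x y and k :: 'a
  proof -
    obtain b m a n where "x = path_from N b m" "y = path_from N a n"
      using xy assms unfolding KQ_carrier qpaths_cyclic by blast
    then show ?thesis
      by (cases "vertex N (a + int n) = vertex N b") (auto simp: path_from_append path_from_append_ne qpaths_cyclic)
  qed
  then have "Poly_Mapping.keys (\<Sum>x\<in>Poly_Mapping.keys f. \<Sum>y\<in>Poly_Mapping.keys g. qpath_prod x y
      (Poly_Mapping.lookup f x * Poly_Mapping.lookup g y)) \<subseteq> qpaths (cyclic_quiver N)"
    by (intro order_trans[OF keys_sum] UN_least)
  then show ?thesis by (simp add: path_algebra_def)
qed

text \<open>
  A path is the product of two paths in exactly one way for each place where it can be cut. All
  computations in the path algebra reduce to this convolution formula, as for polynomials.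
\<close>

lemma path_coeff_mult:
  assumes "f \<in> carrier KQ" "g \<in> carrier KQ"
  shows "path_coeff (f \<otimes>\<^bsub>KQ\<^esub> g) a n = (\<Sum>j\<le>n. path_coeff f (a + int j) (n - j) * path_coeff g a j)"
proof -
  let ?d = "\<lambda>j. (path_from N (a + int j) (n - j), path_from N a j)"
  let ?D = "?d ` {..n}"
  let ?K = "Poly_Mapping.keys f \<times> Poly_Mapping.keys g"
  let ?F = "\<lambda>(x, y). Poly_Mapping.lookup f x * Poly_Mapping.lookup g y"
  have "Poly_Mapping.lookup (qpath_prod x y k) (path_from N a n) = (if (x, y) \<in> ?D then k else 0)"
    if xy: "x \<in> Poly_Mapping.keys f" "y \<in> Poly_Mapping.keys g" for x y and k :: 'a
  proof -
    obtain b m a' n' where x: "x = path_from N b m" and y: "y = path_from N a' n'"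
      using xy assms unfolding KQ_carrier qpaths_cyclic by blast
    have D: "(x, y) \<in> ?D \<longleftrightarrow> n' + m = n \<and> int N dvd a' - a \<and> int N dvd b - (a + int n')"
      unfolding x y by (auto simp: path_from_eq_iff image_iff)
    show ?thesis
    proof (cases "vertex N (a' + int n') = vertex N b")
      case True
      then have "int N dvd a' + int n' - b" by (simp add: vertex_eq_iff)
      then have "int N dvd a' - a \<longleftrightarrow> int N dvd b - (a + int n')"
        using dvd_add_right_iff[of "int N" "a' + int n' - b" "b - (a + int n')"] by (simp add: algebra_simps)
      then show ?thesis unfolding D using True by (simp add: x y path_from_append lookup_single when_def path_from_eq_iff)
    next
      case False
      then have "\<not> int N dvd a' + int n' - b" by (simp add: vertex_eq_iff)
      then have "\<not> (int N dvd a' - a \<and> int N dvd b - (a + int n'))"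
        using dvd_diff[of "int N" "a' - a" "b - (a + int n')"] by (auto simp: algebra_simps)
      then show ?thesis unfolding D using False by (auto simp: x y path_from_append_ne)
    qed
  qed
  then have "path_coeff (f \<otimes>\<^bsub>KQ\<^esub> g) a n = (\<Sum>x\<in>Poly_Mapping.keys f. \<Sum>y\<in>Poly_Mapping.keys g.
      if (x, y) \<in> ?D then Poly_Mapping.lookup f x * Poly_Mapping.lookup g y else 0)"
    by (simp add: path_algebra_def lookup_sum)
  also have "\<dots> = (\<Sum>p\<in>?K. if p \<in> ?D then ?F p else 0)"
    unfolding sum.cartesian_product by (intro sum.cong) auto
  also have "\<dots> = (\<Sum>p\<in>?K \<inter> ?D. ?F p)" by (simp add: sum.If_cases)
  also have "\<dots> = (\<Sum>p\<in>?D. ?F p)"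
    by (rule sum.mono_neutral_left) (auto simp: in_keys_iff)
  also have "\<dots> = (\<Sum>j\<le>n. ?F (?d j))"
    by (rule sum.reindex_cong[of ?d]) (auto simp: inj_on_def path_from_eq_iff)
  finally show ?thesis by simp
qed

lemma KQ_one: "\<one>\<^bsub>KQ\<^esub> = (\<Sum>v\<in>{..<N}. Poly_Mapping.single (path_from N (int v) 0) (1 :: 'k::field))"
proof -
  have "\<one>\<^bsub>KQ\<^esub> = (\<Sum>v\<in>{1..N}. Poly_Mapping.single (v, [], v) (1 :: 'k))"
    by (simp add: path_algebra_def cyclic_quiver_def)
  also have "\<dots> = (\<Sum>v\<in>{1..N}. Poly_Mapping.single (path_from N (int v) 0) 1)"
    using vertex_id by (intro sum.cong refl) (simp add: path_from_def)
  also have "{1..N} = insert N {1..<N}" using N_pos by auto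
  also have "(\<Sum>v\<in>insert N {1..<N}. Poly_Mapping.single (path_from N (int v) 0) (1 :: 'k))
     = Poly_Mapping.single (path_from N 0 0) 1 + (\<Sum>v\<in>{1..<N}. Poly_Mapping.single (path_from N (int v) 0) 1)"
    using path_from_shift[of 0 1 0] by simp
  also have "\<dots> = (\<Sum>v\<in>insert 0 {1..<N}. Poly_Mapping.single (path_from N (int v) 0) 1)" by simp
  also have "insert 0 {1..<N} = {..<N}" using N_pos by auto
  finally show ?thesis .
qed

lemma sum_residue: "(\<Sum>v\<in>{..<N}. if int N dvd int v - a then k else 0) = k"
proof -
  have u: "int N dvd int v - a \<longleftrightarrow> v = nat (a mod int N)" if "v < N" for v
  proof -
    have "int N dvd int v - a \<longleftrightarrow> int v mod int N = a mod int N" by (simp add: mod_eq_dvd_iff)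
    also have "\<dots> \<longleftrightarrow> v = nat (a mod int N)" using that N_pos by (auto simp: nat_eq_iff)
    finally show ?thesis .
  qed
  have "(\<Sum>v\<in>{..<N}. if int N dvd int v - a then k else 0) = (\<Sum>v\<in>{..<N}. if v = nat (a mod int N) then k else 0)"
    by (rule sum.cong) (use u in auto)
  moreover have "nat (a mod int N) < N" using N_pos by (simp add: nat_less_iff)
  ultimately show ?thesis by simp
qed

lemma path_coeff_one: "path_coeff \<one>\<^bsub>KQ\<^esub> a n = (if n = 0 then 1 else 0)"
proof (cases "n = 0")
  case True
  have "path_coeff \<one>\<^bsub>KQ\<^esub> a n = (\<Sum>v\<in>{..<N}. if int N dvd int v - a then 1 else 0)"
    unfolding KQ_one True lookup_sum by (intro sum.cong refl) (auto simp: lookup_single when_def path_from_eq_iff)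
  then show ?thesis using True by (simp add: sum_residue)
qed (simp add: KQ_one lookup_sum lookup_single when_def path_from_eq_iff)

lemma KQ_single: "Poly_Mapping.single (path_from N a n) k \<in> carrier KQ"
  by (auto simp: KQ_carrier qpaths_cyclic)

lemma KQ_sum: "(\<And>i. i \<in> I \<Longrightarrow> g i \<in> carrier KQ) \<Longrightarrow> sum g I \<in> carrier KQ"
  unfolding KQ_carrier using keys_sum[of g I] by blast

lemma KQ_add_closed: "f \<in> carrier KQ \<Longrightarrow> g \<in> carrier KQ \<Longrightarrow> f + g \<in> carrier KQ"
  unfolding KQ_carrier using keys_add[of f g] by blast

lemma KQ_ring: "ring (KQ :: ((nat, nat) qpath \<Rightarrow>\<^sub>0 'k::field) ring)"
proof (rule ringI)
  show "abelian_group (KQ :: ((nat, nat) qpath \<Rightarrow>\<^sub>0 'k) ring)"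
  proof (rule abelian_groupI)
    fix f :: "(nat, nat) qpath \<Rightarrow>\<^sub>0 'k" assume "f \<in> carrier KQ"
    then show "\<exists>g\<in>carrier KQ. g \<oplus>\<^bsub>KQ\<^esub> f = \<zero>\<^bsub>KQ\<^esub>"
      by (intro bexI[of _ "- f"]) (auto simp: KQ_add KQ_zero KQ_carrier)
  qed (auto simp: KQ_add KQ_zero KQ_add_closed add_ac, simp add: KQ_carrier)
  have one: "\<one>\<^bsub>KQ\<^esub> \<in> carrier (KQ :: ((nat, nat) qpath \<Rightarrow>\<^sub>0 'k) ring)"
    unfolding KQ_one by (rule KQ_sum) (rule KQ_single)
  show "Group.monoid (KQ :: ((nat, nat) qpath \<Rightarrow>\<^sub>0 'k) ring)"
  proof (rule Group.monoidI)
    fix f g h :: "(nat, nat) qpath \<Rightarrow>\<^sub>0 'k"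
    assume c: "f \<in> carrier KQ" "g \<in> carrier KQ" "h \<in> carrier KQ"
    show "f \<otimes>\<^bsub>KQ\<^esub> g \<otimes>\<^bsub>KQ\<^esub> h = f \<otimes>\<^bsub>KQ\<^esub> (g \<otimes>\<^bsub>KQ\<^esub> h)"
    proof (rule KQ_eqI)
      fix a n
      have "path_coeff (f \<otimes>\<^bsub>KQ\<^esub> g \<otimes>\<^bsub>KQ\<^esub> h) a n
          = (\<Sum>j\<le>n. \<Sum>i\<le>n - j. path_coeff f (a + int j + int i) (n - j - i) * path_coeff g (a + int j) i * path_coeff h a j)"
        using c by (simp add: path_coeff_mult KQ_mult_closed sum_distrib_right)
      also have "\<dots> = (\<Sum>(j, i)\<in>Sigma {..n} (\<lambda>j. {..n - j}).
          path_coeff f (a + int j + int i) (n - j - i) * path_coeff g (a + int j) i * path_coeff h a j)"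
        by (simp add: sum.Sigma)
      also have "\<dots> = (\<Sum>(j, i)\<in>Sigma {..n} (\<lambda>j. {..j}).
          path_coeff f (a + int j) (n - j) * (path_coeff g (a + int i) (j - i) * path_coeff h a i))"
        by (rule sum.reindex_bij_witness[of _ "\<lambda>(j, i). (i, j - i)" "\<lambda>(j, i). (j + i, j)"])
          (auto simp: algebra_simps)
      also have "\<dots> = (\<Sum>j\<le>n. \<Sum>i\<le>j. path_coeff f (a + int j) (n - j) * (path_coeff g (a + int i) (j - i) * path_coeff h a i))"
        by (simp add: sum.Sigma)
      also have "\<dots> = path_coeff (f \<otimes>\<^bsub>KQ\<^esub> (g \<otimes>\<^bsub>KQ\<^esub> h)) a n"
        using c by (simp add: path_coeff_mult KQ_mult_closed sum_distrib_left)
      finally show "path_coeff (f \<otimes>\<^bsub>KQ\<^esub> g \<otimes>\<^bsub>KQ\<^esub> h) a n = path_coeff (f \<otimes>\<^bsub>KQ\<^esub> (g \<otimes>\<^bsub>KQ\<^esub> h)) a n" .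
    qed (use c in \<open>auto intro: KQ_mult_closed\<close>)
  next
    fix f :: "(nat, nat) qpath \<Rightarrow>\<^sub>0 'k" assume c: "f \<in> carrier KQ"
    have "path_coeff (\<one>\<^bsub>KQ\<^esub> \<otimes>\<^bsub>KQ\<^esub> f) a n = path_coeff f a n" for a n
    proof -
      have "path_coeff (\<one>\<^bsub>KQ\<^esub> \<otimes>\<^bsub>KQ\<^esub> f) a n = (\<Sum>j\<le>n. if j = n then path_coeff f a j else 0)"
        unfolding path_coeff_mult[OF one c] by (intro sum.cong) (auto simp: path_coeff_one)
      then show ?thesis by simp
    qed
    then show "\<one>\<^bsub>KQ\<^esub> \<otimes>\<^bsub>KQ\<^esub> f = f" by (intro KQ_eqI KQ_mult_closed one c)
    have "path_coeff (f \<otimes>\<^bsub>KQ\<^esub> \<one>\<^bsub>KQ\<^esub>) a n = path_coeff f a n" for a n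
    proof -
      have "path_coeff (f \<otimes>\<^bsub>KQ\<^esub> \<one>\<^bsub>KQ\<^esub>) a n = (\<Sum>j\<le>n. if j = 0 then path_coeff f (a + int j) (n - j) else 0)"
        unfolding path_coeff_mult[OF c one] by (intro sum.cong) (auto simp: path_coeff_one)
      then show ?thesis by simp
    qed
    then show "f \<otimes>\<^bsub>KQ\<^esub> \<one>\<^bsub>KQ\<^esub> = f" by (intro KQ_eqI KQ_mult_closed one c)
  qed (auto intro: KQ_mult_closed one)
next
  fix f g h :: "(nat, nat) qpath \<Rightarrow>\<^sub>0 'k"
  assume c: "f \<in> carrier KQ" "g \<in> carrier KQ" "h \<in> carrier KQ"
  show "(f \<oplus>\<^bsub>KQ\<^esub> g) \<otimes>\<^bsub>KQ\<^esub> h = f \<otimes>\<^bsub>KQ\<^esub> h \<oplus>\<^bsub>KQ\<^esub> g \<otimes>\<^bsub>KQ\<^esub> h"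
    unfolding KQ_add using c
    by (intro KQ_eqI) (auto simp: KQ_mult_closed KQ_add_closed path_coeff_mult lookup_add distrib_right sum.distrib)
  show "h \<otimes>\<^bsub>KQ\<^esub> (f \<oplus>\<^bsub>KQ\<^esub> g) = h \<otimes>\<^bsub>KQ\<^esub> f \<oplus>\<^bsub>KQ\<^esub> h \<otimes>\<^bsub>KQ\<^esub> g"
    unfolding KQ_add using c
    by (intro KQ_eqI) (auto simp: KQ_mult_closed KQ_add_closed path_coeff_mult lookup_add distrib_left sum.distrib)
qed

definition idem :: "int \<Rightarrow> (nat, nat) qpath \<Rightarrow>\<^sub>0 'k::field" where
  "idem a = Poly_Mapping.single (path_from N a 0) 1"

text \<open>
  The value of the polynomial \<open>p\<close> at the sum of all arrows: every path of length \<open>j\<close> has coefficient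
  \<open>coeff p j\<close>.
\<close>

definition arrow_poly :: "'k::field poly \<Rightarrow> (nat, nat) qpath \<Rightarrow>\<^sub>0 'k" where
  "arrow_poly p = (\<Sum>v\<in>{..<N}. \<Sum>j\<le>degree p. Poly_Mapping.single (path_from N (int v) j) (coeff p j))"

lemma idem_carrier: "idem a \<in> carrier KQ"
  unfolding idem_def by (rule KQ_single)

lemma arrow_poly_carrier: "arrow_poly p \<in> carrier KQ"
  unfolding arrow_poly_def by (intro KQ_sum KQ_single)

lemma path_coeff_idem: "path_coeff (idem a) b n = (if n = 0 \<and> int N dvd b - a then 1 else 0)"
  by (auto simp: idem_def lookup_single when_def path_from_eq_iff dvd_diff_commute)

lemma path_coeff_arrow_poly: "path_coeff (arrow_poly p) a n = coeff p n"
proof -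
  have "path_coeff (arrow_poly p) a n = (\<Sum>v\<in>{..<N}. \<Sum>j\<le>degree p. if j = n then if int N dvd int v - a then coeff p n else 0 else 0)"
    unfolding arrow_poly_def lookup_sum
    by (intro sum.cong refl) (auto simp: lookup_single when_def path_from_eq_iff)
  also have "\<dots> = (\<Sum>v\<in>{..<N}. if int N dvd int v - a then coeff p n else 0)"
    by (intro sum.cong refl) (auto simp: coeff_eq_0)
  finally show ?thesis by (simp add: sum_residue)
qed

lemma path_coeff_mult_idem:
  assumes "f \<in> carrier KQ"
  shows "path_coeff (f \<otimes>\<^bsub>KQ\<^esub> idem a) b n = (if int N dvd b - a then path_coeff f b n else 0)"
proof -
  have "path_coeff (f \<otimes>\<^bsub>KQ\<^esub> idem a) b n = (\<Sum>j\<le>n. if j = 0 then if int N dvd b - a then path_coeff f b n else 0 else 0)"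
    unfolding path_coeff_mult[OF assms idem_carrier] by (intro sum.cong) (auto simp: path_coeff_idem)
  then show ?thesis by simp
qed

lemma path_coeff_idem_mult:
  assumes "f \<in> carrier KQ"
  shows "path_coeff (idem a \<otimes>\<^bsub>KQ\<^esub> f) b n = (if int N dvd b + int n - a then path_coeff f b n else 0)"
proof -
  have "path_coeff (idem a \<otimes>\<^bsub>KQ\<^esub> f) b n = (\<Sum>j\<le>n. if j = n then if int N dvd b + int n - a then path_coeff f b n else 0 else 0)"
    unfolding path_coeff_mult[OF idem_carrier assms] by (intro sum.cong) (auto simp: path_coeff_idem)
  then show ?thesis by simp
qed

lemma arrow_poly_add: "arrow_poly (p + q) = arrow_poly p + arrow_poly q"
  by (intro KQ_eqI KQ_add_closed arrow_poly_carrier) (simp add: path_coeff_arrow_poly lookup_add)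

lemma arrow_poly_mult: "arrow_poly (p * q) = arrow_poly p \<otimes>\<^bsub>KQ\<^esub> arrow_poly q"
proof (intro KQ_eqI KQ_mult_closed arrow_poly_carrier)
  fix a n
  show "path_coeff (arrow_poly (p * q)) a n = path_coeff (arrow_poly p \<otimes>\<^bsub>KQ\<^esub> arrow_poly q) a n"
    unfolding path_coeff_mult[OF arrow_poly_carrier arrow_poly_carrier] path_coeff_arrow_poly mult.commute[of p q] coeff_mult
    by (simp add: mult.commute)
qed

lemma arrow_poly_one: "arrow_poly 1 = \<one>\<^bsub>KQ\<^esub>"
  by (intro KQ_eqI arrow_poly_carrier ring.ring_simprules(6)[OF KQ_ring]) (simp add: path_coeff_arrow_poly path_coeff_one)

lemma arrow_poly_X_idem:
  "arrow_poly (monom 1 (Suc 0)) \<otimes>\<^bsub>KQ\<^esub> idem a = idem (a + 1) \<otimes>\<^bsub>KQ\<^esub> arrow_poly (monom 1 (Suc 0))"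
  by (intro KQ_eqI KQ_mult_closed arrow_poly_carrier idem_carrier)
    (auto simp: path_coeff_mult_idem path_coeff_idem_mult arrow_poly_carrier path_coeff_arrow_poly)

lemma arrow_poly_const_idem:
  "arrow_poly [:k:] \<otimes>\<^bsub>KQ\<^esub> idem a = idem a \<otimes>\<^bsub>KQ\<^esub> arrow_poly [:k:]"
  by (intro KQ_eqI KQ_mult_closed arrow_poly_carrier idem_carrier)
    (simp add: path_coeff_mult_idem path_coeff_idem_mult arrow_poly_carrier path_coeff_arrow_poly coeff_pCons split: nat.split)

lemma idem_idem: "idem a \<otimes>\<^bsub>KQ\<^esub> idem a = idem a"
  by (intro KQ_eqI KQ_mult_closed idem_carrier) (simp add: path_coeff_mult_idem idem_carrier path_coeff_idem)

lemma idem_shift: "idem (a + int N) = idem a"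
  using path_from_shift[of a 1 0] by (simp add: idem_def)

lemma mult_idem_eq_arrow_poly:
  assumes "f \<in> carrier KQ"
  shows "\<exists>p. f \<otimes>\<^bsub>KQ\<^esub> idem a = arrow_poly p \<otimes>\<^bsub>KQ\<^esub> idem a"
proof -
  have "inj (path_from N a)" by (auto simp: inj_def path_from_eq_iff)
  then have "finite (path_from N a -` Poly_Mapping.keys f)" by (intro finite_vimageI) auto
  moreover have "path_from N a -` Poly_Mapping.keys f = {n. path_coeff f a n \<noteq> 0}" by (auto simp: in_keys_iff)
  ultimately have "\<forall>\<^sub>\<infinity>n. path_coeff f a n = 0" by (simp add: MOST_iff_cofinite)
  then have p: "coeff (Abs_poly (path_coeff f a)) = path_coeff f a" by (simp add: Abs_poly_inverse)
  have "path_coeff (f \<otimes>\<^bsub>KQ\<^esub> idem a) b n = path_coeff (arrow_poly (Abs_poly (path_coeff f a)) \<otimes>\<^bsub>KQ\<^esub> idem a) b n" for b n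
    using path_from_cong[of b a n] by (simp add: path_coeff_mult_idem assms arrow_poly_carrier path_coeff_arrow_poly p)
  then show ?thesis by (intro exI KQ_eqI KQ_mult_closed assms idem_carrier arrow_poly_carrier)
qed

lemma t_idem: "arrow_poly (monom 1 n) \<otimes>\<^bsub>KQ\<^esub> idem a = Poly_Mapping.single (path_from N a n) 1"
proof (intro KQ_eqI KQ_mult_closed arrow_poly_carrier idem_carrier KQ_single)
  fix b m
  show "path_coeff (arrow_poly (monom 1 n) \<otimes>\<^bsub>KQ\<^esub> idem a) b m = path_coeff (Poly_Mapping.single (path_from N a n) 1) b m"
    by (auto simp: path_coeff_mult_idem arrow_poly_carrier path_coeff_arrow_poly lookup_single when_def path_from_eq_iff dvd_diff_commute)
qed

end

section \<open>The quotient by the relations\<close>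

locale nakayama_presentation = cyclic_paths N for N :: nat +
  fixes r :: nat and k :: "nat \<Rightarrow> nat"
  assumes r_pos: "r \<ge> 1"
    and k_pos: "i \<in> {1..r} \<Longrightarrow> 1 \<le> k (2 * i - 1)"
    and k_le: "i \<in> {1..r} \<Longrightarrow> k (2 * i - 1) \<le> k (2 * i)"
begin

text \<open>
  The path of length \<open>n\<close> that starts at \<open>a\<close>, drawn on the line of integers, contains a lift of the
  path of some relation. The arrow \<open>k (2 i)\<close> ends at \<open>k (2 i) + 1\<close>.
\<close>

definition contains_relation :: "int \<Rightarrow> nat \<Rightarrow> bool" where
  "contains_relation a n \<longleftrightarrow> (\<exists>i\<in>{1..r}. \<exists>w. a \<le> int (k (2 * i - 1)) + int N * w \<and>
     int (k (2 * i)) + 1 + int N * w \<le> a + int n)"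

lemma contains_relation_shift: "int N dvd a - b \<Longrightarrow> contains_relation a n \<Longrightarrow> contains_relation b n"
proof -
  assume d: "int N dvd a - b" and "contains_relation a n"
  then obtain i w where iw: "i \<in> {1..r}" "a \<le> int (k (2 * i - 1)) + int N * w"
    "int (k (2 * i)) + 1 + int N * w \<le> a + int n"
    unfolding contains_relation_def by blast
  obtain z where "a - b = int N * z" using d by blast
  with iw show "contains_relation b n"
    unfolding contains_relation_def
    by (intro bexI[of _ i] exI[of _ "w - z"]) (auto simp: algebra_simps)
qed

lemma contains_relation_mono:
  "contains_relation (a + int j) m \<Longrightarrow> contains_relation a (j + m)"
  "contains_relation a j \<Longrightarrow> j \<le> n \<Longrightarrow> contains_relation a n"
  unfolding contains_relation_def
   apply (elim bexE exE conjE)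
  subgoal for i w by (intro bexI[of _ i] exI[of _ w]) auto
  apply (elim bexE exE conjE)
  subgoal for i w by (intro bexI[of _ i] exI[of _ w]) auto
  done

lemma contains_relation_exists: "\<exists>n. contains_relation a n"
proof -
  have "a \<le> int (k 1) + int N * \<bar>a\<bar>"
  proof -
    have "\<bar>a\<bar> \<le> int N * \<bar>a\<bar>" using N_pos mult_right_mono[of 1 "int N" "\<bar>a\<bar>"] by simp
    then show ?thesis by linarith
  qed
  moreover have "int (k 2) + 1 + int N * \<bar>a\<bar> \<le> a + int (nat (int (k 2) + 1 + int N * \<bar>a\<bar> - a))" by simp
  ultimately show ?thesis
    unfolding contains_relation_def using r_pos
    by (intro exI[of _ "nat (int (k 2) + 1 + int N * \<bar>a\<bar> - a)"] bexI[of _ 1] exI[of _ "\<bar>a\<bar>"]) simp_all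
qed

definition proj_length :: "int \<Rightarrow> nat" where
  "proj_length a = (LEAST n. contains_relation a n)"

lemma proj_length_le_iff: "proj_length a \<le> n \<longleftrightarrow> contains_relation a n"
proof
  have "contains_relation a (proj_length a)"
    unfolding proj_length_def using contains_relation_exists by (rule LeastI_ex)
  then show "proj_length a \<le> n \<Longrightarrow> contains_relation a n" using contains_relation_mono(2) by blast
  show "contains_relation a n \<Longrightarrow> proj_length a \<le> n" unfolding proj_length_def by (rule Least_le)
qed

text \<open>
  A shortest path containing a relation ends where the relation ends. This is why the ends of the
  indecomposable projective modules take at most \<open>r\<close> values modulo \<open>N\<close>.
\<close>

lemma proj_length_end: "\<exists>i\<in>{1..r}. \<exists>w. a + int (proj_length a) = int (k (2 * i)) + 1 + int N * w"
proof -
  have "contains_relation a (proj_length a)" using proj_length_le_iff[of a "proj_length a"] by simp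
  then obtain i w where iw: "i \<in> {1..r}" "a \<le> int (k (2 * i - 1)) + int N * w"
    "int (k (2 * i)) + 1 + int N * w \<le> a + int (proj_length a)" unfolding contains_relation_def by blast
  have "a + int (proj_length a) \<le> int (k (2 * i)) + 1 + int N * w"
  proof (rule ccontr)
    assume *: "\<not> ?thesis"
    have "a < int (k (2 * i)) + 1 + int N * w" using iw(2) k_le[OF iw(1)] by linarith
    then have "contains_relation a (proj_length a - 1)"
      unfolding contains_relation_def using iw * by (intro bexI[of _ i] exI[of _ w]) auto
    then have "proj_length a \<le> proj_length a - 1" using proj_length_le_iff by blast
    then show False using * \<open>a < int (k (2 * i)) + 1 + int N * w\<close> by linarith
  qed
  then show ?thesis using iw by (intro bexI[of _ i] exI[of _ w]) auto
qed

lemma card_proj_ends: "card (range (\<lambda>a. (a + int (proj_length a)) mod int N)) \<le> r"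
proof -
  have "range (\<lambda>a. (a + int (proj_length a)) mod int N) \<subseteq> (\<lambda>i. (int (k (2 * i)) + 1) mod int N) ` {1..r}"
  proof
    fix x assume "x \<in> range (\<lambda>a. (a + int (proj_length a)) mod int N)"
    then obtain a where a: "x = (a + int (proj_length a)) mod int N" by blast
    obtain i w where "i \<in> {1..r}" "a + int (proj_length a) = int (k (2 * i)) + 1 + int N * w"
      using proj_length_end[of a] by blast
    then show "x \<in> (\<lambda>i. (int (k (2 * i)) + 1) mod int N) ` {1..r}" unfolding a by auto
  qed
  then have "card (range (\<lambda>a. (a + int (proj_length a)) mod int N))
      \<le> card ((\<lambda>i. (int (k (2 * i)) + 1) mod int N) ` {1..r})"
    by (rule card_mono[rotated]) simp
  also have "\<dots> \<le> r" using card_image_le[of "{1..r}"] by (metis card_atLeastAtMost diff_Suc_1 finite_atLeastAtMost)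
  finally show ?thesis .
qed

lemma relation_path_from:
  assumes "i \<in> {1..r}"
  shows "nakayama_relation N k i
    = Poly_Mapping.single (path_from N (int (k (2 * i - 1))) (Suc (k (2 * i)) - k (2 * i - 1))) 1"
proof -
  let ?s = "k (2 * i - 1)" and ?t = "k (2 * i)"
  note s = k_pos[OF assms] and st = k_le[OF assms]
  have "[?s..<Suc ?t] = map (\<lambda>j. j + ?s) [0..<Suc ?t - ?s]"
    using st by (simp add: map_add_upt del: upt_Suc)
  then have "map (\<lambda>j. (j - 1) mod N + 1) [?s..<Suc ?t] = map (\<lambda>j. vertex N (int ?s + int j)) [0..<Suc ?t - ?s]"
    using s vertex_of_nat[of "?s + j" for j] by (simp add: add.commute del: upt_Suc)
  moreover have "vertex N (int ?s) = (?s - 1) mod N + 1" by (rule vertex_of_nat[OF s])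
  moreover have "int ?s + int (Suc ?t - ?s) = int (Suc ?t)" using st by simp
  then have "vertex N (int ?s + int (Suc ?t - ?s)) = ?t mod N + 1" using vertex_of_nat[of "Suc ?t"] by simp
  ultimately show ?thesis by (simp add: nakayama_relation_def arrow_product_def path_from_def del: upt_Suc)
qed

text \<open>
  The span of the paths that contain a relation. As it is an ideal, no other path is zero in the
  quotient.
\<close>

definition relation_span :: "((nat, nat) qpath \<Rightarrow>\<^sub>0 'k::field) set" where
  "relation_span = {f \<in> carrier KQ. \<forall>a n. path_coeff f a n \<noteq> 0 \<longrightarrow> contains_relation a n}"

lemma ideal_relation_span: "ideal (relation_span :: ((nat, nat) qpath \<Rightarrow>\<^sub>0 'k::field) set) KQ"
proof (rule idealI[OF KQ_ring])
  interpret P: ring "KQ :: ((nat, nat) qpath \<Rightarrow>\<^sub>0 'k) ring" by (rule KQ_ring)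
  have m: "\<ominus>\<^bsub>KQ\<^esub> f = - f" if f: "f \<in> carrier KQ" for f :: "(nat, nat) qpath \<Rightarrow>\<^sub>0 'k"
    using f P.minus_equality[of "- f" f] by (simp add: KQ_add KQ_zero KQ_carrier)
  show "subgroup (relation_span :: ((nat, nat) qpath \<Rightarrow>\<^sub>0 'k) set) (add_monoid KQ)"
  proof (rule P.add.subgroupI)
    show "(relation_span :: ((nat, nat) qpath \<Rightarrow>\<^sub>0 'k) set) \<subseteq> carrier KQ" by (auto simp: relation_span_def)
    have "(0 :: (nat, nat) qpath \<Rightarrow>\<^sub>0 'k) \<in> relation_span" by (simp add: relation_span_def KQ_carrier)
    then show "(relation_span :: ((nat, nat) qpath \<Rightarrow>\<^sub>0 'k) set) \<noteq> {}" by blast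
    fix f g :: "(nat, nat) qpath \<Rightarrow>\<^sub>0 'k" assume f: "f \<in> relation_span"
    then show "\<ominus>\<^bsub>KQ\<^esub> f \<in> relation_span" by (auto simp: relation_span_def m KQ_carrier)
    assume g: "g \<in> relation_span"
    show "f \<oplus>\<^bsub>KQ\<^esub> g \<in> relation_span"
      using f g by (auto simp: relation_span_def KQ_add KQ_add_closed lookup_add) (metis add_0)
  qed
next
  fix f g :: "(nat, nat) qpath \<Rightarrow>\<^sub>0 'k" assume f: "f \<in> relation_span" and g: "g \<in> carrier KQ"
  then have fc: "f \<in> carrier KQ" and fb: "\<And>a n. path_coeff f a n \<noteq> 0 \<Longrightarrow> contains_relation a n"
    by (auto simp: relation_span_def)
  have "contains_relation a n" if "path_coeff (g \<otimes>\<^bsub>KQ\<^esub> f) a n \<noteq> 0" for a n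
  proof -
    have "\<exists>j\<in>{..n}. path_coeff g (a + int j) (n - j) * path_coeff f a j \<noteq> 0"
      using that unfolding path_coeff_mult[OF g fc] by (rule contrapos_np) (intro sum.neutral, blast)
    then obtain j where "j \<le> n" "path_coeff g (a + int j) (n - j) * path_coeff f a j \<noteq> 0" by blast
    then show ?thesis using fb[of a j] contains_relation_mono(2) by auto
  qed
  then show "g \<otimes>\<^bsub>KQ\<^esub> f \<in> relation_span" using fc g by (simp add: relation_span_def KQ_mult_closed)
  have "contains_relation a n" if "path_coeff (f \<otimes>\<^bsub>KQ\<^esub> g) a n \<noteq> 0" for a n
  proof -
    have "\<exists>j\<in>{..n}. path_coeff f (a + int j) (n - j) * path_coeff g a j \<noteq> 0"
      using that unfolding path_coeff_mult[OF fc g] by (rule contrapos_np) (intro sum.neutral, blast)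
    then obtain j where "j \<le> n" "path_coeff f (a + int j) (n - j) * path_coeff g a j \<noteq> 0" by blast
    then show ?thesis using fb[of "a + int j" "n - j"] contains_relation_mono(1)[of a j "n - j"] by auto
  qed
  then show "f \<otimes>\<^bsub>KQ\<^esub> g \<in> relation_span" using fc g by (simp add: relation_span_def KQ_mult_closed)
qed

abbreviation rel_ideal :: "((nat, nat) qpath \<Rightarrow>\<^sub>0 'k::field) set" where
  "rel_ideal \<equiv> nakayama_ideal N k {1..r}"

lemma relations_carrier:
  "nakayama_relation N k ` {1..r} \<subseteq> carrier (KQ :: ((nat, nat) qpath \<Rightarrow>\<^sub>0 'k::field) ring)"
  using KQ_single by (auto simp: relation_path_from)

lemma ideal_rel_ideal: "ideal (rel_ideal :: ((nat, nat) qpath \<Rightarrow>\<^sub>0 'k::field) set) KQ"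
  unfolding nakayama_ideal_def by (rule ring.genideal_ideal[OF KQ_ring relations_carrier])

lemma rel_ideal_subset: "(rel_ideal :: ((nat, nat) qpath \<Rightarrow>\<^sub>0 'k::field) set) \<subseteq> relation_span"
  unfolding nakayama_ideal_def
proof (rule ring.genideal_minimal[OF KQ_ring ideal_relation_span], rule subsetI)
  fix f :: "(nat, nat) qpath \<Rightarrow>\<^sub>0 'k" assume "f \<in> nakayama_relation N k ` {1..r}"
  then obtain i where i: "i \<in> {1..r}"
    "f = Poly_Mapping.single (path_from N (int (k (2 * i - 1))) (Suc (k (2 * i)) - k (2 * i - 1))) 1"
    by (auto simp: relation_path_from)
  have "contains_relation (int (k (2 * i - 1))) (Suc (k (2 * i)) - k (2 * i - 1))"
    unfolding contains_relation_def using i k_le[OF i(1)] by (intro bexI[of _ i] exI[of _ 0]) auto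
  then show "f \<in> relation_span"
    unfolding i(2) relation_span_def using KQ_single contains_relation_shift
    by (auto simp: lookup_single when_def path_from_eq_iff)
qed

lemma path_from_mult_single:
  "(Poly_Mapping.single (path_from N (a + int n) m) 1 :: (nat, nat) qpath \<Rightarrow>\<^sub>0 'k::field)
     \<otimes>\<^bsub>KQ\<^esub> Poly_Mapping.single (path_from N a n) 1
   = Poly_Mapping.single (path_from N a (n + m)) 1"
  by (simp add: path_algebra_def path_from_append)

lemma single_mem_rel_ideal_iff:
  "(Poly_Mapping.single (path_from N a n) 1 :: (nat, nat) qpath \<Rightarrow>\<^sub>0 'k::field) \<in> rel_ideal \<longleftrightarrow> contains_relation a n"
proof
  assume "(Poly_Mapping.single (path_from N a n) 1 :: (nat, nat) qpath \<Rightarrow>\<^sub>0 'k) \<in> rel_ideal"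
  then have "(Poly_Mapping.single (path_from N a n) 1 :: (nat, nat) qpath \<Rightarrow>\<^sub>0 'k) \<in> relation_span"
    using rel_ideal_subset by blast
  then show "contains_relation a n" by (simp add: relation_span_def)
next
  interpret I: ideal "rel_ideal :: ((nat, nat) qpath \<Rightarrow>\<^sub>0 'k) set" KQ by (rule ideal_rel_ideal)
  assume "contains_relation a n"
  then obtain i w where iw: "i \<in> {1..r}" "a \<le> int (k (2 * i - 1)) + int N * w"
    "int (k (2 * i)) + 1 + int N * w \<le> a + int n" unfolding contains_relation_def by blast
  \<comment> \<open>The path is cut before and after the lift of the relation, which starts at \<open>s\<close> and has length \<open>d\<close>.\<close>
  define s where "s = int (k (2 * i - 1)) + int N * w"
  define d where "d = Suc (k (2 * i)) - k (2 * i - 1)"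
  define j where "j = nat (s - a)"
  define m where "m = nat (a + int n - (s + int d))"
  have dk: "int d = int (k (2 * i)) + 1 - int (k (2 * i - 1))" using k_le[OF iw(1)] by (simp add: d_def)
  have j: "a + int j = s" using iw(2) by (simp add: j_def s_def)
  have n: "j + (d + m) = n"
    using iw(2,3) dk by (simp add: j_def m_def s_def flip: int_int_eq)
  have "nakayama_relation N k i \<in> (rel_ideal :: ((nat, nat) qpath \<Rightarrow>\<^sub>0 'k) set)"
    unfolding nakayama_ideal_def using ring.genideal_self[OF KQ_ring relations_carrier] iw(1) by blast
  then have 0: "(Poly_Mapping.single (path_from N s d) 1 :: (nat, nat) qpath \<Rightarrow>\<^sub>0 'k) \<in> rel_ideal"
    unfolding relation_path_from[OF iw(1)] s_def d_def path_from_shift .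
  have 1: "(Poly_Mapping.single (path_from N s (d + m)) 1 :: (nat, nat) qpath \<Rightarrow>\<^sub>0 'k) \<in> rel_ideal"
    using I.I_l_closed[OF 0 KQ_single[of "s + int d" m 1]] by (simp add: path_from_mult_single)
  show "(Poly_Mapping.single (path_from N a n) 1 :: (nat, nat) qpath \<Rightarrow>\<^sub>0 'k) \<in> rel_ideal"
    using I.I_r_closed[OF 1 KQ_single[of a j 1]] unfolding j[symmetric] path_from_mult_single n .
qed

theorem nakayama_algebra_ends:
  "cyclic_nakayama_ends (nakayama_algebra N r k :: 'k::field nakayama) N
    (\<lambda>a. rel_ideal +>\<^bsub>KQ\<^esub> idem a) (\<lambda>p. rel_ideal +>\<^bsub>KQ\<^esub> arrow_poly p) proj_length r"
proof -
  let ?L = "nakayama_algebra N r k :: 'k nakayama"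
  let ?q = "\<lambda>f :: (nat, nat) qpath \<Rightarrow>\<^sub>0 'k. rel_ideal +>\<^bsub>KQ\<^esub> f"
  interpret P: ring "KQ :: ((nat, nat) qpath \<Rightarrow>\<^sub>0 'k) ring" by (rule KQ_ring)
  interpret I: ideal "rel_ideal :: ((nat, nat) qpath \<Rightarrow>\<^sub>0 'k) set" KQ by (rule ideal_rel_ideal)
  have L: "?L = KQ Quot rel_ideal" by (simp add: nakayama_algebra_def)
  interpret L: ring ?L unfolding L by (rule I.quotient_is_ring)
  have hom: "?q \<in> ring_hom KQ ?L" unfolding L by (rule I.rcos_ring_hom)
  have surj: "\<exists>f \<in> carrier KQ. u = ?q f" if "u \<in> carrier ?L" for u
    using that unfolding L by (auto simp: FactRing_def A_RCOSETS_def')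
  have zero: "?q f = \<zero>\<^bsub>?L\<^esub> \<longleftrightarrow> f \<in> rel_ideal" if "f \<in> carrier KQ" for f
    using that I.rcos_const_imp_mem[of f] I.a_rcos_const[of f] unfolding L FactRing_def by auto
  have sum: "(\<Oplus>\<^bsub>?L\<^esub>i\<in>J. ?q (g i)) = ?q (sum g J)" if "finite J" "\<And>i. g i \<in> carrier KQ" for J :: "nat set" and g
    using that
  proof (induction J)
    case empty
    then show ?case using ring_hom_zero[OF hom P.ring_axioms L.ring_axioms] by (simp add: KQ_zero)
  next
    case (insert i J)
    then show ?case
      using ring_hom_closed[OF hom] ring_hom_add[OF hom, of "g i" "sum g J"]
      by (simp add: KQ_add KQ_sum Pi_iff)
  qed
  show ?thesis
  proof
    show "N > 0" by (rule N_pos)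
    show "?q (idem a) \<in> carrier ?L" for a by (rule ring_hom_closed[OF hom idem_carrier])
    show "?q (idem (a + int N)) = ?q (idem a)" for a by (simp add: idem_shift)
    show "?q (idem a) \<otimes>\<^bsub>?L\<^esub> ?q (idem a) = ?q (idem a)" for a
      unfolding ring_hom_mult[OF hom idem_carrier idem_carrier, symmetric] idem_idem ..
    have "(\<Oplus>\<^bsub>?L\<^esub>i\<in>{..<N}. ?q (idem (int i))) = ?q (\<Sum>i<N. idem (int i))"
      by (rule sum) (simp_all add: idem_carrier)
    also have "\<dots> = \<one>\<^bsub>?L\<^esub>" using ring_hom_one[OF hom] by (simp add: KQ_one idem_def)
    finally show "(\<Oplus>\<^bsub>?L\<^esub>i\<in>{..<N}. ?q (idem (int i))) = \<one>\<^bsub>?L\<^esub>" .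
    show "?q (arrow_poly p) \<in> carrier ?L" for p by (rule ring_hom_closed[OF hom arrow_poly_carrier])
    show "?q (arrow_poly (p + q)) = ?q (arrow_poly p) \<oplus>\<^bsub>?L\<^esub> ?q (arrow_poly q)" for p q
      using ring_hom_add[OF hom arrow_poly_carrier[of p] arrow_poly_carrier[of q]]
      by (simp add: arrow_poly_add KQ_add)
    show "?q (arrow_poly (p * q)) = ?q (arrow_poly p) \<otimes>\<^bsub>?L\<^esub> ?q (arrow_poly q)" for p q
      using ring_hom_mult[OF hom arrow_poly_carrier[of p] arrow_poly_carrier[of q]]
      by (simp add: arrow_poly_mult)
    show "?q (arrow_poly 1) = \<one>\<^bsub>?L\<^esub>" using ring_hom_one[OF hom] by (simp add: arrow_poly_one)
    show "?q (arrow_poly (monom 1 (Suc 0))) \<otimes>\<^bsub>?L\<^esub> ?q (idem a)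
        = ?q (idem (a + 1)) \<otimes>\<^bsub>?L\<^esub> ?q (arrow_poly (monom 1 (Suc 0)))" for a
      using ring_hom_mult[OF hom arrow_poly_carrier idem_carrier] ring_hom_mult[OF hom idem_carrier arrow_poly_carrier]
      by (metis arrow_poly_X_idem)
    show "?q (arrow_poly [:z:]) \<otimes>\<^bsub>?L\<^esub> ?q (idem a) = ?q (idem a) \<otimes>\<^bsub>?L\<^esub> ?q (arrow_poly [:z:])" for z a
      using ring_hom_mult[OF hom arrow_poly_carrier idem_carrier] ring_hom_mult[OF hom idem_carrier arrow_poly_carrier]
      by (metis arrow_poly_const_idem)
    show "\<exists>p. u \<otimes>\<^bsub>?L\<^esub> ?q (idem a) = ?q (arrow_poly p) \<otimes>\<^bsub>?L\<^esub> ?q (idem a)" if u: "u \<in> carrier ?L" for u a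
    proof -
      obtain f where f: "f \<in> carrier KQ" "u = ?q f" using surj[OF u] by blast
      obtain p where "f \<otimes>\<^bsub>KQ\<^esub> idem a = arrow_poly p \<otimes>\<^bsub>KQ\<^esub> idem a" using mult_idem_eq_arrow_poly[OF f(1)] by blast
      then show ?thesis
        using ring_hom_mult[OF hom f(1) idem_carrier] ring_hom_mult[OF hom arrow_poly_carrier idem_carrier]
        unfolding f(2) by metis
    qed
    show "?q (arrow_poly (monom 1 n)) \<otimes>\<^bsub>?L\<^esub> ?q (idem a) = \<zero>\<^bsub>?L\<^esub> \<longleftrightarrow> proj_length a \<le> n" for n a
      unfolding ring_hom_mult[OF hom arrow_poly_carrier idem_carrier, symmetric] t_idem zero[OF KQ_single]
        single_mem_rel_ideal_iff proj_length_le_iff ..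
    show "card (range (\<lambda>a. (a + int (proj_length a)) mod int N)) \<le> r" by (rule card_proj_ends)
  qed
qed

end

section \<open>The bounds\<close>

theorem theoremB:
  fixes N r :: nat and k :: "nat \<Rightarrow> nat" and \<Lambda> :: "'k::alg_closed_field nakayama"
  assumes "N \<ge> 2" and "r \<ge> 1"
    and "1 \<le> k 1"
    and "\<forall>i\<in>{1..<r}. k (2 * i - 1) < k (2 * i + 1)"
    and "k (2 * r - 1) \<le> N"
    and "\<forall>i\<in>{1..r}. k (2 * i - 1) < k (2 * i)"
    and "\<forall>i\<in>{1..r}. (nakayama_relation N k i :: (nat, nat) qpath \<Rightarrow>\<^sub>0 'k)
           \<notin> nakayama_ideal N k ({1..r} - {i})"
    and "\<Lambda> = nakayama_algebra N r k"
    and "\<not> selfinjective \<Lambda>"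
  shows "phi_dim \<Lambda> \<le> enat (2 * r) \<and>
    fin_dim \<Lambda> \<le> enat (2 * r) \<and>
    (gorenstein \<Lambda> \<longrightarrow> gor_dim \<Lambda> \<le> enat (2 * r)) \<and>
    dom_dim \<Lambda> \<le> enat (2 * r)"
proof -
  have "1 \<le> i \<Longrightarrow> i \<le> r \<Longrightarrow> 1 \<le> k (2 * i - 1)" for i
  proof (induction i rule: nat_induct_at_least)
    case base
    then show ?case using assms(3) by simp
  next
    case (Suc i)
    then have "k (2 * i - 1) < k (2 * i + 1)" using assms(4) by auto
    then show ?case using Suc by simp
  qed
  then interpret nakayama_presentation N r k
    using assms(1,2,6) by unfold_locales (auto simp: less_imp_le)
  interpret L: cyclic_nakayama_ends \<Lambda> N "\<lambda>a. rel_ideal +>\<^bsub>KQ\<^esub> idem a" "\<lambda>p. rel_ideal +>\<^bsub>KQ\<^esub> arrow_poly p" proj_length r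
    unfolding assms(8) by (rule nakayama_algebra_ends)
  show ?thesis
    using L.phi_dim_bound L.fin_dim_bound L.gor_dim_bound L.dom_dim_bound[OF assms(9)] by blast
qed

end
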